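(* Let $\varphi\colon G\times M\to M$ be a left action of a Lie group $G$ on an analytic manifold $M$ (continuous in $G$) that is sated and analytic in $M$. Let $I$ be an open interval and $\gamma\colon I\to M$ a free analytic immersion that is positive. 1) There exists a unique class $[e]\neq[h]\in G/G_\gamma$ such that for each $A$-decomposition $(\{a_n\}_{n\in\mathfrak n},\{[g_n]\}_{n\in\mathfrak n})$ of $\gamma$ ($A\subseteq I$ any compact maximal interval) one has $[h_n]=[h^{\mathrm{sgn}(n)}]$ for all $n\in\mathfrak n$. In particular, $[g_n]=[h^n]$ for all $n\in\mathfrak n$, hence $h^n\cdot\gamma|_A\leadsto_+\gamma|_{A_n}$ for all $n\in\mathfrak n$. 2) For each compact maximal interval $A\subseteq I$ and each $A$-decomposition $(\{a_n\}_{n\in\mathfrak n},\{[g_n]\}_{n\in\mathfrak n})$ of $\gamma$, with associated intervals $A_n$ ($\mathfrak n_-\le n\le\mathfrak n_+$): given $\mathfrak n_-<n\le0$ and $b'\in\mathrm{int}[A_{n-1}]$, there exists $b\in\mathrm{int}[A_n]$ such that $[b',b]$ is positive; and given $0\le n<\mathfrak n_+$ and $b\in\mathrm{int}[A_{n+1}]$, there exists $b'\in\mathrm{int}[A_n]$ such that $[b',b]$ is positive. In particular, for each $t\in I$ there exists a positive interval $A_t$ with $t\in\mathrm{int}[A_t]$.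
   Context: Intervals are connected subsets of $\mathbb{R}$ with non-empty interior. $M$ is a finite-dimensional Hausdorff real-analytic manifold without boundary (second countability not assumed); $G$ is a Lie group (same conventions); $\varphi$, $(g,x)\mapsto g\cdot x$, is a left action with $g\mapsto g\cdot x$ continuous for each $x\in M$. $\varphi$ is analytic in $M$ if $x\mapsto g\cdot x$ is analytic for each $g\in G$. $\varphi$ is sated if for mutually different $x,y,z\in M$ there is no sequence $\{g_n\}\subseteq G$ with $\lim_n g_n\cdot y=x=\lim_n g_n\cdot z$. A curve $\gamma\colon D\to M$ on an interval is an analytic immersion (embedding) if it is the restriction of an analytic immersion (analytic immersion that is a homeomorphism onto its image) on an open interval containing $D$. An analytic diffeomorphism between intervals is a bijection that extends to an analytic diffeomorphism between open intervals. $(g\cdot\gamma)(t)=g\cdot\gamma(t)$, $G_\gamma=\{g: g\cdot\gamma=\gamma\}$, $[g]=gG_\gamma\in G/G_\gamma$. For analytic immersions, $\gamma\sim_\circ\gamma'$ means $\gamma(J)=\gamma'(J')$ for non-empty open intervals $J\subseteq\mathrm{dom}[\gamma]$, $J'\subseteq\mathrm{dom}[\gamma']$ on which $\gamma,\gamma'$ are embeddings. An analytic immersion $\delta$ is a free segment if for all $g\in G$: $g\cdot\delta\sim_\circ\delta$ implies $g\in G_\delta$. $\gamma$ is free if its restriction to some interval is a free segment. An interval $A\subseteq I$ is free if $\gamma|_A$ is a free segment; maximal if free and not properly contained in a free interval $A'\subseteq I$. Let $\tilde\gamma\colon\tilde D\to M$, $\gamma\colon D\to M$ be analytic immersions with $\tilde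 D$ compact. $\tilde\gamma\leadsto\gamma$ w.r.t. $\mu$ means: $\mu\colon\tilde D\supseteq\mathrm{dom}[\mu]\to D$ is an analytic diffeomorphism between intervals (onto $D$) with $\tilde\gamma|_{\mathrm{dom}[\mu]}=\gamma\circ\mu$, and either $\mathrm{dom}[\mu]=\tilde D$ and $D$ is compact, or $\mathrm{dom}[\mu]$ and $D$ are half-open and $\mathrm{dom}[\mu]$ contains an endpoint of $\tilde D$. Write $\leadsto_+$ (resp. $\leadsto_-$) if $\mu$ is increasing (resp. decreasing). Let $I=(i',i)$ and $A\subseteq I$ a compact free interval. An $A$-decomposition of $\gamma$ is a pair $(\{a_n\}_{n\in\mathfrak n},\{[g_n]\}_{n\in\mathfrak n})$ with $\mathfrak n=\{n\in\mathbb{Z}_{\ne0}:\mathfrak n_-\le n\le\mathfrak n_+\}$, $-\infty\le\mathfrak n_-<0<\mathfrak n_+\le\infty$, $a_n\in I$ strictly increasing in $n$, $g_n\in G$, $[g_{\pm1}]\ne[e]$, such that with $A_0=[a_{-1},a_1]$, $A_n=[a_{n-1},a_n]$ for $\mathfrak n_-<n\le-1$, $A_n=[a_n,a_{n+1}]$ for $1\le n<\mathfrak n_+$, $A_{\mathfrak n_-}=(i',a_{\mathfrak n_-}]$ if $\mathfrak n_-\neq-\infty$, $A_{\mathfrak n_+}=[a_{\mathfrak n_+},i)$ if $\mathfrak n_+\ne\infty$, one has $A_0=A$ and $g_n\cdot\gamma|_A\leadsto\gamma|_{A_n}$ for all $n\in\mathfrak n$. (If $\varphi$ is sated and analytic in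 $M$, every compact maximal interval $A$ admits exactly one $A$-decomposition, and $A$ is maximal whenever an $A$-decomposition exists.) Put $h_{\pm1}=g_{\pm1}$, $h_n=g_n g_{n+1}^{-1}$ for $\mathfrak n_-\le n\le-2$, and $h_n=g_ng_{n-1}^{-1}$ for $2\le n\le\mathfrak n_+$. A compact maximal interval $A$ is positive (negative) if in its $A$-decomposition both $g_{1}\cdot\gamma|_A\leadsto_+\gamma|_{A_{1}}$ and $g_{-1}\cdot\gamma|_A\leadsto_+\gamma|_{A_{-1}}$ (resp. both with $\leadsto_-$). $\gamma$ is positive if it admits a positive compact maximal interval (then every compact maximal interval is positive). "Positive interval" means positive compact maximal interval. *)

theory Defs
  imports
    "HOL-Analysis.Analysis"
    "HOL-Algebra.Group_Action"
    "HOL-Algebra.Left_Coset"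
    "HOL-Library.Extended"
begin

section \<open>Real-analytic manifolds and Lie groups\<close>

text \<open>Points of \<^term>\<open>Euclidean_space n\<close> are functions \<^typ>\<open>nat \<Rightarrow> real\<close> vanishing from
  index \<open>n\<close> on; this covers all dimensions including \<open>0\<close> (discrete groups).\<close>

definition multi_indices :: "nat \<Rightarrow> (nat \<Rightarrow> nat) set" where
  "multi_indices n = {\<alpha>. \<forall>i\<ge>n. \<alpha> i = 0}"

text \<open>Only used for \<open>W\<close> open in \<^term>\<open>Euclidean_space n\<close>: each of the \<open>m\<close> components of \<open>F\<close> is
  locally an (unconditionally, hence absolutely) convergent power series in \<open>n\<close> variables.\<close>

definition real_analytic_on ::
    "nat \<Rightarrow> nat \<Rightarrow> (nat \<Rightarrow> real) set \<Rightarrow> ((nat \<Rightarrow> real) \<Rightarrow> (nat \<Rightarrow> real)) \<Rightarrow> bool" where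
  "real_analytic_on n m W F \<longleftrightarrow>
     (\<forall>x\<in>W. \<forall>j<m. \<exists>c r. r > 0 \<and>
        (\<forall>y\<in>W. (\<forall>i<n. \<bar>y i - x i\<bar> < r) \<longrightarrow>
           ((\<lambda>\<alpha>. c \<alpha> * (\<Prod>i<n. (y i - x i) ^ \<alpha> i)) has_sum F y j) (multi_indices n)))"

record 'a manifold =
  mtop :: "'a topology"
  mdim :: nat
  charts :: "('a set \<times> ('a \<Rightarrow> nat \<Rightarrow> real)) set"

definition analytic_manifold :: "'a manifold \<Rightarrow> bool" where
  "analytic_manifold M \<longleftrightarrow>
     Hausdorff_space (mtop M) \<and>
     topspace (mtop M) = \<Union>(fst ` charts M) \<and>
     (\<forall>(U, f)\<in>charts M.
        openin (mtop M) U \<and>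
        openin (Euclidean_space (mdim M)) (f ` U) \<and>
        homeomorphic_map (subtopology (mtop M) U)
          (subtopology (Euclidean_space (mdim M)) (f ` U)) f) \<and>
     (\<forall>(U, f)\<in>charts M. \<forall>(V, g)\<in>charts M.
        real_analytic_on (mdim M) (mdim M) (f ` (U \<inter> V)) (g \<circ> inv_into U f))"

definition analytic_map :: "'a manifold \<Rightarrow> 'b manifold \<Rightarrow> ('a \<Rightarrow> 'b) \<Rightarrow> bool" where
  "analytic_map M N F \<longleftrightarrow>
     continuous_map (mtop M) (mtop N) F \<and>
     (\<forall>(U, f)\<in>charts M. \<forall>(V, g)\<in>charts N.
        real_analytic_on (mdim M) (mdim N) (f ` (U \<inter> F -` V)) (g \<circ> F \<circ> inv_into U f))"

text \<open>Chart coordinates are concatenated.\<close>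

definition prod_manifold :: "'a manifold \<Rightarrow> 'b manifold \<Rightarrow> ('a \<times> 'b) manifold" where
  "prod_manifold M N =
     \<lparr>mtop = prod_topology (mtop M) (mtop N),
      mdim = mdim M + mdim N,
      charts = (\<lambda>((U, f), (V, g)).
          (U \<times> V, \<lambda>(x, y) i. if i < mdim M then f x i else g y (i - mdim M))) `
        (charts M \<times> charts N)\<rparr>"

definition lie_group :: "('g, 'r) monoid_scheme \<Rightarrow> 'g manifold \<Rightarrow> bool" where
  "lie_group G L \<longleftrightarrow>
     group G \<and> analytic_manifold L \<and> topspace (mtop L) = carrier G \<and>
     analytic_map (prod_manifold L L) L (\<lambda>(g, h). g \<otimes>\<^bsub>G\<^esub> h) \<and>
     analytic_map L L (m_inv G)"

definition continuous_in_group ::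
    "('g, 'r) monoid_scheme \<Rightarrow> 'g manifold \<Rightarrow> 'm manifold \<Rightarrow> ('g \<Rightarrow> 'm \<Rightarrow> 'm) \<Rightarrow> bool" where
  "continuous_in_group G L M \<phi> \<longleftrightarrow>
     (\<forall>x\<in>topspace (mtop M). continuous_map (mtop L) (mtop M) (\<lambda>g. \<phi> g x))"

definition analytic_in_space ::
    "('g, 'r) monoid_scheme \<Rightarrow> 'm manifold \<Rightarrow> ('g \<Rightarrow> 'm \<Rightarrow> 'm) \<Rightarrow> bool" where
  "analytic_in_space G M \<phi> \<longleftrightarrow> (\<forall>g\<in>carrier G. analytic_map M M (\<phi> g))"

definition sated :: "('g, 'r) monoid_scheme \<Rightarrow> 'm manifold \<Rightarrow> ('g \<Rightarrow> 'm \<Rightarrow> 'm) \<Rightarrow> bool" where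
  "sated G M \<phi> \<longleftrightarrow>
     (\<forall>x\<in>topspace (mtop M). \<forall>y\<in>topspace (mtop M). \<forall>z\<in>topspace (mtop M).
        x \<noteq> y \<and> y \<noteq> z \<and> x \<noteq> z \<longrightarrow>
        \<not> (\<exists>g::nat \<Rightarrow> 'g. range g \<subseteq> carrier G \<and>
             limitin (mtop M) (\<lambda>n. \<phi> (g n) y) x sequentially \<and>
             limitin (mtop M) (\<lambda>n. \<phi> (g n) z) x sequentially))"


section \<open>Analytic curves\<close>

definition real_interval :: "real set \<Rightarrow> bool" where
  "real_interval D \<longleftrightarrow> connected D \<and> interior D \<noteq> {}"

definition open_interval :: "real set \<Rightarrow> bool" where
  "open_interval D \<longleftrightarrow> real_interval D \<and> open D"

definition half_open_interval :: "real set \<Rightarrow> bool" where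
  "half_open_interval D \<longleftrightarrow> real_interval D \<and>
     (\<exists>a b. D = {a..<b} \<or> D = {a<..b} \<or> D = {a..} \<or> D = {..b})"

definition real_analytic_at :: "(real \<Rightarrow> real) \<Rightarrow> real \<Rightarrow> bool" where
  "real_analytic_at f t \<longleftrightarrow> (\<exists>F. (\<lambda>h. f (t + h)) has_fps_expansion F)"

text \<open>A curve is a function together with an explicit domain; its values outside of the domain are
  irrelevant.\<close>

definition open_analytic_immersion :: "'m manifold \<Rightarrow> real set \<Rightarrow> (real \<Rightarrow> 'm) \<Rightarrow> bool" where
  "open_analytic_immersion M J \<gamma> \<longleftrightarrow>
     open_interval J \<and> continuous_map (top_of_set J) (mtop M) \<gamma> \<and>
     (\<forall>t\<in>J. \<forall>(U, f)\<in>charts M. \<gamma> t \<in> U \<longrightarrow>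
        (\<forall>i<mdim M. real_analytic_at (\<lambda>s. f (\<gamma> s) i) t) \<and>
        (\<exists>i<mdim M. deriv (\<lambda>s. f (\<gamma> s) i) t \<noteq> 0))"

definition analytic_immersion :: "'m manifold \<Rightarrow> real set \<Rightarrow> (real \<Rightarrow> 'm) \<Rightarrow> bool" where
  "analytic_immersion M D \<gamma> \<longleftrightarrow>
     real_interval D \<and>
     (\<exists>J \<delta>. D \<subseteq> J \<and> open_analytic_immersion M J \<delta> \<and> (\<forall>t\<in>D. \<delta> t = \<gamma> t))"

definition analytic_embedding :: "'m manifold \<Rightarrow> real set \<Rightarrow> (real \<Rightarrow> 'm) \<Rightarrow> bool" where
  "analytic_embedding M D \<gamma> \<longleftrightarrow>
     real_interval D \<and>
     (\<exists>J \<delta>. D \<subseteq> J \<and> open_analytic_immersion M J \<delta> \<and>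
        embedding_map (top_of_set J) (mtop M) \<delta> \<and> (\<forall>t\<in>D. \<delta> t = \<gamma> t))"

definition analytic_diffeo :: "real set \<Rightarrow> real set \<Rightarrow> (real \<Rightarrow> real) \<Rightarrow> bool" where
  "analytic_diffeo D E \<mu> \<longleftrightarrow>
     real_interval D \<and> real_interval E \<and> bij_betw \<mu> D E \<and>
     (\<exists>J K \<nu>. open_interval J \<and> open_interval K \<and> D \<subseteq> J \<and> E \<subseteq> K \<and>
        bij_betw \<nu> J K \<and> (\<forall>t\<in>D. \<nu> t = \<mu> t) \<and>
        (\<forall>t\<in>J. real_analytic_at \<nu> t) \<and> (\<forall>s\<in>K. real_analytic_at (the_inv_into J \<nu>) s))"

definition translate :: "('g \<Rightarrow> 'm \<Rightarrow> 'm) \<Rightarrow> 'g \<Rightarrow> (real \<Rightarrow> 'm) \<Rightarrow> real \<Rightarrow> 'm" where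
  "translate \<phi> g \<gamma> = (\<lambda>t. \<phi> g (\<gamma> t))"

definition curve_stabilizer ::
    "('g, 'r) monoid_scheme \<Rightarrow> ('g \<Rightarrow> 'm \<Rightarrow> 'm) \<Rightarrow> real set \<Rightarrow> (real \<Rightarrow> 'm) \<Rightarrow> 'g set" where
  "curve_stabilizer G \<phi> D \<gamma> = {g \<in> carrier G. \<forall>t\<in>D. translate \<phi> g \<gamma> t = \<gamma> t}"

definition curve_class ::
    "('g, 'r) monoid_scheme \<Rightarrow> ('g \<Rightarrow> 'm \<Rightarrow> 'm) \<Rightarrow> real set \<Rightarrow> (real \<Rightarrow> 'm) \<Rightarrow> 'g \<Rightarrow> 'g set" where
  "curve_class G \<phi> D \<gamma> g = g <#\<^bsub>G\<^esub> curve_stabilizer G \<phi> D \<gamma>"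


section \<open>Free intervals\<close>

definition overlap ::
    "'m manifold \<Rightarrow> real set \<Rightarrow> (real \<Rightarrow> 'm) \<Rightarrow> real set \<Rightarrow> (real \<Rightarrow> 'm) \<Rightarrow> bool" where
  "overlap M D \<gamma> D' \<gamma>' \<longleftrightarrow>
     (\<exists>J J'. open_interval J \<and> J \<subseteq> D \<and> open_interval J' \<and> J' \<subseteq> D' \<and>
        analytic_embedding M J \<gamma> \<and> analytic_embedding M J' \<gamma>' \<and> \<gamma> ` J = \<gamma>' ` J')"

definition free_segment ::
    "('g, 'r) monoid_scheme \<Rightarrow> 'm manifold \<Rightarrow> ('g \<Rightarrow> 'm \<Rightarrow> 'm) \<Rightarrow> real set \<Rightarrow> (real \<Rightarrow> 'm) \<Rightarrow> bool" where
  "free_segment G M \<phi> D \<delta> \<longleftrightarrow>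
     analytic_immersion M D \<delta> \<and>
     (\<forall>g\<in>carrier G. overlap M D (translate \<phi> g \<delta>) D \<delta> \<longrightarrow> g \<in> curve_stabilizer G \<phi> D \<delta>)"

definition free_interval ::
    "('g, 'r) monoid_scheme \<Rightarrow> 'm manifold \<Rightarrow> ('g \<Rightarrow> 'm \<Rightarrow> 'm) \<Rightarrow> real set \<Rightarrow> (real \<Rightarrow> 'm) \<Rightarrow>
      real set \<Rightarrow> bool" where
  "free_interval G M \<phi> I \<gamma> A \<longleftrightarrow> real_interval A \<and> A \<subseteq> I \<and> free_segment G M \<phi> A \<gamma>"

definition free_curve ::
    "('g, 'r) monoid_scheme \<Rightarrow> 'm manifold \<Rightarrow> ('g \<Rightarrow> 'm \<Rightarrow> 'm) \<Rightarrow> real set \<Rightarrow> (real \<Rightarrow> 'm) \<Rightarrow> bool" where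
  "free_curve G M \<phi> I \<gamma> \<longleftrightarrow> (\<exists>A. free_interval G M \<phi> I \<gamma> A)"

definition maximal_interval ::
    "('g, 'r) monoid_scheme \<Rightarrow> 'm manifold \<Rightarrow> ('g \<Rightarrow> 'm \<Rightarrow> 'm) \<Rightarrow> real set \<Rightarrow> (real \<Rightarrow> 'm) \<Rightarrow>
      real set \<Rightarrow> bool" where
  "maximal_interval G M \<phi> I \<gamma> A \<longleftrightarrow>
     free_interval G M \<phi> I \<gamma> A \<and> \<not> (\<exists>A'. A \<subset> A' \<and> free_interval G M \<phi> I \<gamma> A')"

definition compact_maximal_interval ::
    "('g, 'r) monoid_scheme \<Rightarrow> 'm manifold \<Rightarrow> ('g \<Rightarrow> 'm \<Rightarrow> 'm) \<Rightarrow> real set \<Rightarrow> (real \<Rightarrow> 'm) \<Rightarrow>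
      real set \<Rightarrow> bool" where
  "compact_maximal_interval G M \<phi> I \<gamma> A \<longleftrightarrow> compact A \<and> maximal_interval G M \<phi> I \<gamma> A"


section \<open>Decompositions\<close>

text \<open>In \<open>leads_wrt M C \<beta> D \<gamma> K \<mu>\<close>, the set \<open>K \<subseteq> C\<close> is the domain of \<open>\<mu>\<close>.\<close>

definition leads_wrt ::
    "'m manifold \<Rightarrow> real set \<Rightarrow> (real \<Rightarrow> 'm) \<Rightarrow> real set \<Rightarrow> (real \<Rightarrow> 'm) \<Rightarrow>
      real set \<Rightarrow> (real \<Rightarrow> real) \<Rightarrow> bool" where
  "leads_wrt M C \<beta> D \<gamma> K \<mu> \<longleftrightarrow>
     analytic_immersion M C \<beta> \<and> analytic_immersion M D \<gamma> \<and> compact C \<and>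
     K \<subseteq> C \<and> analytic_diffeo K D \<mu> \<and> (\<forall>t\<in>K. \<beta> t = \<gamma> (\<mu> t)) \<and>
     (K = C \<and> compact D \<or>
      half_open_interval K \<and> half_open_interval D \<and> (Inf C \<in> K \<or> Sup C \<in> K))"

definition leads ::
    "'m manifold \<Rightarrow> real set \<Rightarrow> (real \<Rightarrow> 'm) \<Rightarrow> real set \<Rightarrow> (real \<Rightarrow> 'm) \<Rightarrow> bool" where
  "leads M C \<beta> D \<gamma> \<longleftrightarrow> (\<exists>K \<mu>. leads_wrt M C \<beta> D \<gamma> K \<mu>)"

definition leads_pos ::
    "'m manifold \<Rightarrow> real set \<Rightarrow> (real \<Rightarrow> 'm) \<Rightarrow> real set \<Rightarrow> (real \<Rightarrow> 'm) \<Rightarrow> bool" where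
  "leads_pos M C \<beta> D \<gamma> \<longleftrightarrow> (\<exists>K \<mu>. leads_wrt M C \<beta> D \<gamma> K \<mu> \<and> strict_mono_on K \<mu>)"

definition dec_index :: "int extended \<Rightarrow> int extended \<Rightarrow> int set" where
  "dec_index l u = {n. n \<noteq> 0 \<and> l \<le> Fin n \<and> Fin n \<le> u}"

text \<open>For \<open>I = (i', i)\<close> with \<open>-\<infinity> \<le> i' < i \<le> \<infinity>\<close>, the outermost intervals \<open>(i', a\<^sub>n]\<close> and \<open>[a\<^sub>n, i)\<close>
  are written as \<open>{t \<in> I. t \<le> a n}\<close> and \<open>{t \<in> I. a n \<le> t}\<close>.\<close>

definition dec_interval ::
    "real set \<Rightarrow> int extended \<Rightarrow> int extended \<Rightarrow> (int \<Rightarrow> real) \<Rightarrow> int \<Rightarrow> real set" where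
  "dec_interval I l u a n =
     (if n = 0 then {a (- 1)..a 1}
      else if Fin n = l then {t \<in> I. t \<le> a n}
      else if Fin n = u then {t \<in> I. a n \<le> t}
      else if n < 0 then {a (n - 1)..a n}
      else {a n..a (n + 1)})"

text \<open>The classes \<open>[g\<^sub>n]\<close> are given by representatives \<open>g n\<close>.\<close>

definition decomposition ::
    "('g, 'r) monoid_scheme \<Rightarrow> 'm manifold \<Rightarrow> ('g \<Rightarrow> 'm \<Rightarrow> 'm) \<Rightarrow> real set \<Rightarrow> (real \<Rightarrow> 'm) \<Rightarrow>
      real set \<Rightarrow> int extended \<Rightarrow> int extended \<Rightarrow> (int \<Rightarrow> real) \<Rightarrow> (int \<Rightarrow> 'g) \<Rightarrow> bool" where
  "decomposition G M \<phi> I \<gamma> A l u a g \<longleftrightarrow>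
     compact A \<and> free_interval G M \<phi> I \<gamma> A \<and>
     l < Fin 0 \<and> Fin 0 < u \<and>
     a ` dec_index l u \<subseteq> I \<and> strict_mono_on (dec_index l u) a \<and>
     g ` dec_index l u \<subseteq> carrier G \<and>
     curve_class G \<phi> I \<gamma> (g 1) \<noteq> curve_class G \<phi> I \<gamma> \<one>\<^bsub>G\<^esub> \<and>
     curve_class G \<phi> I \<gamma> (g (- 1)) \<noteq> curve_class G \<phi> I \<gamma> \<one>\<^bsub>G\<^esub> \<and>
     dec_interval I l u a 0 = A \<and>
     (\<forall>n\<in>dec_index l u. leads M A (translate \<phi> (g n) \<gamma>) (dec_interval I l u a n) \<gamma>)"

definition dec_step :: "('g, 'r) monoid_scheme \<Rightarrow> (int \<Rightarrow> 'g) \<Rightarrow> int \<Rightarrow> 'g" where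
  "dec_step G g n =
     (if n = 1 \<or> n = - 1 then g n
      else if n < 0 then g n \<otimes>\<^bsub>G\<^esub> inv\<^bsub>G\<^esub> g (n + 1)
      else g n \<otimes>\<^bsub>G\<^esub> inv\<^bsub>G\<^esub> g (n - 1))"

definition positive_interval ::
    "('g, 'r) monoid_scheme \<Rightarrow> 'm manifold \<Rightarrow> ('g \<Rightarrow> 'm \<Rightarrow> 'm) \<Rightarrow> real set \<Rightarrow> (real \<Rightarrow> 'm) \<Rightarrow>
      real set \<Rightarrow> bool" where
  "positive_interval G M \<phi> I \<gamma> A \<longleftrightarrow>
     compact_maximal_interval G M \<phi> I \<gamma> A \<and>
     (\<exists>l u a g. decomposition G M \<phi> I \<gamma> A l u a g \<and>
        leads_pos M A (translate \<phi> (g 1) \<gamma>) (dec_interval I l u a 1) \<gamma> \<and>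
        leads_pos M A (translate \<phi> (g (- 1)) \<gamma>) (dec_interval I l u a (- 1)) \<gamma>)"

definition positive_curve ::
    "('g, 'r) monoid_scheme \<Rightarrow> 'm manifold \<Rightarrow> ('g \<Rightarrow> 'm \<Rightarrow> 'm) \<Rightarrow> real set \<Rightarrow> (real \<Rightarrow> 'm) \<Rightarrow> bool" where
  "positive_curve G M \<phi> I \<gamma> \<longleftrightarrow> (\<exists>A. positive_interval G M \<phi> I \<gamma> A)"

text \<open>The condition is imposed on every representative \<open>h\<close> of the class \<open>c\<close>.\<close>

definition step_class ::
    "('g, 'r) monoid_scheme \<Rightarrow> 'm manifold \<Rightarrow> ('g \<Rightarrow> 'm \<Rightarrow> 'm) \<Rightarrow> real set \<Rightarrow> (real \<Rightarrow> 'm) \<Rightarrow>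
      'g set \<Rightarrow> bool" where
  "step_class G M \<phi> I \<gamma> c \<longleftrightarrow>
     c \<in> lcosets\<^bsub>G\<^esub> (curve_stabilizer G \<phi> I \<gamma>) \<and>
     c \<noteq> curve_class G \<phi> I \<gamma> \<one>\<^bsub>G\<^esub> \<and>
     (\<forall>h\<in>c. \<forall>A l u a g.
        compact_maximal_interval G M \<phi> I \<gamma> A \<and> decomposition G M \<phi> I \<gamma> A l u a g \<longrightarrow>
        (\<forall>n\<in>dec_index l u.
           curve_class G \<phi> I \<gamma> (dec_step G g n) = curve_class G \<phi> I \<gamma> (h [^]\<^bsub>G\<^esub> sgn n)))"

end

theory Submission
  imports Defs "HOL-Complex_Analysis.Complex_Analysis"
begin

text \<open>Call a \<open>germ\<close> a local identity \<open>g \<cdot> \<gamma> = \<gamma> \<circ> \<mu>\<close> with \<open>\<mu>\<close> an analytic diffeomorphism between neighbourhoods of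
  two parameters. Germs form a groupoid, and an interval is free iff every germ with both ends in its
  interior belongs to the stabilizer. Let \<open>[p, q]\<close> be positive with \<open>h = g\<^sub>1\<close>; then \<open>h\<close> has an increasing germ
  from \<open>p\<close> to \<open>q\<close>. Its maximal continuation \<open>\<rho>\<close> satisfies \<open>h \<cdot> \<gamma> = \<gamma> \<circ> \<rho>\<close> and has no fixed point,
  since near a fixed point the iterates of \<open>h\<close> would contract an arc of \<open>\<gamma>\<close> to a point, contradicting
  satedness. Hence \<open>\<rho>(t) > t\<close>. The set of \<open>t\<close> for which \<open>[t, \<rho>(t)]\<close> is free is open and closed in
  the domain of \<open>\<rho>\<close>, so these intervals are all free; they are exactly the compact maximal intervals.
  Comparing germs at the common end points of neighbouring cells of a decomposition determines the classes
  and the orientations, because a decreasing germ of the identity would fold \<open>\<gamma>\<close> at a fixed point.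
  Iterating \<open>\<rho>\<close> and its inverse produces the decomposition of \<open>[t, \<rho>(t)]\<close>.\<close>

section \<open>Real-analytic functions of one variable\<close>

text \<open>The obstacle is that the stabilizer need not be normal: from [g] = [h] one may multiply
  from the left, but not from the right. If k has a germ, however, k moves an arc of \<gamma> into
  \<gamma>, and analytic continuation then justifies right multiplication by k. For this reason
  group elements are handled together with germs. New germs are found by one principle: if g \<cdot>
  \<gamma> and \<gamma> meet at parameters accumulating at (x, y), then g has a germ there. This
  asks for no open overlap and therefore also works at end points of intervals and at the boundary
  of a continuation. A germ with ends on the boundary of a free interval is pushed inside by a small
  shift in a suitable direction. The continuation \<rho> need not be defined on all of I. Its domain
  is downward closed and its range upward closed in I, and where iteration leaves the domain the
  outermost, half-open cells arise. Freeness passes from [u, \<rho>(u)] to nearby [t, \<rho>(t)]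
  because the latter arises by cutting off a piece at one end and moving it by h or its inverse to
  the other end.\<close>

text \<open>The power series becomes a holomorphic function on a disc, so that composition, the
  identity theorem and local inversion can be taken from complex analysis.\<close>

lemma real_analytic_at_iff_holomorphic:
  "real_analytic_at f t \<longleftrightarrow>
     (\<exists>F r. r > 0 \<and> F holomorphic_on ball (complex_of_real t) r \<and>
        (\<forall>x. \<bar>x - t\<bar> < r \<longrightarrow> F (of_real x) = complex_of_real (f x)))"
proof
  assume "real_analytic_at f t"
  then obtain F where F: "(\<lambda>h. f (t + h)) has_fps_expansion F"
    unfolding real_analytic_at_def by blast
  define Fc where "Fc = Abs_fps (\<lambda>n. complex_of_real (fps_nth F n))"
  have rad: "fps_conv_radius Fc = fps_conv_radius F"
    unfolding fps_conv_radius_def conv_radius_def Fc_def by simp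
  from F have pos: "fps_conv_radius F > 0"
    and ev: "eventually (\<lambda>h. eval_fps F h = f (t + h)) (nhds 0)"
    by (auto simp: has_fps_expansion_def)
  from ev obtain d where d: "d > 0" "\<And>h. \<bar>h\<bar> < d \<Longrightarrow> eval_fps F h = f (t + h)"
    by (auto simp: eventually_nhds_metric dist_real_def)
  obtain e where e: "0 < e" "ereal e < fps_conv_radius F"
    using pos ereal_dense2 by (metis ereal_less(2))
  define r where "r = min d e"
  have r: "r > 0" using d e by (simp add: r_def)
  have hol: "(\<lambda>z. eval_fps Fc (z - of_real t)) holomorphic_on ball (of_real t) r"
  proof (rule holomorphic_on_compose_gen[of "\<lambda>z. z - of_real t" _ "eval_fps Fc" "eball 0 (fps_conv_radius Fc)", unfolded o_def])
    show "eval_fps Fc holomorphic_on eball 0 (fps_conv_radius Fc)"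
      by (rule holomorphic_on_eval_fps) auto
    show "(\<lambda>z. z - complex_of_real t) ` ball (complex_of_real t) r \<subseteq> eball 0 (fps_conv_radius Fc)"
    proof clarify
      fix z assume "z \<in> ball (complex_of_real t) r"
      hence "ereal (norm (z - of_real t)) < ereal e"
        by (simp add: dist_norm norm_minus_commute r_def)
      also have "\<dots> < fps_conv_radius F" by (rule e)
      finally show "z - complex_of_real t \<in> eball 0 (fps_conv_radius Fc)"
        by (simp add: rad eball_def)
    qed
  qed (auto intro!: holomorphic_intros)
  have val: "eval_fps Fc (of_real x - of_real t) = complex_of_real (f x)" if "\<bar>x - t\<bar> < r" for x
  proof -
    have "ereal \<bar>x - t\<bar> < ereal e" using that by (simp add: r_def)
    also have "\<dots> < fps_conv_radius F" by (rule e)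
    finally have "summable (\<lambda>n. fps_nth F n * (x - t) ^ n)"
      by (intro summable_fps) simp
    from suminf_of_real[OF this, where 'a=complex]
    have "of_real (eval_fps F (x - t)) = eval_fps Fc (of_real x - of_real t)"
      by (simp add: eval_fps_def Fc_def)
    moreover have "eval_fps F (x - t) = f x"
      using d(2)[of "x - t"] that by (simp add: r_def)
    ultimately show ?thesis by simp
  qed
  show "\<exists>F r. r > 0 \<and> F holomorphic_on ball (complex_of_real t) r \<and>
        (\<forall>x. \<bar>x - t\<bar> < r \<longrightarrow> F (of_real x) = complex_of_real (f x))"
    using r hol val by blast
next
  assume "\<exists>F r. r > 0 \<and> F holomorphic_on ball (complex_of_real t) r \<and>
        (\<forall>x. \<bar>x - t\<bar> < r \<longrightarrow> F (of_real x) = complex_of_real (f x))"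
  then obtain F r where r: "r > 0" and hol: "F holomorphic_on ball (complex_of_real t) r"
    and val: "\<And>x. \<bar>x - t\<bar> < r \<Longrightarrow> F (of_real x) = complex_of_real (f x)" by blast
  have "F analytic_on {of_real t}"
    unfolding analytic_at using hol r by (intro exI[of _ "ball (of_real t) r"]) auto
  from analytic_at_imp_has_fps_expansion[OF this]
  obtain P where P: "(\<lambda>x. F (of_real t + x)) has_fps_expansion P" by blast
  \<comment> \<open>F is real on the real axis, so the real parts of its coefficients give a series
    for f there.\<close>
  define Q where "Q = Abs_fps (\<lambda>n. Re (fps_nth P n))"
  from P have pos: "fps_conv_radius P > 0"
    and ev: "eventually (\<lambda>h. eval_fps P h = F (of_real t + h)) (nhds 0)"
    by (auto simp: has_fps_expansion_def)
  have sums: "(\<lambda>n. fps_nth Q n * x ^ n) sums Re (eval_fps P (of_real x))"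
    if "ereal \<bar>x\<bar> < fps_conv_radius P" for x :: real
  proof -
    have "(\<lambda>n. fps_nth P n * of_real x ^ n) sums eval_fps P (of_real x)"
      by (rule sums_eval_fps) (use that in simp)
    from sums_Re[OF this] show ?thesis
      by (simp add: Q_def flip: of_real_power)
  qed
  have "fps_conv_radius Q \<ge> fps_conv_radius P"
    unfolding fps_conv_radius_def[of Q]
  proof (rule conv_radius_geI_ex')
    fix x :: real assume "0 < x" "ereal x < fps_conv_radius P"
    thus "summable (\<lambda>n. fps_nth Q n * of_real x ^ n)"
      using sums[of x] by (auto simp: sums_iff)
  qed
  hence posQ: "fps_conv_radius Q > 0" using pos by simp
  obtain e where e: "0 < e" "ereal e < fps_conv_radius P"
    using pos ereal_dense2 by (metis ereal_less(2))
  from ev obtain d where d: "d > 0" "\<And>h. norm h < d \<Longrightarrow> eval_fps P h = F (of_real t + h)"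
    by (auto simp: eventually_nhds_metric dist_norm)
  have "eval_fps Q x = f (t + x)" if x: "\<bar>x\<bar> < min e (min d r)" for x
  proof -
    have "ereal \<bar>x\<bar> < ereal e" using x by simp
    also have "\<dots> < fps_conv_radius P" by (rule e)
    finally have "eval_fps Q x = Re (eval_fps P (of_real x))"
      using sums[of x] by (simp add: eval_fps_def sums_iff)
    also have "eval_fps P (of_real x) = F (of_real (t + x))" using d(2)[of "of_real x"] x by simp
    also have "\<dots> = of_real (f (t + x))" using val[of "t + x"] x by simp
    finally show ?thesis by simp
  qed
  hence "eventually (\<lambda>x. eval_fps Q x = f (t + x)) (nhds 0)"
    unfolding eventually_nhds_metric using e d r
    by (intro exI[of _ "min e (min d r)"]) (auto simp: dist_real_def)
  with posQ show "real_analytic_at f t"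
    unfolding real_analytic_at_def has_fps_expansion_def by blast
qed

lemma real_analytic_atE:
  assumes "real_analytic_at f t"
  obtains F r where "r > 0" "F holomorphic_on ball (complex_of_real t) r"
    "\<And>x. \<bar>x - t\<bar> < r \<Longrightarrow> F (of_real x) = complex_of_real (f x)"
  using assms unfolding real_analytic_at_iff_holomorphic by blast

lemma real_analytic_atI:
  assumes "r > 0" "F holomorphic_on ball (complex_of_real t) r"
    "\<And>x. \<bar>x - t\<bar> < r \<Longrightarrow> F (of_real x) = complex_of_real (f x)"
  shows "real_analytic_at f t"
  using assms unfolding real_analytic_at_iff_holomorphic by blast

lemma real_analytic_at_cong:
  assumes "eventually (\<lambda>x. f x = g x) (nhds t)"
  shows "real_analytic_at f t \<longleftrightarrow> real_analytic_at g t"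
proof -
  have "real_analytic_at g t" if f: "real_analytic_at f t" and ev: "eventually (\<lambda>x. f x = g x) (nhds t)" for f g
  proof -
    from f obtain F r where F: "r > 0" "F holomorphic_on ball (complex_of_real t) r"
      "\<And>x. \<bar>x - t\<bar> < r \<Longrightarrow> F (of_real x) = complex_of_real (f x)" by (rule real_analytic_atE) blast
    from ev obtain d where "d > 0" "\<And>x. \<bar>x - t\<bar> < d \<Longrightarrow> f x = g x"
      by (auto simp: eventually_nhds_metric dist_real_def)
    thus ?thesis using F
      by (intro real_analytic_atI[of "min d r" F]) (auto intro: holomorphic_on_subset)
  qed
  from this[of f g] this[of g f] assms show ?thesis by (auto simp: eq_commute)
qed

lemma real_analytic_at_ident: "real_analytic_at (\<lambda>x. x) t"
  by (rule real_analytic_atI[of 1 "\<lambda>z. z"]) auto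

lemma real_analytic_at_diff:
  assumes "real_analytic_at f t" "real_analytic_at g t"
  shows "real_analytic_at (\<lambda>x. f x - g x) t"
  using assms unfolding real_analytic_at_def
  using has_fps_expansion_diff by fast

lemma real_analytic_at_eventually:
  assumes "real_analytic_at f t"
  shows "eventually (real_analytic_at f) (nhds t)"
proof -
  from assms obtain F r where F: "r > 0" "F holomorphic_on ball (complex_of_real t) r"
    "\<And>x. \<bar>x - t\<bar> < r \<Longrightarrow> F (of_real x) = complex_of_real (f x)" by (rule real_analytic_atE) blast
  have "real_analytic_at f s" if s: "\<bar>s - t\<bar> < r" for s
  proof (rule real_analytic_atI[of "r - \<bar>s - t\<bar>" F])
    show "r - \<bar>s - t\<bar> > 0" using s by simp
    have "ball (complex_of_real s) (r - \<bar>s - t\<bar>) \<subseteq> ball (of_real t) r"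
      using s by (intro ball_subset_ball_iff[THEN iffD2]) (auto simp: dist_norm simp flip: of_real_diff)
    thus "F holomorphic_on ball (complex_of_real s) (r - \<bar>s - t\<bar>)"
      using F(2) by (rule holomorphic_on_subset[rotated])
    show "F (of_real x) = of_real (f x)" if "\<bar>x - s\<bar> < r - \<bar>s - t\<bar>" for x
      using that by (intro F(3)) linarith
  qed
  thus ?thesis using F(1) by (auto simp: eventually_nhds_metric dist_real_def)
qed

text \<open>The derivative is supplied as a function near t that is continuous at t, because
  \<open>germE\<close> needs its sign to persist on a neighbourhood.\<close>

lemma real_analytic_at_derivE:
  assumes "real_analytic_at f t"
  obtains f' where "eventually (\<lambda>x. (f has_real_derivative f' x) (at x)) (nhds t)" "isCont f' t"
    "f' t = deriv f t"
proof -
  from assms obtain F r where F: "r > 0" "F holomorphic_on ball (complex_of_real t) r"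
    "\<And>x. \<bar>x - t\<bar> < r \<Longrightarrow> F (of_real x) = complex_of_real (f x)" by (rule real_analytic_atE) blast
  define f' where "f' = (\<lambda>x::real. Re (deriv F (of_real x)))"
  have der: "(f has_real_derivative f' x) (at x)" if x: "\<bar>x - t\<bar> < r" for x
  proof -
    have "complex_of_real x \<in> ball (of_real t) r"
      using x by (simp add: dist_norm norm_minus_commute flip: of_real_diff)
    hence "(F has_field_derivative deriv F (of_real x)) (at (of_real x))"
      using F(2) by (intro holomorphic_derivI[OF F(2)]) auto
    from bounded_linear.has_vector_derivative[OF bounded_linear_Re has_vector_derivative_real_field[OF this, of UNIV]]
    have "((\<lambda>y. Re (F (of_real y))) has_real_derivative f' x) (at x)"
      by (simp add: f'_def has_real_derivative_iff_has_vector_derivative)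
    thus ?thesis
      by (rule has_field_derivative_transform_within_open[where S="ball t r"])
         (use x in \<open>auto simp: dist_real_def F(3)\<close>)
  qed
  have cont: "isCont f' t"
  proof -
    have "isCont (deriv F) (of_real t)"
      using continuous_on_interior[OF holomorphic_on_imp_continuous_on[OF holomorphic_deriv[OF F(2) open_ball]]] F(1)
      by simp
    moreover have "isCont complex_of_real t" by simp
    ultimately have "isCont (\<lambda>x::real. deriv F (of_real x)) t"
      by (metis isCont_o2)
    thus ?thesis unfolding f'_def by (rule continuous_Re)
  qed
  show ?thesis
  proof (rule that[OF _ cont])
    show "eventually (\<lambda>x. (f has_real_derivative f' x) (at x)) (nhds t)"
      unfolding eventually_nhds_metric using der F(1) by (auto simp: dist_real_def)
    show "f' t = deriv f t" using der[of t] F(1) by (simp add: DERIV_imp_deriv)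
  qed
qed

lemma real_analytic_at_has_deriv:
  "real_analytic_at f t \<Longrightarrow> (f has_real_derivative deriv f t) (at t)"
  by (metis eventually_nhds_x_imp_x real_analytic_at_derivE)

lemma real_analytic_at_isCont: "real_analytic_at f t \<Longrightarrow> isCont f t"
  using real_analytic_at_has_deriv DERIV_isCont by blast

lemma real_analytic_at_compose:
  assumes f: "real_analytic_at f t" and g: "real_analytic_at g (f t)"
  shows "real_analytic_at (\<lambda>x. g (f x)) t"
proof -
  from f obtain F r where F: "r > 0" "F holomorphic_on ball (complex_of_real t) r"
    "\<And>x. \<bar>x - t\<bar> < r \<Longrightarrow> F (of_real x) = complex_of_real (f x)" by (rule real_analytic_atE) blast
  from g obtain H s where H: "s > 0" "H holomorphic_on ball (complex_of_real (f t)) s"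
    "\<And>x. \<bar>x - f t\<bar> < s \<Longrightarrow> H (of_real x) = complex_of_real (g x)" by (rule real_analytic_atE) blast
  have "isCont F (of_real t)"
    using continuous_on_interior[OF holomorphic_on_imp_continuous_on[OF F(2)]] F(1) by simp
  then obtain d where d: "d > 0" "\<And>z. dist z (of_real t) < d \<Longrightarrow> dist (F z) (F (of_real t)) < s"
    unfolding continuous_at_eps_delta using H(1) by blast
  have Ft: "F (of_real t) = of_real (f t)" using F by simp
  show ?thesis
  proof (rule real_analytic_atI[of "min d r" "\<lambda>z. H (F z)"])
    show "(\<lambda>z. H (F z)) holomorphic_on ball (complex_of_real t) (min d r)"
      by (rule holomorphic_on_compose_gen[unfolded o_def, OF holomorphic_on_subset[OF F(2)] H(2)])
         (use d Ft in \<open>auto simp: dist_commute\<close>)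
    fix x assume x: "\<bar>x - t\<bar> < min d r"
    hence "dist (complex_of_real (f x)) (of_real (f t)) < s"
      using d(2)[of "of_real x"] F(3)[of x] Ft by (simp add: dist_norm flip: of_real_diff)
    thus "H (F (of_real x)) = of_real (g (f x))"
      using F(3)[of x] x H(3)[of "f x"] by (simp add: dist_norm flip: of_real_diff)
  qed (use d F in auto)
qed

text \<open>Agreement at points accumulating at t makes zeros of the holomorphic extension of
  \<open>f - g\<close> accumulate at the centre of its disc.\<close>

lemma real_analytic_at_identity:
  assumes f: "real_analytic_at f t" and g: "real_analytic_at g t"
    and fr: "frequently (\<lambda>x. f x = g x) (at t)"
  shows "eventually (\<lambda>x. f x = g x) (nhds t)"
proof -
  from real_analytic_at_diff[OF f g] obtain F r where F: "r > 0" "F holomorphic_on ball (complex_of_real t) r"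
    "\<And>x. \<bar>x - t\<bar> < r \<Longrightarrow> F (of_real x) = complex_of_real (f x - g x)" by (rule real_analytic_atE) blast
  define U where "U = {complex_of_real x | x. \<bar>x - t\<bar> < r \<and> f x = g x}"
  have lim: "of_real t islimpt U"
    unfolding islimpt_approachable
  proof (intro allI impI)
    fix e :: real assume e: "e > 0"
    have "eventually (\<lambda>x. \<bar>x - t\<bar> < min e r) (at t)"
      using e F(1) by (auto simp: eventually_at dist_real_def intro!: exI[of _ "min e r"])
    hence "eventually (\<lambda>x. \<bar>x - t\<bar> < min e r \<and> x \<noteq> t) (at t)"
      by (simp add: eventually_at_filter)
    from frequently_ex[OF frequently_eventually_frequently[OF fr this]] obtain x where "f x = g x" "\<bar>x - t\<bar> < min e r" "x \<noteq> t" by blast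
    thus "\<exists>x'\<in>U. x' \<noteq> complex_of_real t \<and> dist x' (complex_of_real t) < e"
      by (intro bexI[of _ "of_real x"]) (auto simp: U_def dist_norm simp flip: of_real_diff)
  qed
  have zero: "F z = 0" if "z \<in> ball (of_real t) r" for z
  proof (rule analytic_continuation[OF F(2) _ _ _ _ lim _ that])
    show "U \<subseteq> ball (complex_of_real t) r"
      by (auto simp: U_def dist_norm abs_minus_commute simp flip: of_real_diff)
    show "F z = 0" if "z \<in> U" for z using that F(3) by (auto simp: U_def)
  qed (use F(1) in auto)
  have "f x = g x" if "\<bar>x - t\<bar> < r" for x
    using zero[of "of_real x"] F(3)[OF that] that
    by (simp add: dist_norm abs_minus_commute flip: of_real_diff)
  thus ?thesis using F(1) by (auto simp: eventually_nhds_metric dist_real_def)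
qed

lemma deriv_real_analytic_extension:
  assumes F: "r > 0" "F holomorphic_on ball (complex_of_real t) r"
    "\<And>x. \<bar>x - t\<bar> < r \<Longrightarrow> F (of_real x) = complex_of_real (f x)"
  shows "deriv F (of_real t) = of_real (deriv f t)"
proof -
  have f: "real_analytic_at f t" using F by (rule real_analytic_atI)
    have "(F has_field_derivative deriv F (of_real t)) (at (of_real t))"
      using F(1) by (intro holomorphic_derivI[OF F(2)]) auto
    from has_vector_derivative_real_field[OF this, of UNIV]
    have v: "((\<lambda>y. F (of_real y)) has_vector_derivative deriv F (of_real t)) (at t)" by simp
    have "(f has_vector_derivative deriv f t) (at t)"
      using real_analytic_at_has_deriv[OF f] has_real_derivative_iff_has_vector_derivative by blast
    from bounded_linear.has_vector_derivative[OF bounded_linear_of_real this]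
    have "((\<lambda>y. complex_of_real (f y)) has_vector_derivative of_real (deriv f t)) (at t)" .
    hence "((\<lambda>y. F (of_real y)) has_vector_derivative of_real (deriv f t)) (at t)"
      by (rule has_vector_derivative_transform_within_open[where S="ball t r"])
         (use F(1) in \<open>auto simp: dist_real_def F(3)\<close>)
  with v show ?thesis by (rule vector_derivative_unique_at)
qed

text \<open>The complex derivative of the holomorphic extension equals the nonzero real one, so the
  extension has a holomorphic local inverse; g is its real part on the real line.\<close>

lemma real_analytic_at_local_inverse:
  assumes f: "real_analytic_at f t" and nz: "deriv f t \<noteq> 0"
  obtains g where "real_analytic_at g (f t)" "eventually (\<lambda>x. g (f x) = x) (nhds t)"
proof -
  from f obtain F r where F: "r > 0" "F holomorphic_on ball (complex_of_real t) r"
    "\<And>x. \<bar>x - t\<bar> < r \<Longrightarrow> F (of_real x) = complex_of_real (f x)" by (rule real_analytic_atE) blast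
  note derF = deriv_real_analytic_extension[OF F]
  obtain e where e: "e > 0" "ball (complex_of_real t) e \<subseteq> ball (of_real t) r"
    "open (F ` ball (of_real t) e)" "inj_on F (ball (of_real t) e)"
    by (rule has_complex_derivative_locally_invertible[OF F(2), of "of_real t"]) (use F(1) nz derF in auto)
  have holF: "F holomorphic_on ball (of_real t) e" using F(2) e(2) by (rule holomorphic_on_subset)
  obtain H where H: "H holomorphic_on F ` ball (of_real t) e" "\<And>z. z \<in> ball (of_real t) e \<Longrightarrow> H (F z) = z"
    by (rule holomorphic_has_inverse[OF holF _ e(4)]) auto
  define g where "g = (\<lambda>x::real. Re (H (of_real x)))"
  have gf: "g (f x) = x" if x: "\<bar>x - t\<bar> < e" for x
  proof -
    have "complex_of_real x \<in> ball (of_real t) e"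
      using x by (simp add: dist_norm abs_minus_commute flip: of_real_diff)
    moreover from this e(2) have "complex_of_real x \<in> ball (of_real t) r" by blast
    hence "F (of_real x) = of_real (f x)"
      by (intro F(3)) (simp add: dist_norm abs_minus_commute flip: of_real_diff)
    ultimately show ?thesis using H(2)[of "of_real x"] by (simp add: g_def)
  qed
  have "of_real (f t) \<in> F ` ball (of_real t) e"
    using F(3)[of t] F(1) e(1) by (intro image_eqI[of _ _ "of_real t"]) simp_all
  then obtain d where d: "d > 0" "ball (complex_of_real (f t)) d \<subseteq> F ` ball (of_real t) e"
    using e(3) by (meson openE)
  text \<open>The values of the complex inverse on the reals are real: near \<open>f t\<close> every real number is a
    value of \<open>f\<close>.\<close>
  have mono: "\<exists>s>0. \<forall>y. \<bar>y - f t\<bar> < s \<longrightarrow> (\<exists>x. \<bar>x - t\<bar> < e \<and> f x = y)"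
  proof -
    \<comment> \<open>On B the function f inherits injectivity from F, so its image is open by
      invariance of domain in dimension one; this yields s.\<close>
    define B where "B = ball t (min e r)"
    have Fr: "F (of_real x) = of_real (f x)" if "x \<in> B" for x
      using that F(3)[of x] by (auto simp: B_def dist_real_def)
    have inj: "inj_on f B"
    proof (rule inj_onI)
      fix x y assume "x \<in> B" "y \<in> B" "f x = f y"
      hence "F (of_real x) = F (of_real y)" by (simp add: Fr)
      moreover have "complex_of_real x \<in> ball (of_real t) e" "complex_of_real y \<in> ball (of_real t) e"
        using \<open>x \<in> B\<close> \<open>y \<in> B\<close> by (auto simp: B_def)
      ultimately show "x = y" using e(4) by (auto dest: inj_onD)
    qed
    have "continuous_on B (\<lambda>x. Re (F (of_real x)))"
      by (intro continuous_intros continuous_on_compose2[OF holomorphic_on_imp_continuous_on[OF F(2)]])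
         (auto simp: B_def)
    hence "continuous_on B f" by (rule continuous_on_eq) (simp add: Fr)
    with inj have "open (f ` B)"
      by (intro injective_into_1d_imp_open_map_UNIV[of B B f]) (auto simp: B_def)
    moreover have "f t \<in> f ` B" using F(1) e(1) by (auto simp: B_def)
    ultimately obtain s where "s > 0" "ball (f t) s \<subseteq> f ` B" by (meson openE)
    hence "\<exists>x. \<bar>x - t\<bar> < e \<and> f x = y" if "\<bar>y - f t\<bar> < s" for y
    proof -
      have "y \<in> ball (f t) s" using that by (simp add: dist_real_def)
      then obtain x where "x \<in> B" "y = f x" using \<open>ball (f t) s \<subseteq> f ` B\<close> by blast
      thus ?thesis by (intro exI[of _ x]) (simp add: B_def dist_real_def abs_minus_commute)
    qed
    with \<open>s > 0\<close> show ?thesis by blast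
  qed
  then obtain s where s: "s > 0" "\<And>y. \<bar>y - f t\<bar> < s \<Longrightarrow> \<exists>x. \<bar>x - t\<bar> < e \<and> f x = y" by blast
  have "real_analytic_at g (f t)"
  proof (rule real_analytic_atI[of "min d s" H])
    show "H holomorphic_on ball (complex_of_real (f t)) (min d s)"
      by (rule holomorphic_on_subset[OF H(1)]) (use d in auto)
    fix y assume "\<bar>y - f t\<bar> < min d s"
    then obtain x where x: "\<bar>x - t\<bar> < e" "f x = y" using s(2)[of y] by auto
    have "complex_of_real x \<in> ball (of_real t) e"
      using x by (simp add: dist_norm abs_minus_commute flip: of_real_diff)
    moreover from this e(2) have "complex_of_real x \<in> ball (of_real t) r" by blast
    hence "F (of_real x) = of_real y" unfolding x(2)[symmetric]
      by (intro F(3)) (simp add: dist_norm abs_minus_commute flip: of_real_diff)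
    ultimately have "H (of_real y) = of_real x" using H(2)[of "of_real x"] by simp
    thus "H (of_real y) = of_real (g y)" by (simp add: g_def)
  qed (use d s in auto)
  moreover have "eventually (\<lambda>x. g (f x) = x) (nhds t)"
    using gf e(1) by (auto simp: eventually_nhds_metric dist_real_def)
  ultimately show ?thesis by (rule that)
qed

section \<open>Power series in several variables along an analytic curve\<close>

lemma openin_Euclidean_space_box:
  assumes W: "openin (Euclidean_space n) W" and x: "x \<in> W"
  obtains \<rho> where "\<rho> > 0" "\<And>y. (\<And>i. i < n \<Longrightarrow> \<bar>y i - x i\<bar> \<le> \<rho>) \<Longrightarrow> (\<And>i. i \<ge> n \<Longrightarrow> y i = 0) \<Longrightarrow> y \<in> W"
proof -
  from W obtain T where T: "openin (powertop_real UNIV) T" and WT: "W = T \<inter> {x. \<forall>i\<ge>n. x i = 0}"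
    unfolding Euclidean_space_def openin_subtopology by auto
  from T x WT obtain U where U: "finite {i. U i \<noteq> UNIV}" "\<And>i. open (U i)" "x \<in> Pi\<^sub>E UNIV U" "Pi\<^sub>E UNIV U \<subseteq> T"
    unfolding openin_product_topology_alt by fastforce
  have "\<exists>e>0. cball (x i) e \<subseteq> U i" for i
    using U(2)[of i] U(3) open_contains_cball[of "U i"] by (auto simp: PiE_iff)
  then obtain e where e: "\<And>i. e i > 0" "\<And>i. cball (x i) (e i) \<subseteq> U i" by metis
  define \<rho> where "\<rho> = Min (insert 1 (e ` {..<n}))"
  have "\<rho> > 0" using e(1) by (auto simp: \<rho>_def)
  moreover have "y \<in> W" if y: "\<And>i. i < n \<Longrightarrow> \<bar>y i - x i\<bar> \<le> \<rho>" "\<And>i. i \<ge> n \<Longrightarrow> y i = 0" for y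
  proof -
    have "y i \<in> U i" for i
    proof (cases "i < n")
      case True
      hence "\<rho> \<le> e i" unfolding \<rho>_def by (intro Min_le) auto
      with y(1)[OF True] have "y i \<in> cball (x i) (e i)" by (simp add: dist_real_def abs_minus_commute)
      thus ?thesis using e(2) by blast
    next
      case False
      hence "y i = x i" using y(2) x WT by auto
      thus ?thesis using U(3) by (auto simp: PiE_iff)
    qed
    hence "y \<in> T" using U(4) by (auto simp: PiE_iff)
    thus ?thesis using y(2) WT by auto
  qed
  ultimately show ?thesis by (rule that)
qed

text \<open>With complex extensions of the coordinates of x inserted, the series is dominated by its
  values at one real point, so the M-test makes it a uniform limit of holomorphic functions. The
  second claim stands in for the chain rule: if all coordinate velocities vanish, each term of the
  series has derivative 0, and derivatives pass to the uniform limit.\<close>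

lemma real_analytic_on_compose_curve:
  fixes x :: "real \<Rightarrow> nat \<Rightarrow> real"
  assumes F: "real_analytic_on n m W F" and W: "openin (Euclidean_space n) W"
    and x: "\<And>i. i < n \<Longrightarrow> real_analytic_at (\<lambda>s. x s i) t" and ev: "eventually (\<lambda>s. x s \<in> W) (nhds t)"
    and j: "j < m"
  shows "real_analytic_at (\<lambda>s. F (x s) j) t"
    and "(\<And>i. i < n \<Longrightarrow> deriv (\<lambda>s. x s i) t = 0) \<Longrightarrow> deriv (\<lambda>s. F (x s) j) t = 0"
proof -
  have xt: "x t \<in> W" using ev by (rule eventually_nhds_x_imp_x)
  obtain c r where r: "r > 0"
    and c: "\<And>y. y \<in> W \<Longrightarrow> (\<And>i. i < n \<Longrightarrow> \<bar>y i - x t i\<bar> < r) \<Longrightarrow>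
      ((\<lambda>\<alpha>. c \<alpha> * (\<Prod>i<n. (y i - x t i) ^ \<alpha> i)) has_sum F y j) (multi_indices n)"
    using F xt j unfolding real_analytic_on_def by meson
  obtain \<rho>0 where \<rho>0: "\<rho>0 > 0"
    "\<And>y. (\<And>i. i < n \<Longrightarrow> \<bar>y i - x t i\<bar> \<le> \<rho>0) \<Longrightarrow> (\<And>i. i \<ge> n \<Longrightarrow> y i = 0) \<Longrightarrow> y \<in> W"
    using openin_Euclidean_space_box[OF W xt] by metis
  define \<rho> where "\<rho> = min \<rho>0 (r / 2)"
  have \<rho>: "\<rho> > 0" "\<rho> < r" using r \<rho>0(1) by (auto simp: \<rho>_def)
  \<comment> \<open>The corner of a closed box inside W: convergence of the series there controls
    all points whose coordinates differ from those of \<open>x t\<close> by at most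
    \<open>\<rho>\<close>.\<close>
  define y0 where "y0 = (\<lambda>i. if i < n then x t i + \<rho> else 0)"
  have "y0 \<in> W" by (rule \<rho>0(2)) (use \<rho> in \<open>auto simp: \<rho>_def y0_def\<close>)
  moreover have "\<bar>y0 i - x t i\<bar> < r" if "i < n" for i using \<rho> that by (simp add: y0_def)
  ultimately have "((\<lambda>\<alpha>. c \<alpha> * (\<Prod>i<n. (y0 i - x t i) ^ \<alpha> i)) has_sum F y0 j) (multi_indices n)"
    by (rule c)
  moreover have "(\<Prod>i<n. (y0 i - x t i) ^ \<alpha> i) = (\<Prod>i<n. \<rho> ^ \<alpha> i)" for \<alpha>
    by (rule prod.cong) (auto simp: y0_def)
  ultimately have "(\<lambda>\<alpha>. c \<alpha> * (\<Prod>i<n. \<rho> ^ \<alpha> i)) summable_on multi_indices n"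
    unfolding summable_on_def by auto
  \<comment> \<open>A summable real family is absolutely summable, which gives a majorant
    independent of the point.\<close>
  hence M: "(\<lambda>\<alpha>. \<bar>c \<alpha>\<bar> * (\<Prod>i<n. \<rho> ^ \<alpha> i)) summable_on multi_indices n"
    using \<rho> by (subst (asm) summable_on_iff_abs_summable_on_real) (simp add: abs_mult abs_prod power_abs)
  have "\<exists>X d. d > 0 \<and> X holomorphic_on ball (complex_of_real t) d \<and>
      (\<forall>s. \<bar>s - t\<bar> < d \<longrightarrow> X (of_real s) = complex_of_real (x s i)) \<and>
      (\<forall>z\<in>ball (of_real t) d. norm (X z - of_real (x t i)) < \<rho>)" if i: "i < n" for i
  proof -
    from x[OF i] obtain X d where X: "d > 0" "X holomorphic_on ball (complex_of_real t) d"
      "\<And>s. \<bar>s - t\<bar> < d \<Longrightarrow> X (of_real s) = complex_of_real (x s i)" by (rule real_analytic_atE) blast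
    have "isCont X (of_real t)"
      using continuous_on_interior[OF holomorphic_on_imp_continuous_on[OF X(2)]] X(1) by simp
    then obtain e where e: "e > 0" "\<And>z. dist z (of_real t) < e \<Longrightarrow> dist (X z) (X (of_real t)) < \<rho>"
      unfolding continuous_at_eps_delta using \<rho> by blast
    show ?thesis
    proof (intro exI[of _ X] exI[of _ "min d e"] conjI ballI allI impI)
      show "X holomorphic_on ball (complex_of_real t) (min d e)" by (rule holomorphic_on_subset[OF X(2)]) auto
      show "norm (X z - of_real (x t i)) < \<rho>" if "z \<in> ball (of_real t) (min d e)" for z
        using e(2)[of z] that X(1) X(3)[of t] by (simp add: dist_commute dist_norm)
    qed (use X e in auto)
  qed
  then obtain X d0 where X: "\<And>i. i < n \<Longrightarrow> d0 i > 0" "\<And>i. i < n \<Longrightarrow> X i holomorphic_on ball (complex_of_real t) (d0 i)"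
    "\<And>i s. i < n \<Longrightarrow> \<bar>s - t\<bar> < d0 i \<Longrightarrow> X i (of_real s) = complex_of_real (x s i)"
    "\<And>i z. i < n \<Longrightarrow> z \<in> ball (of_real t) (d0 i) \<Longrightarrow> norm (X i z - of_real (x t i)) < \<rho>"
    by metis
  from ev obtain d1 where d1: "d1 > 0" "\<And>s. \<bar>s - t\<bar> < d1 \<Longrightarrow> x s \<in> W"
    by (auto simp: eventually_nhds_metric dist_real_def)
  \<comment> \<open>Half of the least radius, so that the closed disc of radius d lies in a disc on
    which every term is holomorphic.\<close>
  define d where "d = Min (insert d1 (d0 ` {..<n})) / 2"
  have d: "d > 0" using X(1) d1(1) by (auto simp: d_def)
  have d_less: "d < d1" "\<And>i. i < n \<Longrightarrow> d < d0 i"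
  proof -
    have *: "2 * d \<le> y" if "y \<in> insert d1 (d0 ` {..<n})" for y
      using that unfolding d_def by (simp del: Min_insert)
    show "d < d1" using *[of d1] d by simp
    show "d < d0 i" if "i < n" for i using *[of "d0 i"] that d by auto
  qed
  define tm where "tm = (\<lambda>\<alpha> z. of_real (c \<alpha>) * (\<Prod>i<n. (X i z - of_real (x t i)) ^ \<alpha> i))"
  define g where "g = (\<lambda>z. \<Sum>\<^sub>\<infinity>\<alpha>\<in>multi_indices n. tm \<alpha> z)"
  have ulim: "uniform_limit (cball (of_real t) d) (\<lambda>S z. \<Sum>\<alpha>\<in>S. tm \<alpha> z) g (finite_subsets_at_top (multi_indices n))"
    unfolding g_def
  proof (rule Weierstrass_m_test_general[OF _ M])
    fix \<alpha> z assume "z \<in> cball (complex_of_real t) d"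
    hence "norm (X i z - of_real (x t i)) \<le> \<rho>" if "i < n" for i
      using X(4)[OF that, of z] d_less(2)[OF that] by auto
    thus "norm (tm \<alpha> z) \<le> \<bar>c \<alpha>\<bar> * (\<Prod>i<n. \<rho> ^ \<alpha> i)"
      unfolding tm_def norm_mult norm_of_real prod_norm[symmetric] norm_power
      by (intro mult_left_mono prod_mono conjI power_mono) auto
  qed
  have hol_tm: "tm \<alpha> holomorphic_on ball (of_real t) (Min (insert d1 (d0 ` {..<n})))" for \<alpha>
    unfolding tm_def by (intro holomorphic_intros holomorphic_on_subset[OF X(2)]) auto
  have Min_eq: "Min (insert d1 (d0 ` {..<n})) = 2 * d" by (simp add: d_def del: Min_insert)
  have sub: "cball (complex_of_real t) d \<subseteq> ball (of_real t) (Min (insert d1 (d0 ` {..<n})))"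
    unfolding Min_eq using d by auto
  have "eventually (\<lambda>S. continuous_on (cball (of_real t) d) (\<lambda>z. \<Sum>\<alpha>\<in>S. tm \<alpha> z) \<and>
      (\<forall>w\<in>ball (of_real t) d. ((\<lambda>z. \<Sum>\<alpha>\<in>S. tm \<alpha> z) has_field_derivative (\<Sum>\<alpha>\<in>S. deriv (tm \<alpha>) w)) (at w)))
      (finite_subsets_at_top (multi_indices n))"
  proof (intro always_eventually allI conjI ballI)
    fix S show "continuous_on (cball (of_real t) d) (\<lambda>z. \<Sum>\<alpha>\<in>S. tm \<alpha> z)"
      by (intro continuous_on_sum continuous_on_subset[OF holomorphic_on_imp_continuous_on[OF hol_tm] sub])
    fix w assume "w \<in> ball (complex_of_real t) d"
    hence "w \<in> ball (of_real t) (Min (insert d1 (d0 ` {..<n})))" using sub ball_subset_cball by blast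
    thus "((\<lambda>z. \<Sum>\<alpha>\<in>S. tm \<alpha> z) has_field_derivative (\<Sum>\<alpha>\<in>S. deriv (tm \<alpha>) w)) (at w)"
      by (intro DERIV_sum holomorphic_derivI[OF hol_tm]) auto
  qed
  \<comment> \<open>This rule also identifies the derivative of g as the limit of the derivatives of
    the partial sums, which the second claim uses.\<close>
  from has_complex_derivative_uniform_limit[OF this ulim finite_subsets_at_top_neq_bot d]
  obtain g' where g': "\<And>w. w \<in> ball (of_real t) d \<Longrightarrow> (g has_field_derivative g' w) (at w)"
    "\<And>w. w \<in> ball (of_real t) d \<Longrightarrow>
      ((\<lambda>S. \<Sum>\<alpha>\<in>S. deriv (tm \<alpha>) w) \<longlongrightarrow> g' w) (finite_subsets_at_top (multi_indices n))"
    by metis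
  have hol: "g holomorphic_on ball (of_real t) d"
    unfolding holomorphic_on_open[OF open_ball] using g'(1) by blast
  have val: "g (of_real s) = of_real (F (x s) j)" if s: "\<bar>s - t\<bar> < d" for s
  proof -
    have Xs: "X i (of_real s) = of_real (x s i)" if "i < n" for i
      using X(3)[OF that, of s] d_less(2)[OF that] s by simp
    have small: "\<bar>x s i - x t i\<bar> < r" if "i < n" for i
    proof -
      have "complex_of_real s \<in> ball (of_real t) (d0 i)"
        using s d_less(2)[OF that] by (simp add: dist_norm abs_minus_commute flip: of_real_diff)
      from X(4)[OF that this] \<rho>(2) show ?thesis
        unfolding Xs[OF that] by (simp flip: of_real_diff)
    qed
    have "x s \<in> W" using d1(2)[of s] d_less(1) s by simp
    from has_sum_of_real[OF c[OF this small], where 'a=complex]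
    have "((\<lambda>\<alpha>. complex_of_real (c \<alpha> * (\<Prod>i<n. (x s i - x t i) ^ \<alpha> i))) has_sum of_real (F (x s) j)) (multi_indices n)"
      by simp
    also have "(\<lambda>\<alpha>. complex_of_real (c \<alpha> * (\<Prod>i<n. (x s i - x t i) ^ \<alpha> i))) = (\<lambda>\<alpha>. tm \<alpha> (of_real s))"
      by (simp add: tm_def Xs)
    finally show ?thesis unfolding g_def by (rule infsumI)
  qed
  show "real_analytic_at (\<lambda>s. F (x s) j) t"
    using d hol val by (rule real_analytic_atI)
  assume zero: "\<And>i. i < n \<Longrightarrow> deriv (\<lambda>s. x s i) t = 0"
  have "(tm \<alpha> has_field_derivative 0) (at (of_real t))" for \<alpha>
  proof -
    have X0: "(X i has_field_derivative 0) (at (of_real t))" if "i < n" for i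
      using holomorphic_derivI[OF X(2)[OF that] open_ball, of "of_real t"] X(1)[OF that]
        deriv_real_analytic_extension[OF X(1-3)[OF that]] zero[OF that] by simp
    have "((\<lambda>z. (X i z - of_real (x t i)) ^ \<alpha> i) has_field_derivative 0) (at (of_real t))" if "i < n" for i
      using DERIV_power[OF DERIV_diff[OF X0[OF that] DERIV_const], of "of_real (x t i)" "\<alpha> i"] by simp
    hence "((\<lambda>z. \<Prod>i<n. (X i z - of_real (x t i)) ^ \<alpha> i) has_field_derivative
       (\<Sum>i<n. 0 * (\<Prod>k\<in>{..<n} - {i}. (X k (of_real t) - of_real (x t k)) ^ \<alpha> k))) (at (of_real t))"
      by (intro has_field_derivative_prod) auto
    from DERIV_cmult[OF this, of "of_real (c \<alpha>)"] show ?thesis by (simp add: tm_def)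
  qed
  hence "deriv (tm \<alpha>) (of_real t) = 0" for \<alpha> by (rule DERIV_imp_deriv)
  with g'(2)[of "of_real t"] d have "((\<lambda>S::(nat \<Rightarrow> nat) set. 0) \<longlongrightarrow> g' (of_real t)) (finite_subsets_at_top (multi_indices n))"
    by simp
  hence "g' (of_real t) = 0"
    by (metis finite_subsets_at_top_neq_bot tendsto_const tendsto_unique)
  hence "deriv g (of_real t) = 0"
    using g'(1)[of "of_real t"] d by (simp add: DERIV_imp_deriv)
  thus "deriv (\<lambda>s. F (x s) j) t = 0"
    using deriv_real_analytic_extension[OF d hol val] by simp
qed

section \<open>Analytic curves in manifolds\<close>

text \<open>Continuity at t is a limit along \<open>nhds t\<close>, which includes that
  \<open>\<alpha> t\<close> lies in the space. All conditions concern a single parameter, so that no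
  domain of the curve has to be carried along.\<close>

definition analytic_curve_at :: "'m manifold \<Rightarrow> (real \<Rightarrow> 'm) \<Rightarrow> real \<Rightarrow> bool" where
  "analytic_curve_at M \<alpha> t \<longleftrightarrow> limitin (mtop M) \<alpha> (\<alpha> t) (nhds t) \<and>
     (\<forall>(U, f)\<in>charts M. \<alpha> t \<in> U \<longrightarrow> (\<forall>i<mdim M. real_analytic_at (\<lambda>s. f (\<alpha> s) i) t))"

definition immersed_at :: "'m manifold \<Rightarrow> (real \<Rightarrow> 'm) \<Rightarrow> real \<Rightarrow> bool" where
  "immersed_at M \<alpha> t \<longleftrightarrow> analytic_curve_at M \<alpha> t \<and>
     (\<forall>(U, f)\<in>charts M. \<alpha> t \<in> U \<longrightarrow> (\<exists>i<mdim M. deriv (\<lambda>s. f (\<alpha> s) i) t \<noteq> 0))"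

lemma analytic_curve_at_coordinate:
  "analytic_curve_at M \<alpha> t \<Longrightarrow> (U, f) \<in> charts M \<Longrightarrow> \<alpha> t \<in> U \<Longrightarrow> i < mdim M \<Longrightarrow>
    real_analytic_at (\<lambda>s. f (\<alpha> s) i) t"
  unfolding analytic_curve_at_def by blast

lemma analytic_curve_atI:
  assumes "limitin (mtop M) \<alpha> (\<alpha> t) (nhds t)"
    "\<And>U f i. (U, f) \<in> charts M \<Longrightarrow> \<alpha> t \<in> U \<Longrightarrow> i < mdim M \<Longrightarrow> real_analytic_at (\<lambda>s. f (\<alpha> s) i) t"
  shows "analytic_curve_at M \<alpha> t"
  using assms unfolding analytic_curve_at_def by blast

lemma immersed_at_derivE:
  assumes "immersed_at M \<alpha> t" "(U, f) \<in> charts M" "\<alpha> t \<in> U"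
  obtains i where "i < mdim M" "deriv (\<lambda>s. f (\<alpha> s) i) t \<noteq> 0"
  using assms unfolding immersed_at_def by blast

lemma immersed_atI:
  assumes "analytic_curve_at M \<alpha> t"
    "\<And>U f. (U, f) \<in> charts M \<Longrightarrow> \<alpha> t \<in> U \<Longrightarrow> \<exists>i<mdim M. deriv (\<lambda>s. f (\<alpha> s) i) t \<noteq> 0"
  shows "immersed_at M \<alpha> t"
  using assms unfolding immersed_at_def by blast

lemma immersed_at_imp_analytic_curve_at: "immersed_at M \<alpha> t \<Longrightarrow> analytic_curve_at M \<alpha> t"
  by (simp add: immersed_at_def)

lemma analytic_curve_at_limitin: "analytic_curve_at M \<alpha> t \<Longrightarrow> limitin (mtop M) \<alpha> (\<alpha> t) (nhds t)"
  by (simp add: analytic_curve_at_def)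

lemma chart_exists:
  assumes "analytic_manifold M" "x \<in> topspace (mtop M)"
  obtains U f where "(U, f) \<in> charts M" "x \<in> U"
proof -
  from assms have "x \<in> \<Union>(fst ` charts M)" unfolding analytic_manifold_def by simp
  thus ?thesis using that by auto
qed

context
  fixes M :: "'m manifold" and U f
  assumes M: "analytic_manifold M" and chart: "(U, f) \<in> charts M"
begin

lemma chart_open: "openin (mtop M) U"
  and chart_image_open: "openin (Euclidean_space (mdim M)) (f ` U)"
  and chart_homeomorphic: "homeomorphic_map (subtopology (mtop M) U)
    (subtopology (Euclidean_space (mdim M)) (f ` U)) f"
  using M chart unfolding analytic_manifold_def by auto

lemma chart_subset: "U \<subseteq> topspace (mtop M)"
  using chart_open by (rule openin_subset)

lemma chart_inj: "inj_on f U"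
  using homeomorphic_imp_injective_map[OF chart_homeomorphic] chart_subset by (simp add: Int_absorb1)

lemma chart_zero: "x \<in> U \<Longrightarrow> i \<ge> mdim M \<Longrightarrow> f x i = 0"
  using openin_subset[OF chart_image_open] by (auto simp: topspace_Euclidean_space)

lemma chart_eqI: "x \<in> U \<Longrightarrow> y \<in> U \<Longrightarrow> (\<And>i. i < mdim M \<Longrightarrow> f x i = f y i) \<Longrightarrow> x = y"
  by (metis chart_inj chart_zero ext inj_onD linorder_not_le)

lemma chart_open_image:
  assumes "openin (mtop M) V" "V \<subseteq> U"
  shows "openin (Euclidean_space (mdim M)) (f ` V)"
proof -
  have "openin (subtopology (mtop M) U) V"
    using assms by (metis openin_subtopology_Int inf.absorb_iff1)
  hence "openin (subtopology (Euclidean_space (mdim M)) (f ` U)) (f ` V)"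
    using homeomorphic_imp_open_map[OF chart_homeomorphic] by (simp add: open_map_def)
  thus ?thesis using chart_image_open openin_trans_full by blast
qed

lemma chart_coordinate_continuous:
  "continuous_map (subtopology (mtop M) U) euclideanreal (\<lambda>x. f x i)"
proof -
  have "continuous_map (subtopology (mtop M) U) (Euclidean_space (mdim M)) f"
    using homeomorphic_imp_continuous_map[OF chart_homeomorphic] continuous_map_in_subtopology by blast
  hence "continuous_map (subtopology (mtop M) U) (powertop_real UNIV) f"
    unfolding Euclidean_space_def by (simp add: continuous_map_in_subtopology)
  thus ?thesis by (simp add: continuous_map_componentwise_UNIV)
qed

end

text \<open>On an open J continuity is a pointwise matter, so immersions can be handled one
  parameter at a time.\<close>

lemma open_analytic_immersion_iff:
  "open_analytic_immersion M J \<gamma> \<longleftrightarrow> open_interval J \<and> (\<forall>t\<in>J. immersed_at M \<gamma> t)"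
proof -
  have "continuous_map (top_of_set J) (mtop M) \<gamma> \<longleftrightarrow> (\<forall>t\<in>J. limitin (mtop M) \<gamma> (\<gamma> t) (nhds t))"
    if "open J"
  proof
    assume c: "continuous_map (top_of_set J) (mtop M) \<gamma>"
    show "\<forall>t\<in>J. limitin (mtop M) \<gamma> (\<gamma> t) (nhds t)"
      unfolding limitin_def
    proof (intro ballI conjI allI impI)
      fix t assume t: "t \<in> J"
      show "\<gamma> t \<in> topspace (mtop M)" using c t by (auto simp: continuous_map_def)
      fix U assume "openin (mtop M) U \<and> \<gamma> t \<in> U"
      hence "openin (top_of_set J) {s \<in> J. \<gamma> s \<in> U}" using c by (auto simp: continuous_map_def)
      hence "open {s \<in> J. \<gamma> s \<in> U}" using that openin_open_trans by blast
      moreover have "t \<in> {s \<in> J. \<gamma> s \<in> U}" using t \<open>openin (mtop M) U \<and> \<gamma> t \<in> U\<close> by simp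
      ultimately show "eventually (\<lambda>s. \<gamma> s \<in> U) (nhds t)" unfolding eventually_nhds by blast
    qed
  next
    assume l: "\<forall>t\<in>J. limitin (mtop M) \<gamma> (\<gamma> t) (nhds t)"
    show "continuous_map (top_of_set J) (mtop M) \<gamma>"
      unfolding continuous_map_def
    proof (intro conjI allI impI)
      show "\<gamma> \<in> topspace (top_of_set J) \<rightarrow> topspace (mtop M)" using l by (auto simp: limitin_def)
      fix U assume U: "openin (mtop M) U"
      have "open {s \<in> J. \<gamma> s \<in> U}"
      proof (subst open_subopen, clarify)
        fix t assume t: "t \<in> J" "\<gamma> t \<in> U"
        with l U have "eventually (\<lambda>s. \<gamma> s \<in> U) (nhds t)" by (auto simp: limitin_def)
        then obtain T where "open T" "t \<in> T" "\<forall>s\<in>T. \<gamma> s \<in> U" unfolding eventually_nhds by blast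
        thus "\<exists>T. open T \<and> t \<in> T \<and> T \<subseteq> {s \<in> J. \<gamma> s \<in> U}"
          using t \<open>open J\<close> by (intro exI[of _ "T \<inter> J"]) auto
      qed
      thus "openin (top_of_set J) {x \<in> topspace (top_of_set J). \<gamma> x \<in> U}"
        using \<open>open J\<close> by (simp add: openin_open_eq)
    qed
  qed
  note * = this
  show ?thesis
  proof (cases "open_interval J")
    case True
    hence "open J" by (simp add: open_interval_def)
    with * True show ?thesis
      unfolding open_analytic_immersion_def immersed_at_def analytic_curve_at_def case_prod_beta by blast
  qed (simp add: open_analytic_immersion_def)
qed

lemma limitin_eventually: "limitin X f l F \<Longrightarrow> openin X U \<Longrightarrow> l \<in> U \<Longrightarrow> eventually (\<lambda>x. f x \<in> U) F"
  by (simp add: limitin_def)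

lemma limitin_compose_real:
  assumes "limitin X \<alpha> (\<alpha> (\<nu> t)) (nhds (\<nu> t))" "isCont \<nu> t"
  shows "limitin X (\<lambda>s. \<alpha> (\<nu> s)) (\<alpha> (\<nu> t)) (nhds t)"
proof -
  have "filterlim \<nu> (nhds (\<nu> t)) (nhds t)" using assms(2) isCont_def tendsto_at_iff_tendsto_nhds by blast
  thus ?thesis using assms(1) unfolding limitin_def by (auto dest: eventually_compose_filterlim)
qed

lemma analytic_curve_at_compose:
  assumes \<alpha>: "analytic_curve_at M \<alpha> (\<nu> t)" and \<nu>: "real_analytic_at \<nu> t"
  shows "analytic_curve_at M (\<lambda>s. \<alpha> (\<nu> s)) t"
proof (rule analytic_curve_atI)
  show "limitin (mtop M) (\<lambda>s. \<alpha> (\<nu> s)) (\<alpha> (\<nu> t)) (nhds t)"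
    by (rule limitin_compose_real[OF analytic_curve_at_limitin[OF \<alpha>] real_analytic_at_isCont[OF \<nu>]])
  show "real_analytic_at (\<lambda>s. f (\<alpha> (\<nu> s)) i) t"
    if "(U, f) \<in> charts M" "\<alpha> (\<nu> t) \<in> U" "i < mdim M" for U f i
    using real_analytic_at_compose[OF \<nu>, of "\<lambda>s. f (\<alpha> s) i"] analytic_curve_at_coordinate[OF \<alpha> that] by blast
qed

lemma immersed_at_cong:
  assumes ev: "eventually (\<lambda>s. \<alpha> s = \<beta> s) (nhds t)" and \<alpha>: "immersed_at M \<alpha> t"
  shows "immersed_at M \<beta> t"
proof -
  have eq: "\<alpha> t = \<beta> t" using ev by (rule eventually_nhds_x_imp_x)
  have ev': "eventually (\<lambda>s. f (\<alpha> s) i = f (\<beta> s) i) (nhds t)" for f :: "'a \<Rightarrow> nat \<Rightarrow> real" and i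
    using ev by (rule eventually_mono) simp
  have \<alpha>c: "analytic_curve_at M \<alpha> t" by (rule immersed_at_imp_analytic_curve_at[OF \<alpha>])
  show ?thesis
  proof (intro immersed_atI analytic_curve_atI)
    show "limitin (mtop M) \<beta> (\<beta> t) (nhds t)"
      using limitin_transform_eventually[OF ev analytic_curve_at_limitin[OF \<alpha>c]] by (simp add: eq)
  next
    fix U f i assume "(U, f) \<in> charts M" "\<beta> t \<in> U" "i < mdim M"
    thus "real_analytic_at (\<lambda>s. f (\<beta> s) i) t"
      using analytic_curve_at_coordinate[OF \<alpha>c, of U f i] real_analytic_at_cong[OF ev'[of f i]] by (simp add: eq)
  next
    fix U f assume "(U, f) \<in> charts M" "\<beta> t \<in> U"
    then obtain i where "i < mdim M" "deriv (\<lambda>s. f (\<alpha> s) i) t \<noteq> 0"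
      using immersed_at_derivE[OF \<alpha>, of U f] by (metis eq)
    thus "\<exists>i<mdim M. deriv (\<lambda>s. f (\<beta> s) i) t \<noteq> 0"
      using deriv_cong_ev[OF ev'[of f i] refl] by auto
  qed
qed

text \<open>Hausdorffness first forces \<open>\<alpha> t = \<beta> t\<close>; then both curves stay
  in one chart near t and the identity theorem applies to each coordinate.\<close>

lemma analytic_curves_identity:
  assumes M: "analytic_manifold M"
    and \<alpha>: "analytic_curve_at M \<alpha> t" and \<beta>: "analytic_curve_at M \<beta> t"
    and fr: "frequently (\<lambda>s. \<alpha> s = \<beta> s) (at t)"
  shows "eventually (\<lambda>s. \<alpha> s = \<beta> s) (nhds t)"
proof -
  have lim: "limitin (mtop M) \<alpha> (\<alpha> t) (nhds t)" "limitin (mtop M) \<beta> (\<beta> t) (nhds t)"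
    using \<alpha> \<beta> by (auto simp: analytic_curve_at_def)
  have eq: "\<alpha> t = \<beta> t"
  proof (rule ccontr)
    assume "\<alpha> t \<noteq> \<beta> t"
    then obtain P Q where PQ: "openin (mtop M) P" "openin (mtop M) Q" "\<alpha> t \<in> P" "\<beta> t \<in> Q" "disjnt P Q"
      using M lim unfolding analytic_manifold_def Hausdorff_space_def limitin_def by meson
    have "eventually (\<lambda>s. \<alpha> s \<in> P \<and> \<beta> s \<in> Q) (at t)"
      using limitin_eventually[OF lim(1) PQ(1,3)] limitin_eventually[OF lim(2) PQ(2,4)]
      by (auto simp: eventually_nhds_conv_at elim: eventually_elim2)
    from frequently_ex[OF frequently_eventually_frequently[OF fr this]] PQ(5)
    show False by (auto simp: disjnt_iff)
  qed
  obtain U f where U: "(U, f) \<in> charts M" "\<alpha> t \<in> U"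
    using chart_exists[OF M] lim(1) by (auto simp: limitin_def)
  have "eventually (\<lambda>s. f (\<alpha> s) i = f (\<beta> s) i) (nhds t)" if "i < mdim M" for i
    using analytic_curve_at_coordinate[OF \<alpha> U that] analytic_curve_at_coordinate[OF \<beta> U(1) _ that] U(2) eq
    by (intro real_analytic_at_identity frequently_elim1[OF fr]) simp_all
  hence "eventually (\<lambda>s. \<forall>i\<in>{..<mdim M}. f (\<alpha> s) i = f (\<beta> s) i) (nhds t)"
    by (intro eventually_ball_finite) auto
  moreover have "eventually (\<lambda>s. \<alpha> s \<in> U) (nhds t)" "eventually (\<lambda>s. \<beta> s \<in> U) (nhds t)"
    using lim U eq chart_open[OF M U(1)] by (auto intro: limitin_eventually)
  ultimately show ?thesis
    by eventually_elim (auto intro: chart_eqI[OF M U(1)])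
qed

text \<open>The function g recovers the parameter from one coordinate of the point. Local
  injectivity, the embedding property and the parameter change between two curves all come from
  it.\<close>

lemma immersed_at_coordinate:
  assumes M: "analytic_manifold M" and \<beta>: "immersed_at M \<beta> y"
  obtains U f i g where "(U, f) \<in> charts M" "\<beta> y \<in> U" "i < mdim M"
    "real_analytic_at g (f (\<beta> y) i)" "eventually (\<lambda>s. g (f (\<beta> s) i) = s) (nhds y)"
proof -
  obtain U f where U: "(U, f) \<in> charts M" "\<beta> y \<in> U"
    using chart_exists[OF M] \<beta> by (auto simp: limitin_def immersed_at_def analytic_curve_at_def)
  then obtain i where i: "i < mdim M" "deriv (\<lambda>s. f (\<beta> s) i) y \<noteq> 0"
    by (rule immersed_at_derivE[OF \<beta>])
  have "real_analytic_at (\<lambda>s. f (\<beta> s) i) y"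
    by (rule analytic_curve_at_coordinate[OF immersed_at_imp_analytic_curve_at[OF \<beta>] U i(1)])
  from real_analytic_at_local_inverse[OF this i(2)] U i(1) that show ?thesis by blast
qed

text \<open>Only t is required to differ from x: then infinitely many meeting parameters accumulate
  at x, which is what the identity theorem asks for.\<close>

definition curves_accumulate :: "(real \<Rightarrow> 'm) \<Rightarrow> (real \<Rightarrow> 'm) \<Rightarrow> real \<Rightarrow> real \<Rightarrow> bool" where
  "curves_accumulate \<alpha> \<beta> x y \<longleftrightarrow>
     (\<forall>\<delta>>0. \<exists>t s. t \<noteq> x \<and> \<bar>t - x\<bar> < \<delta> \<and> \<bar>s - y\<bar> < \<delta> \<and> \<alpha> t = \<beta> s)"

text \<open>The last clause makes \<nu> the only way of matching parameters near (x, y).\<close>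

definition parameter_change ::
    "(real \<Rightarrow> 'm) \<Rightarrow> (real \<Rightarrow> 'm) \<Rightarrow> real \<Rightarrow> real \<Rightarrow> (real \<Rightarrow> real) \<Rightarrow> real \<Rightarrow> bool" where
  "parameter_change \<alpha> \<beta> x y \<nu> \<delta> \<longleftrightarrow> real_analytic_at \<nu> x \<and> \<nu> x = y \<and> deriv \<nu> x \<noteq> 0 \<and>
     eventually (\<lambda>t. \<alpha> t = \<beta> (\<nu> t)) (nhds x) \<and> \<delta> > 0 \<and>
     (\<forall>t s. \<bar>t - x\<bar> < \<delta> \<longrightarrow> \<bar>s - y\<bar> < \<delta> \<longrightarrow> \<alpha> t = \<beta> s \<longrightarrow> s = \<nu> t)"

text \<open>Near \<open>y\<close> some chart coordinate of \<open>\<beta>\<close> is invertible; its inverse applied to the same coordinate of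
  \<open>\<alpha>\<close> is the only possible parameter change, and it is one by the identity theorem.\<close>

lemma curves_accumulate_parameter_change:
  assumes M: "analytic_manifold M"
    and \<alpha>: "immersed_at M \<alpha> x" and \<beta>: "immersed_at M \<beta> y" and acc: "curves_accumulate \<alpha> \<beta> x y"
  obtains \<nu> \<delta> where "parameter_change \<alpha> \<beta> x y \<nu> \<delta>"
proof -
  have lim: "limitin (mtop M) \<alpha> (\<alpha> x) (nhds x)" "limitin (mtop M) \<beta> (\<beta> y) (nhds y)"
    and \<alpha>c: "analytic_curve_at M \<alpha> x" and \<beta>c: "analytic_curve_at M \<beta> y"
    using \<alpha> \<beta> by (auto simp: analytic_curve_at_def immersed_at_def)
  have eq: "\<alpha> x = \<beta> y"
  proof (rule ccontr)
    assume "\<alpha> x \<noteq> \<beta> y"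
    then obtain P Q where PQ: "openin (mtop M) P" "openin (mtop M) Q" "\<alpha> x \<in> P" "\<beta> y \<in> Q" "disjnt P Q"
      using M lim unfolding analytic_manifold_def Hausdorff_space_def limitin_def by meson
    obtain d e where "d > 0" "\<And>t. \<bar>t - x\<bar> < d \<Longrightarrow> \<alpha> t \<in> P" "e > 0" "\<And>s. \<bar>s - y\<bar> < e \<Longrightarrow> \<beta> s \<in> Q"
      using limitin_eventually[OF lim(1) PQ(1,3)] limitin_eventually[OF lim(2) PQ(2,4)]
      unfolding eventually_nhds_metric dist_real_def by metis
    with acc[unfolded curves_accumulate_def, rule_format, of "min d e"] PQ(5)
    show False by (metis disjnt_iff min_less_iff_conj)
  qed
  obtain U f i g where U: "(U, f) \<in> charts M" "\<beta> y \<in> U" "i < mdim M"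
    and g: "real_analytic_at g (f (\<beta> y) i)" "eventually (\<lambda>s. g (f (\<beta> s) i) = s) (nhds y)"
    using immersed_at_coordinate[OF M \<beta>] .
  define \<nu> where "\<nu> = (\<lambda>t. g (f (\<alpha> t) i))"
  have \<nu>: "real_analytic_at \<nu> x"
    unfolding \<nu>_def using analytic_curve_at_coordinate[OF \<alpha>c U(1) _ U(3)] U(2) g(1) eq
    by (intro real_analytic_at_compose[of "\<lambda>t. f (\<alpha> t) i" x g]) simp_all
  have \<nu>x: "\<nu> x = y" using eventually_nhds_x_imp_x[OF g(2)] eq by (simp add: \<nu>_def)
  from g(2) obtain \<delta> where \<delta>: "\<delta> > 0" "\<And>s. \<bar>s - y\<bar> < \<delta> \<Longrightarrow> g (f (\<beta> s) i) = s"
    unfolding eventually_nhds_metric dist_real_def by blast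
  have uniq: "s = \<nu> t" if "\<bar>s - y\<bar> < \<delta>" "\<alpha> t = \<beta> s" for s t
    using \<delta>(2)[OF that(1)] that(2) by (simp add: \<nu>_def)
  have "frequently (\<lambda>t. \<alpha> t = \<beta> (\<nu> t)) (at x)"
    unfolding frequently_at
  proof (intro allI impI)
    fix d :: real assume "d > 0"
    with acc[unfolded curves_accumulate_def, rule_format, of "min d \<delta>"] \<delta>(1)
    obtain t s where "t \<noteq> x" "\<bar>t - x\<bar> < d" "\<bar>s - y\<bar> < \<delta>" "\<alpha> t = \<beta> s" by auto
    thus "\<exists>t\<in>UNIV. t \<noteq> x \<and> dist t x < d \<and> \<alpha> t = \<beta> (\<nu> t)"
      using uniq[of s t] by (intro bexI[of _ t]) (auto simp: dist_real_def)
  qed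
  moreover have "analytic_curve_at M (\<lambda>t. \<beta> (\<nu> t)) x"
    by (rule analytic_curve_at_compose[OF _ \<nu>]) (simp add: \<nu>x \<beta>c)
  ultimately have ev: "eventually (\<lambda>t. \<alpha> t = \<beta> (\<nu> t)) (nhds x)"
    using M \<alpha>c by (intro analytic_curves_identity)
  \<comment> \<open>With a vanishing derivative of \<nu>, the chain rule would annihilate the
    velocity of \<alpha> in every coordinate.\<close>
  have "deriv \<nu> x \<noteq> 0"
  proof
    assume 0: "deriv \<nu> x = 0"
    obtain j where j: "j < mdim M" "deriv (\<lambda>s. f (\<alpha> s) j) x \<noteq> 0"
      using immersed_at_derivE[OF \<alpha> U(1)] U(2) eq by auto
    have "real_analytic_at (\<lambda>s. f (\<beta> s) j) (\<nu> x)"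
      using analytic_curve_at_coordinate[OF \<beta>c U(1,2) j(1)] \<nu>x by simp
    from DERIV_chain2[OF real_analytic_at_has_deriv[OF this] real_analytic_at_has_deriv[OF \<nu>]] 0
    have "((\<lambda>t. f (\<beta> (\<nu> t)) j) has_real_derivative 0) (at x)" by simp
    moreover have "eventually (\<lambda>t. f (\<alpha> t) j = f (\<beta> (\<nu> t)) j) (nhds x)"
      using ev by (rule eventually_mono) simp
    ultimately have "deriv (\<lambda>t. f (\<alpha> t) j) x = 0"
      by (simp add: DERIV_imp_deriv deriv_cong_ev)
    with j(2) show False ..
  qed
  with \<nu> \<nu>x ev \<delta>(1) uniq have "parameter_change \<alpha> \<beta> x y \<nu> \<delta>"
    unfolding parameter_change_def by blast
  thus ?thesis by (rule that)
qed

lemma immersed_at_locally_injective: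
  assumes M: "analytic_manifold M" and \<beta>: "immersed_at M \<beta> y"
  obtains \<delta> where "\<delta> > 0" "inj_on \<beta> (ball y \<delta>)"
proof -
  obtain U f i g where "(U, f) \<in> charts M" "\<beta> y \<in> U" "i < mdim M" "real_analytic_at g (f (\<beta> y) i)"
    and "eventually (\<lambda>s. g (f (\<beta> s) i) = s) (nhds y)"
    using immersed_at_coordinate[OF M \<beta>] .
  then obtain \<delta> where \<delta>: "\<delta> > 0" "\<And>s. dist s y < \<delta> \<Longrightarrow> g (f (\<beta> s) i) = s"
    unfolding eventually_nhds_metric by blast
  have "inj_on \<beta> (ball y \<delta>)"
    by (rule inj_on_inverseI[of _ "\<lambda>p. g (f p i)"]) (simp add: \<delta>(2) dist_commute)
  with \<delta>(1) show ?thesis by (rule that)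
qed

text \<open>The inverse on the image is g applied to a chart coordinate, hence continuous for the
  subspace topology. All subsets D are covered because \<open>overlap_of_germ\<close> shrinks its
  intervals afterwards.\<close>

lemma immersed_at_locally_embedding:
  assumes M: "analytic_manifold M" and imm: "open_analytic_immersion M J \<beta>" and y: "y \<in> J"
  obtains \<delta> where "\<delta> > 0" "ball y \<delta> \<subseteq> J"
    "\<And>D. D \<subseteq> ball y \<delta> \<Longrightarrow> embedding_map (top_of_set D) (mtop M) \<beta>"
proof -
  have J: "open J" and \<beta>: "\<And>s. s \<in> J \<Longrightarrow> immersed_at M \<beta> s"
    and cont: "continuous_map (top_of_set J) (mtop M) \<beta>"
    using imm open_analytic_immersion_iff[of M J \<beta>]
    by (auto simp: open_interval_def open_analytic_immersion_def)
  obtain U f i g where U: "(U, f) \<in> charts M" "\<beta> y \<in> U" "i < mdim M"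
    and g: "real_analytic_at g (f (\<beta> y) i)" "eventually (\<lambda>s. g (f (\<beta> s) i) = s) (nhds y)"
    using immersed_at_coordinate[OF M \<beta>[OF y]] .
  have c: "analytic_curve_at M \<beta> y" using \<beta>[OF y] by (simp add: immersed_at_def)
  hence "isCont (\<lambda>s. f (\<beta> s) i) y"
    using U by (intro real_analytic_at_isCont) (rule analytic_curve_at_coordinate)
  hence "filterlim (\<lambda>s. f (\<beta> s) i) (nhds (f (\<beta> y) i)) (nhds y)"
    using isCont_def tendsto_at_iff_tendsto_nhds by blast
  hence "eventually (\<lambda>s. real_analytic_at g (f (\<beta> s) i)) (nhds y)"
    using real_analytic_at_eventually[OF g(1)] by (rule eventually_compose_filterlim[rotated])
  moreover have "eventually (\<lambda>s. \<beta> s \<in> U) (nhds y)"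
    using c U chart_open[OF M U(1)] by (auto simp: analytic_curve_at_def intro: limitin_eventually)
  moreover have "eventually (\<lambda>s. s \<in> J) (nhds y)" using J y by (rule eventually_nhds_in_open)
  ultimately have "eventually (\<lambda>s. real_analytic_at g (f (\<beta> s) i) \<and> \<beta> s \<in> U \<and> s \<in> J \<and> g (f (\<beta> s) i) = s) (nhds y)"
    using g(2) by eventually_elim auto
  then obtain \<delta> where \<delta>: "\<delta> > 0" "\<And>s. s \<in> ball y \<delta> \<Longrightarrow>
      real_analytic_at g (f (\<beta> s) i) \<and> \<beta> s \<in> U \<and> s \<in> J \<and> g (f (\<beta> s) i) = s"
    unfolding eventually_nhds_metric by (auto simp: dist_commute)
  have "embedding_map (top_of_set D) (mtop M) \<beta>" if D: "D \<subseteq> ball y \<delta>" for D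
  proof -
    have "continuous_map (top_of_set D) (mtop M) \<beta>"
      using continuous_map_from_subtopology_mono[OF cont] D \<delta>(2) by blast
    moreover have "continuous_map (subtopology (mtop M) (\<beta> ` D)) euclidean (\<lambda>p. g (f p i))"
    proof -
      have *: "continuous_map (subtopology (mtop M) (\<beta> ` D)) (top_of_set ((\<lambda>p. f p i) ` (\<beta> ` D))) (\<lambda>p. f p i)"
      proof -
        have "\<beta> ` D \<subseteq> U" using D \<delta>(2) by blast
        from continuous_map_from_subtopology_mono[OF chart_coordinate_continuous[OF M U(1), of i] this]
        show ?thesis by (simp add: continuous_map_in_subtopology image_subset_iff)
      qed
      have "continuous_on ((\<lambda>p. f p i) ` (\<beta> ` D)) g"
        using D \<delta>(2) by (intro continuous_at_imp_continuous_on) (auto intro!: real_analytic_at_isCont)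
      hence "continuous_map (top_of_set ((\<lambda>p. f p i) ` (\<beta> ` D))) euclidean g" by simp
      from continuous_map_compose[OF * this] show ?thesis by (simp add: o_def)
    qed
    ultimately have "homeomorphic_maps (top_of_set D) (subtopology (mtop M) (\<beta> ` D)) \<beta> (\<lambda>p. g (f p i))"
      unfolding homeomorphic_maps_def using D \<delta>(2)
      by (auto simp: continuous_map_in_subtopology)
    thus ?thesis unfolding embedding_map_def by (auto simp: homeomorphic_map_maps)
  qed
  with \<delta> show ?thesis by (intro that[of \<delta>]) auto
qed

lemma analytic_map_compose_curve:
  assumes M: "analytic_manifold M" and N: "analytic_manifold N" and F: "analytic_map M N F"
    and \<alpha>: "analytic_curve_at M \<alpha> t"
  shows "analytic_curve_at N (\<lambda>s. F (\<alpha> s)) t"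
    and "(U, f) \<in> charts M \<Longrightarrow> \<alpha> t \<in> U \<Longrightarrow> (V, h) \<in> charts N \<Longrightarrow> F (\<alpha> t) \<in> V \<Longrightarrow>
      (\<And>i. i < mdim M \<Longrightarrow> deriv (\<lambda>s. f (\<alpha> s) i) t = 0) \<Longrightarrow> j < mdim N \<Longrightarrow>
      deriv (\<lambda>s. h (F (\<alpha> s)) j) t = 0"
proof -
  have lim: "limitin (mtop M) \<alpha> (\<alpha> t) (nhds t)" using \<alpha> by (simp add: analytic_curve_at_def)
  have cont: "continuous_map (mtop M) (mtop N) F" using F by (simp add: analytic_map_def)
  have *: "real_analytic_at (\<lambda>s. h (F (\<alpha> s)) j) t"
    "(\<And>i. i < mdim M \<Longrightarrow> deriv (\<lambda>s. f (\<alpha> s) i) t = 0) \<Longrightarrow> deriv (\<lambda>s. h (F (\<alpha> s)) j) t = 0"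
    if U: "(U, f) \<in> charts M" "\<alpha> t \<in> U" and V: "(V, h) \<in> charts N" "F (\<alpha> t) \<in> V" and j: "j < mdim N"
    for U V f h j
  proof -
    define W where "W = f ` (U \<inter> F -` V)"
    have W_eq: "U \<inter> F -` V = U \<inter> {x \<in> topspace (mtop M). F x \<in> V}"
      using chart_subset[OF M U(1)] by auto
    have op: "openin (mtop M) (U \<inter> F -` V)"
      unfolding W_eq using chart_open[OF M U(1)] openin_continuous_map_preimage[OF cont chart_open[OF N V(1)]]
      by (rule openin_Int)
    have W: "openin (Euclidean_space (mdim M)) W"
      unfolding W_def by (rule chart_open_image[OF M U(1) op]) auto
    have ra: "real_analytic_on (mdim M) (mdim N) W (h \<circ> F \<circ> inv_into U f)"
      using F U V unfolding analytic_map_def W_def by auto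
    have ev: "eventually (\<lambda>s. \<alpha> s \<in> U \<inter> F -` V) (nhds t)"
      using limitin_eventually[OF lim op] U V by simp
    have evW: "eventually (\<lambda>s. f (\<alpha> s) \<in> W) (nhds t)"
      using ev by (rule eventually_mono) (auto simp: W_def)
    have an: "real_analytic_at (\<lambda>s. f (\<alpha> s) i) t" if "i < mdim M" for i
      using \<alpha> U that by (rule analytic_curve_at_coordinate)
    have eq: "eventually (\<lambda>s. (h \<circ> F \<circ> inv_into U f) (f (\<alpha> s)) j = h (F (\<alpha> s)) j) (nhds t)"
      using ev by (rule eventually_mono) (simp add: inv_into_f_f[OF chart_inj[OF M U(1)]])
    show "real_analytic_at (\<lambda>s. h (F (\<alpha> s)) j) t"
      using real_analytic_on_compose_curve(1)[OF ra W an evW j] real_analytic_at_cong[OF eq] by simp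
    show "deriv (\<lambda>s. h (F (\<alpha> s)) j) t = 0" if "\<And>i. i < mdim M \<Longrightarrow> deriv (\<lambda>s. f (\<alpha> s) i) t = 0"
      using real_analytic_on_compose_curve(2)[OF ra W an evW j that] deriv_cong_ev[OF eq refl] by simp
  qed
  have "limitin (mtop N) (\<lambda>s. F (\<alpha> s)) (F (\<alpha> t)) (nhds t)"
    using continuous_map_limit[OF cont lim] by (simp add: o_def)
  moreover obtain U' f' where "(U', f') \<in> charts M" "\<alpha> t \<in> U'"
    using chart_exists[OF M] lim by (auto simp: limitin_def)
  ultimately show "analytic_curve_at N (\<lambda>s. F (\<alpha> s)) t"
    using *(1) by (intro analytic_curve_atI) blast+
  show "(U, f) \<in> charts M \<Longrightarrow> \<alpha> t \<in> U \<Longrightarrow> (V, h) \<in> charts N \<Longrightarrow> F (\<alpha> t) \<in> V \<Longrightarrow>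
      (\<And>i. i < mdim M \<Longrightarrow> deriv (\<lambda>s. f (\<alpha> s) i) t = 0) \<Longrightarrow> j < mdim N \<Longrightarrow>
      deriv (\<lambda>s. h (F (\<alpha> s)) j) t = 0"
    using *(2) by blast
qed

text \<open>If the velocity of \<open>F \<circ> \<alpha>\<close> vanished, then by the second part
  of \<open>analytic_map_compose_curve\<close> so would that of
  \<open>H \<circ> F \<circ> \<alpha>\<close>, which is \<open>\<alpha>\<close> near t.\<close>

lemma immersed_at_analytic_map:
  assumes M: "analytic_manifold M" and N: "analytic_manifold N"
    and F: "analytic_map M N F" and H: "analytic_map N M H"
    and inv: "\<And>x. x \<in> topspace (mtop M) \<Longrightarrow> H (F x) = x" and \<alpha>: "immersed_at M \<alpha> t"
  shows "immersed_at N (\<lambda>s. F (\<alpha> s)) t"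
proof -
  have \<alpha>c: "analytic_curve_at M \<alpha> t" using \<alpha> by (simp add: immersed_at_def)
  hence lim: "limitin (mtop M) \<alpha> (\<alpha> t) (nhds t)" by (simp add: analytic_curve_at_def)
  obtain U f where U: "(U, f) \<in> charts M" "\<alpha> t \<in> U"
    using chart_exists[OF M] lim by (auto simp: limitin_def)
  have c: "analytic_curve_at N (\<lambda>s. F (\<alpha> s)) t" by (rule analytic_map_compose_curve(1)[OF M N F \<alpha>c])
  have ev: "eventually (\<lambda>s. \<alpha> s \<in> topspace (mtop M)) (nhds t)"
    using lim by (intro limitin_eventually) (auto simp: limitin_def)
  have "\<exists>i<mdim N. deriv (\<lambda>s. h (F (\<alpha> s)) i) t \<noteq> 0" if V: "(V, h) \<in> charts N" "F (\<alpha> t) \<in> V" for V h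
  proof (rule ccontr)
    assume "\<not> ?thesis"
    hence 0: "deriv (\<lambda>s. h (F (\<alpha> s)) i) t = 0" if "i < mdim N" for i using that by blast
    have "deriv (\<lambda>s. f (\<alpha> s) j) t = 0" if "j < mdim M" for j
    proof -
      have "H (F (\<alpha> t)) \<in> U" using U inv chart_subset[OF M U(1)] by auto
      from analytic_map_compose_curve(2)[OF N M H c V U(1) this 0 that]
      have "deriv (\<lambda>s. f (H (F (\<alpha> s))) j) t = 0" .
      moreover have "eventually (\<lambda>s. f (H (F (\<alpha> s))) j = f (\<alpha> s) j) (nhds t)"
        using ev by (rule eventually_mono) (simp add: inv)
      ultimately show ?thesis by (simp add: deriv_cong_ev)
    qed
    with immersed_at_derivE[OF \<alpha> U] show False by metis
  qed
  with c show ?thesis by (intro immersed_atI) blast+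
qed

section \<open>Germs of symmetries of a curve\<close>

locale acted_curve =
  fixes G :: "('g, 'r) monoid_scheme" (structure) and M :: "'m manifold" and \<phi> :: "'g \<Rightarrow> 'm \<Rightarrow> 'm"
    and I :: "real set" and \<gamma> :: "real \<Rightarrow> 'm"
  assumes manifold: "analytic_manifold M" and action: "group_action G (topspace (mtop M)) \<phi>"
    and analytic: "analytic_in_space G M \<phi>" and open_interval_I: "open_interval I"
    and immersion: "analytic_immersion M I \<gamma>"
begin

sublocale group_action G "topspace (mtop M)" \<phi> by (rule action)

sublocale group G using group_hom group_hom.axioms(1) by blast

abbreviation tr :: "'g \<Rightarrow> real \<Rightarrow> 'm" where "tr g \<equiv> translate \<phi> g \<gamma>"

abbreviation stab :: "'g set" where "stab \<equiv> curve_stabilizer G \<phi> I \<gamma>"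

lemma open_I: "open I" and connected_I: "connected I"
  using open_interval_I by (auto simp: open_interval_def real_interval_def)

lemma immersed_\<gamma>: "t \<in> I \<Longrightarrow> immersed_at M \<gamma> t"
proof -
  assume t: "t \<in> I"
  from immersion obtain J \<delta> where J: "I \<subseteq> J" "open_analytic_immersion M J \<delta>" "\<And>t. t \<in> I \<Longrightarrow> \<delta> t = \<gamma> t"
    unfolding analytic_immersion_def by blast
  have "eventually (\<lambda>s. \<delta> s = \<gamma> s) (nhds t)"
    using eventually_nhds_in_open[OF open_I t] by (rule eventually_mono) (rule J(3))
  moreover have "immersed_at M \<delta> t" using J(1,2) t by (auto simp: open_analytic_immersion_iff)
  ultimately show ?thesis by (rule immersed_at_cong)
qed

lemma \<gamma>_top: "t \<in> I \<Longrightarrow> \<gamma> t \<in> topspace (mtop M)"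
  using immersed_\<gamma> by (auto simp: immersed_at_def analytic_curve_at_def limitin_def)

lemma act_one: "x \<in> topspace (mtop M) \<Longrightarrow> \<phi> \<one> x = x"
  using id_eq_one by (metis restrict_apply')

lemma act_mult: "x \<in> topspace (mtop M) \<Longrightarrow> g \<in> carrier G \<Longrightarrow> h \<in> carrier G \<Longrightarrow> \<phi> (g \<otimes> h) x = \<phi> g (\<phi> h x)"
  by (rule composition_rule)

lemma act_inv: "x \<in> topspace (mtop M) \<Longrightarrow> g \<in> carrier G \<Longrightarrow> \<phi> (inv g) (\<phi> g x) = x"
  by (metis act_mult act_one inv_closed l_inv)

lemma tr_one: "t \<in> I \<Longrightarrow> tr \<one> t = \<gamma> t"
  by (simp add: translate_def act_one \<gamma>_top)

lemma tr_mult: "t \<in> I \<Longrightarrow> g \<in> carrier G \<Longrightarrow> h \<in> carrier G \<Longrightarrow> tr (g \<otimes> h) t = \<phi> g (tr h t)"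
  by (simp add: translate_def act_mult \<gamma>_top)

lemma immersed_tr: "g \<in> carrier G \<Longrightarrow> t \<in> I \<Longrightarrow> immersed_at M (tr g) t"
  unfolding translate_def using analytic
  by (intro immersed_at_analytic_map[OF manifold manifold, of "\<phi> g" "\<phi> (inv g)"] immersed_\<gamma>)
     (auto simp: analytic_in_space_def act_inv)

lemma open_immersion_tr: "g \<in> carrier G \<Longrightarrow> open_analytic_immersion M I (tr g)"
  by (simp add: open_analytic_immersion_iff open_interval_I immersed_tr)

lemma open_immersion_\<gamma>: "open_analytic_immersion M I \<gamma>"
  by (simp add: open_analytic_immersion_iff open_interval_I immersed_\<gamma>)

text \<open>This is equality of the classes [g] and [h], see \<open>curve_class_eq_iff\<close>,
  phrased as equality of translated curves because that is what analytic continuation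
  produces.\<close>

definition same_translate :: "'g \<Rightarrow> 'g \<Rightarrow> bool" (infix \<open>\<doteq>\<close> 50) where
  "g \<doteq> h \<longleftrightarrow> g \<in> carrier G \<and> h \<in> carrier G \<and> (\<forall>t\<in>I. tr g t = tr h t)"

lemma same_translate_refl: "g \<in> carrier G \<Longrightarrow> g \<doteq> g"
  and same_translate_sym: "g \<doteq> h \<Longrightarrow> h \<doteq> g"
  and same_translate_trans: "g \<doteq> h \<Longrightarrow> h \<doteq> k \<Longrightarrow> g \<doteq> k"
  by (auto simp: same_translate_def)

lemma same_translate_mult_left: "g \<doteq> h \<Longrightarrow> k \<in> carrier G \<Longrightarrow> k \<otimes> g \<doteq> k \<otimes> h"
  by (auto simp: same_translate_def tr_mult)

lemma stab_iff: "g \<in> stab \<longleftrightarrow> g \<doteq> \<one>"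
  by (auto simp: curve_stabilizer_def same_translate_def tr_one)

lemma subgroup_stab: "subgroup stab G"
proof
  show "stab \<subseteq> carrier G" by (auto simp: curve_stabilizer_def)
  show "\<one> \<in> stab" by (simp add: stab_iff same_translate_refl)
  show "x \<otimes> y \<in> stab" if "x \<in> stab" "y \<in> stab" for x y
  proof -
    have "x \<otimes> y \<doteq> x \<otimes> \<one>" using that by (intro same_translate_mult_left) (auto simp: stab_iff same_translate_def)
    thus ?thesis using that by (auto simp: stab_iff same_translate_def)
  qed
  show "inv x \<in> stab" if "x \<in> stab" for x
  proof -
    have x: "x \<doteq> \<one>" "x \<in> carrier G" using that by (auto simp: stab_iff same_translate_def)
    from same_translate_mult_left[OF x(1), of "inv x"] x(2) show ?thesis
      by (simp add: stab_iff same_translate_sym)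
  qed
qed

lemma same_translate_iff: "g \<in> carrier G \<Longrightarrow> h \<in> carrier G \<Longrightarrow> g \<doteq> h \<longleftrightarrow> inv g \<otimes> h \<in> stab"
proof
  assume g: "g \<in> carrier G" "h \<in> carrier G"
  show "inv g \<otimes> h \<in> stab" if "g \<doteq> h"
    using same_translate_mult_left[OF that, of "inv g"] g by (simp add: stab_iff same_translate_sym)
  show "g \<doteq> h" if "inv g \<otimes> h \<in> stab"
  proof -
    have "inv g \<otimes> h \<doteq> \<one>" using that by (simp add: stab_iff)
    from same_translate_mult_left[OF this g(1)] have "g \<otimes> (inv g \<otimes> h) \<doteq> g" using g by simp
    thus ?thesis using g by (simp add: same_translate_sym flip: m_assoc)
  qed
qed

lemma curve_class_eq_iff:
  assumes g: "g \<in> carrier G" "h \<in> carrier G"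
  shows "curve_class G \<phi> I \<gamma> g = curve_class G \<phi> I \<gamma> h \<longleftrightarrow> g \<doteq> h"
proof
  assume "curve_class G \<phi> I \<gamma> g = curve_class G \<phi> I \<gamma> h"
  hence "h \<in> g <# stab" using lcos_self[OF g(2) subgroup_stab] by (simp add: curve_class_def)
  thus "g \<doteq> h" unfolding same_translate_iff[OF g]
    using subgroup.lcos_module_imp[OF subgroup_stab is_group g(1)] by blast
next
  assume "g \<doteq> h"
  hence "h \<in> g <# stab" unfolding same_translate_iff[OF g]
    using subgroup.lcos_module_rev[OF subgroup_stab is_group g] by blast
  thus "curve_class G \<phi> I \<gamma> g = curve_class G \<phi> I \<gamma> h"
    unfolding curve_class_def using l_repr_independence[OF _ g(1) subgroup_stab] by blast
qed

lemma mem_curve_class: "g \<in> carrier G \<Longrightarrow> h \<in> curve_class G \<phi> I \<gamma> g \<Longrightarrow> h \<doteq> g"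
  using subgroup.lcos_module_imp[OF subgroup_stab is_group, of g h]
    subgroup.elemlcos_carrier[OF subgroup_stab is_group, of g h] same_translate_iff[of g h]
  by (simp add: curve_class_def same_translate_sym)

text \<open>The set of parameters near which both translates agree is open, and by the identity
  theorem its complement in I is open as well; I is connected.\<close>

lemma tr_identity:
  assumes g: "g \<in> carrier G" and h: "h \<in> carrier G" and x: "x \<in> I"
    and ev: "eventually (\<lambda>t. tr g t = tr h t) (nhds x)"
  shows "g \<doteq> h"
proof -
  define T where "T = {t \<in> I. eventually (\<lambda>s. tr g s = tr h s) (nhds t)}"
  have "open T"
  proof (subst open_subopen, clarify)
    fix t assume t: "t \<in> T"
    then obtain V where V: "open V" "t \<in> V" "\<forall>s\<in>V. tr g s = tr h s"
      unfolding T_def eventually_nhds by blast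
    hence "V \<inter> I \<subseteq> T" unfolding T_def eventually_nhds by blast
    thus "\<exists>V. open V \<and> t \<in> V \<and> V \<subseteq> T" using V t open_I by (intro exI[of _ "V \<inter> I"]) (auto simp: T_def)
  qed
  have "open (I - T)"
  proof (subst open_subopen, clarify)
    fix t assume t: "t \<in> I" "t \<notin> T"
    have "\<not> frequently (\<lambda>s. tr g s = tr h s) (at t)"
      using analytic_curves_identity[OF manifold immersed_at_imp_analytic_curve_at[OF immersed_tr[OF g t(1)]]
         immersed_at_imp_analytic_curve_at[OF immersed_tr[OF h t(1)]]] t
      by (auto simp: T_def)
    hence "eventually (\<lambda>s. tr g s \<noteq> tr h s) (at t)" by (simp add: frequently_def)
    then obtain V where V: "open V" "t \<in> V" "\<And>s. s \<in> V \<Longrightarrow> s \<noteq> t \<Longrightarrow> tr g s \<noteq> tr h s"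
      unfolding eventually_at_topological by blast
    have "s \<notin> T" if s: "s \<in> V" for s
    proof (cases "s = t")
      case False
      with V(3) s show ?thesis using eventually_nhds_x_imp_x by (fastforce simp: T_def)
    qed (use t in simp)
    thus "\<exists>V. open V \<and> t \<in> V \<and> V \<subseteq> I - T"
      using V t open_I by (intro exI[of _ "V \<inter> I"]) auto
  qed
  have "T = I"
  proof (rule ccontr)
    assume "T \<noteq> I"
    hence "I - T \<noteq> {}" by (auto simp: T_def)
    moreover have "x \<in> T" using x ev by (simp add: T_def)
    ultimately show False
      using connectedD[OF connected_I \<open>open T\<close> \<open>open (I - T)\<close>] by (auto simp: T_def)
  qed
  hence "tr g t = tr h t" if "t \<in> I" for t
    using that eventually_nhds_x_imp_x unfolding T_def by fastforce
  thus ?thesis using g h by (simp add: same_translate_def)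
qed

text \<open>The sign e is part of the data because signs multiply under composition and the
  orientation arguments compare them.\<close>

definition germ :: "'g \<Rightarrow> real \<Rightarrow> real \<Rightarrow> real \<Rightarrow> bool" where
  "germ g x y e \<longleftrightarrow> g \<in> carrier G \<and> x \<in> I \<and> y \<in> I \<and>
     (\<exists>\<nu>. real_analytic_at \<nu> x \<and> \<nu> x = y \<and> deriv \<nu> x \<noteq> 0 \<and> sgn (deriv \<nu> x) = e \<and>
        eventually (\<lambda>t. tr g t = \<gamma> (\<nu> t)) (nhds x))"

lemma germ_carrier: "germ g x y e \<Longrightarrow> g \<in> carrier G"
  and germ_in_I: "germ g x y e \<Longrightarrow> x \<in> I" "germ g x y e \<Longrightarrow> y \<in> I"
  and germ_sign: "germ g x y e \<Longrightarrow> e = 1 \<or> e = -1"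
  by (auto simp: germ_def sgn_if split: if_splits)

lemma curves_accumulateI_eventually:
  assumes "isCont \<nu> x" "\<nu> x = y" "eventually (\<lambda>t. \<alpha> t = \<beta> (\<nu> t)) (nhds x)"
  shows "curves_accumulate \<alpha> \<beta> x y"
  unfolding curves_accumulate_def
proof (intro allI impI)
  fix \<delta> :: real assume \<delta>: "\<delta> > 0"
  from assms(1,2) have "eventually (\<lambda>t. dist (\<nu> t) y < \<delta>) (at x)"
    using \<delta> by (auto simp: isCont_def dest: tendstoD)
  moreover have "eventually (\<lambda>t. dist t x < \<delta>) (at x)"
    using \<delta> by (auto simp: eventually_at)
  moreover have "eventually (\<lambda>t. \<alpha> t = \<beta> (\<nu> t)) (at x)"
    using assms(3) by (simp add: eventually_nhds_conv_at)
  moreover have "eventually (\<lambda>t. t \<noteq> x) (at x)" by (simp add: eventually_at_filter)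
  ultimately have "eventually (\<lambda>t. t \<noteq> x \<and> \<bar>t - x\<bar> < \<delta> \<and> \<bar>\<nu> t - y\<bar> < \<delta> \<and> \<alpha> t = \<beta> (\<nu> t)) (at x)"
    by eventually_elim (auto simp: dist_real_def)
  from eventually_happens[OF this] show "\<exists>t s. t \<noteq> x \<and> \<bar>t - x\<bar> < \<delta> \<and> \<bar>s - y\<bar> < \<delta> \<and> \<alpha> t = \<beta> s"
    by auto
qed

lemma germI_accumulate:
  assumes g: "g \<in> carrier G" and xy: "x \<in> I" "y \<in> I" and acc: "curves_accumulate (tr g) \<gamma> x y"
  obtains e where "germ g x y e"
proof -
  obtain \<nu> \<delta> where "parameter_change (tr g) \<gamma> x y \<nu> \<delta>"
    using curves_accumulate_parameter_change[OF manifold immersed_tr[OF g xy(1)] immersed_\<gamma>[OF xy(2)] acc] .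
  with g xy have "germ g x y (sgn (deriv \<nu> x))" unfolding germ_def parameter_change_def by blast
  thus ?thesis by (rule that)
qed

text \<open>A germ with a radius on which it persists with the same sign. Uniqueness of signs and of
  continuations rests on the last clause.\<close>

definition germ_chart :: "'g \<Rightarrow> real \<Rightarrow> real \<Rightarrow> real \<Rightarrow> (real \<Rightarrow> real) \<Rightarrow> real \<Rightarrow> bool" where
  "germ_chart g x y e \<nu> \<delta> \<longleftrightarrow> \<delta> > 0 \<and> \<nu> x = y \<and>
     (\<forall>t. \<bar>t - x\<bar> < \<delta> \<longrightarrow> t \<in> I \<and> \<nu> t \<in> I \<and> real_analytic_at \<nu> t \<and> deriv \<nu> t \<noteq> 0 \<and>
        sgn (deriv \<nu> t) = e \<and> tr g t = \<gamma> (\<nu> t) \<and> germ g t (\<nu> t) e) \<and>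
     (\<forall>t s. \<bar>t - x\<bar> < \<delta> \<longrightarrow> \<bar>s - y\<bar> < \<delta> \<longrightarrow> tr g t = \<gamma> s \<longrightarrow> s = \<nu> t)"

lemma germ_chartD:
  assumes "germ_chart g x y e \<nu> \<delta>"
  shows "\<delta> > 0" "\<nu> x = y"
    "\<And>t. \<bar>t - x\<bar> < \<delta> \<Longrightarrow> t \<in> I \<and> \<nu> t \<in> I \<and> real_analytic_at \<nu> t \<and> deriv \<nu> t \<noteq> 0 \<and> sgn (deriv \<nu> t) = e"
    "\<And>t. \<bar>t - x\<bar> < \<delta> \<Longrightarrow> tr g t = \<gamma> (\<nu> t)"
    "\<And>t. \<bar>t - x\<bar> < \<delta> \<Longrightarrow> germ g t (\<nu> t) e"
    "\<And>t s. \<bar>t - x\<bar> < \<delta> \<Longrightarrow> \<bar>s - y\<bar> < \<delta> \<Longrightarrow> tr g t = \<gamma> s \<Longrightarrow> s = \<nu> t"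
  using assms unfolding germ_chart_def by blast+

lemma germE:
  assumes "germ g x y e"
  obtains \<nu> \<delta> where "germ_chart g x y e \<nu> \<delta>"
proof -
  from assms obtain \<nu> where g: "g \<in> carrier G" and xy: "x \<in> I" "y \<in> I"
    and \<nu>: "real_analytic_at \<nu> x" "\<nu> x = y" "deriv \<nu> x \<noteq> 0" "sgn (deriv \<nu> x) = e"
      "eventually (\<lambda>t. tr g t = \<gamma> (\<nu> t)) (nhds x)"
    unfolding germ_def by blast
  have acc: "curves_accumulate (tr g) \<gamma> x y"
    by (rule curves_accumulateI_eventually[OF real_analytic_at_isCont[OF \<nu>(1)] \<nu>(2,5)])
  \<comment> \<open>The \<nu> from the definition comes without the uniqueness clause; \<nu>' has
    it, and this clause forces both to agree near x.\<close>
  obtain \<nu>' \<delta> where "parameter_change (tr g) \<gamma> x y \<nu>' \<delta>"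
    using curves_accumulate_parameter_change[OF manifold immersed_tr[OF g xy(1)] immersed_\<gamma>[OF xy(2)] acc] .
  hence \<nu>': "real_analytic_at \<nu>' x" "\<nu>' x = y" "deriv \<nu>' x \<noteq> 0"
    "eventually (\<lambda>t. tr g t = \<gamma> (\<nu>' t)) (nhds x)"
    and \<delta>: "\<delta> > 0" "\<And>t s. \<bar>t - x\<bar> < \<delta> \<Longrightarrow> \<bar>s - y\<bar> < \<delta> \<Longrightarrow> tr g t = \<gamma> s \<Longrightarrow> s = \<nu>' t"
    unfolding parameter_change_def by blast+
  have lim: "filterlim \<nu> (nhds y) (nhds x)"
    using real_analytic_at_isCont[OF \<nu>(1)] \<nu>(2) isCont_def tendsto_at_iff_tendsto_nhds by blast
  have "eventually (\<lambda>s. \<bar>s - y\<bar> < \<delta>) (nhds y)" "eventually (\<lambda>t. \<bar>t - x\<bar> < \<delta>) (nhds x)"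
    using \<delta>(1) by (auto simp: eventually_nhds_metric dist_real_def)
  from eventually_compose_filterlim[OF this(1) lim] this(2) \<nu>(5)
  have ev: "eventually (\<lambda>t. \<nu> t = \<nu>' t) (nhds x)"
    by eventually_elim (rule \<delta>(2))
  hence "deriv \<nu> x = deriv \<nu>' x" by (rule deriv_cong_ev) simp
  with \<nu>(4) have e: "sgn (deriv \<nu>' x) = e" by simp
  obtain \<nu>d where \<nu>d: "eventually (\<lambda>t. (\<nu>' has_real_derivative \<nu>d t) (at t)) (nhds x)" "isCont \<nu>d x" "\<nu>d x = deriv \<nu>' x"
    using real_analytic_at_derivE[OF \<nu>'(1)] .
  \<comment> \<open>Multiplication by e turns preservation of the sign into positivity, an open
    condition.\<close>
  have "filterlim (\<lambda>t. e * \<nu>d t) (nhds (e * \<nu>d x)) (nhds x)"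
    using \<nu>d(2) isCont_def tendsto_at_iff_tendsto_nhds tendsto_mult_left by blast
  moreover have "e * \<nu>d x > 0" using e \<nu>'(3) \<nu>d(3) by (auto simp: sgn_real_def split: if_splits)
  ultimately have "eventually (\<lambda>t. e * \<nu>d t > 0) (nhds x)" by (auto intro: order_tendstoD)
  moreover have "filterlim \<nu>' (nhds y) (nhds x)"
    using real_analytic_at_isCont[OF \<nu>'(1)] \<nu>'(2) isCont_def tendsto_at_iff_tendsto_nhds by blast
  hence "eventually (\<lambda>t. \<nu>' t \<in> I) (nhds x)"
    using eventually_nhds_in_open[OF open_I xy(2)] by (rule eventually_compose_filterlim[rotated])
  moreover have "eventually (\<lambda>t. t \<in> I) (nhds x)" by (rule eventually_nhds_in_open[OF open_I xy(1)])
  moreover have ev': "eventually (\<lambda>t. eventually (\<lambda>t. tr g t = \<gamma> (\<nu>' t)) (nhds t)) (nhds x)"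
    using \<nu>'(4) by (simp add: eventually_eventually)
  ultimately have "eventually (\<lambda>t. t \<in> I \<and> \<nu>' t \<in> I \<and> real_analytic_at \<nu>' t \<and> deriv \<nu>' t \<noteq> 0 \<and> sgn (deriv \<nu>' t) = e \<and>
      eventually (\<lambda>t. tr g t = \<gamma> (\<nu>' t)) (nhds t)) (nhds x)"
    using real_analytic_at_eventually[OF \<nu>'(1)] \<nu>d(1)
  proof eventually_elim
    case (elim t)
    from elim(6) have "deriv \<nu>' t = \<nu>d t" by (rule DERIV_imp_deriv)
    moreover have "e = 1 \<or> e = -1" using e \<nu>'(3) by (auto simp: sgn_real_def split: if_splits)
    ultimately show ?case using elim by (auto simp: sgn_real_def)
  qed
  then obtain d where d: "d > 0" "\<And>t. \<bar>t - x\<bar> < d \<Longrightarrow> t \<in> I \<and> \<nu>' t \<in> I \<and> real_analytic_at \<nu>' t \<and> deriv \<nu>' t \<noteq> 0 \<and>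
      sgn (deriv \<nu>' t) = e \<and> eventually (\<lambda>t. tr g t = \<gamma> (\<nu>' t)) (nhds t)"
    unfolding eventually_nhds_metric dist_real_def by blast
  have gt: "germ g t (\<nu>' t) e" if "\<bar>t - x\<bar> < d" for t
    using d(2)[OF that] g unfolding germ_def by blast
  have "tr g t = \<gamma> (\<nu>' t)" if "\<bar>t - x\<bar> < d" for t
    using d(2)[OF that] eventually_nhds_x_imp_x by blast
  hence "germ_chart g x y e \<nu>' (min d \<delta>)"
    unfolding germ_chart_def using d \<delta> \<nu>'(2) gt by simp
  thus ?thesis by (rule that)
qed

text \<open>Any function witnessing a germ from x to y is forced to agree near x with the \<nu> of a
  \<open>germ_chart\<close>, hence has the same derivative there.\<close>

lemma germ_sign_unique:
  assumes "germ g x y e" "germ g x y e'"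
  shows "e = e'"
proof -
  obtain \<nu> \<delta> where "germ_chart g x y e \<nu> \<delta>" using germE[OF assms(1)] .
  note \<nu> = germ_chartD[OF this]
  obtain \<mu> where \<mu>: "real_analytic_at \<mu> x" "\<mu> x = y" "sgn (deriv \<mu> x) = e'"
      "eventually (\<lambda>t. tr g t = \<gamma> (\<mu> t)) (nhds x)"
    using assms(2) unfolding germ_def by blast
  have lim: "filterlim \<mu> (nhds y) (nhds x)"
    using real_analytic_at_isCont[OF \<mu>(1)] \<mu>(2) isCont_def tendsto_at_iff_tendsto_nhds by blast
  have "eventually (\<lambda>s. \<bar>s - y\<bar> < \<delta>) (nhds y)" "eventually (\<lambda>t. \<bar>t - x\<bar> < \<delta>) (nhds x)"
    using \<nu>(1) by (auto simp: eventually_nhds_metric dist_real_def)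
  from eventually_compose_filterlim[OF this(1) lim] this(2) \<mu>(4)
  have "eventually (\<lambda>t. \<mu> t = \<nu> t) (nhds x)"
    by eventually_elim (rule \<nu>(6))
  hence "deriv \<mu> x = deriv \<nu> x" by (rule deriv_cong_ev) simp
  with \<mu>(3) \<nu>(1) \<nu>(3)[of x] show ?thesis by simp
qed

lemma germ_cong: "g \<doteq> h \<Longrightarrow> germ g x y e \<Longrightarrow> germ h x y e"
proof -
  assume gh: "g \<doteq> h" and "germ g x y e"
  then obtain \<nu> where h: "h \<in> carrier G" and xy: "x \<in> I" "y \<in> I"
    and \<nu>: "real_analytic_at \<nu> x" "\<nu> x = y" "deriv \<nu> x \<noteq> 0" "sgn (deriv \<nu> x) = e"
      "eventually (\<lambda>t. tr g t = \<gamma> (\<nu> t)) (nhds x)"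
    unfolding germ_def same_translate_def by blast
  have "eventually (\<lambda>t. tr h t = \<gamma> (\<nu> t)) (nhds x)"
    using \<nu>(5) eventually_nhds_in_open[OF open_I xy(1)] by eventually_elim (use gh in \<open>auto simp: same_translate_def\<close>)
  with h xy \<nu> show ?thesis unfolding germ_def by blast
qed

lemma germ_one: "x \<in> I \<Longrightarrow> germ \<one> x x 1"
proof -
  assume x: "x \<in> I"
  have "eventually (\<lambda>t. tr \<one> t = \<gamma> t) (nhds x)"
    using eventually_nhds_in_open[OF open_I x] by eventually_elim (rule tr_one)
  moreover have "deriv (\<lambda>x. x) x = (1::real)" by (simp add: DERIV_imp_deriv)
  ultimately show ?thesis unfolding germ_def using x
    by (intro conjI exI[of _ "\<lambda>x. x"]) (auto simp: real_analytic_at_ident)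
qed

lemma germ_mult:
  assumes "germ g x y e" "germ h y z e'"
  shows "germ (h \<otimes> g) x z (e * e')"
proof -
  from assms(1) obtain \<nu> where g: "g \<in> carrier G" and xy: "x \<in> I" "y \<in> I"
    and \<nu>: "real_analytic_at \<nu> x" "\<nu> x = y" "deriv \<nu> x \<noteq> 0" "sgn (deriv \<nu> x) = e"
      "eventually (\<lambda>t. tr g t = \<gamma> (\<nu> t)) (nhds x)"
    unfolding germ_def by blast
  from assms(2) obtain \<mu> where h: "h \<in> carrier G" and z: "z \<in> I"
    and \<mu>: "real_analytic_at \<mu> y" "\<mu> y = z" "deriv \<mu> y \<noteq> 0" "sgn (deriv \<mu> y) = e'"
      "eventually (\<lambda>t. tr h t = \<gamma> (\<mu> t)) (nhds y)"
    unfolding germ_def by blast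
  have an: "real_analytic_at (\<lambda>t. \<mu> (\<nu> t)) x"
    using \<nu> \<mu> by (intro real_analytic_at_compose[of \<nu> x \<mu>]) auto
  have der: "deriv (\<lambda>t. \<mu> (\<nu> t)) x = deriv \<mu> y * deriv \<nu> x"
    using DERIV_chain2[of \<mu> "deriv \<mu> y" \<nu> x "deriv \<nu> x" UNIV] real_analytic_at_has_deriv[OF \<nu>(1)]
      real_analytic_at_has_deriv[OF \<mu>(1)] \<nu>(2) by (intro DERIV_imp_deriv) simp
  have lim: "filterlim \<nu> (nhds y) (nhds x)"
    using real_analytic_at_isCont[OF \<nu>(1)] \<nu>(2) isCont_def tendsto_at_iff_tendsto_nhds by blast
  have "eventually (\<lambda>t. tr (h \<otimes> g) t = \<gamma> (\<mu> (\<nu> t))) (nhds x)"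
    using eventually_compose_filterlim[OF \<mu>(5) lim] \<nu>(5) eventually_nhds_in_open[OF open_I xy(1)]
    by eventually_elim (use g h in \<open>auto simp: act_mult \<gamma>_top translate_def\<close>)
  with g h xy z an der \<nu> \<mu> show ?thesis unfolding germ_def
    by (intro conjI exI[of _ "\<lambda>t. \<mu> (\<nu> t)"]) (auto simp: sgn_mult)
qed

text \<open>The function \<nu> is not inverted: the meeting points of g \<cdot> \<gamma> and
  \<gamma>, read backwards, accumulate at (y, x) and give a germ of the inverse. Its sign follows
  because the composite is a germ of the identity at x.\<close>

lemma germ_inv:
  assumes "germ g x y e"
  shows "germ (inv g) y x e"
proof -
  obtain \<nu> \<delta> where "germ_chart g x y e \<nu> \<delta>" using germE[OF assms] .
  note \<nu> = germ_chartD[OF this]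
  have g: "g \<in> carrier G" and xy: "x \<in> I" "y \<in> I" using assms by (auto simp: germ_def)
  have inv_tr: "tr (inv g) (\<nu> t) = \<gamma> t" if "\<bar>t - x\<bar> < \<delta>" for t
    using \<nu>(3,4)[OF that] g act_inv[OF \<gamma>_top, of t g] by (simp add: translate_def)
  obtain \<delta>' where \<delta>': "\<delta>' > 0" "inj_on (tr g) (ball x \<delta>')"
    using immersed_at_locally_injective[OF manifold immersed_tr[OF g xy(1)]] .
  have cont: "isCont \<nu> x" using \<nu>(1,3) by (intro real_analytic_at_isCont) auto
  have "curves_accumulate (tr (inv g)) \<gamma> y x"
    unfolding curves_accumulate_def
  proof (intro allI impI)
    fix d :: real assume d: "d > 0"
    have "eventually (\<lambda>t. dist (\<nu> t) y < d) (at x)"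
      using tendstoD[OF cont[unfolded isCont_def] d] \<nu>(2) by simp
    moreover have "eventually (\<lambda>t. t \<noteq> x \<and> \<bar>t - x\<bar> < min \<delta> (min \<delta>' d)) (at x)"
      using \<nu>(1) \<delta>'(1) d unfolding eventually_at dist_real_def by (intro exI[of _ "min \<delta> (min \<delta>' d)"]) auto
    ultimately have "eventually (\<lambda>t. dist (\<nu> t) y < d \<and> t \<noteq> x \<and> \<bar>t - x\<bar> < min \<delta> (min \<delta>' d)) (at x)"
      by eventually_elim auto
    from eventually_happens[OF this] obtain t where t: "dist (\<nu> t) y < d" "t \<noteq> x" "\<bar>t - x\<bar> < min \<delta> (min \<delta>' d)"
      by auto
    \<comment> \<open>Accumulation requires parameters different from y; they are, because g \<cdot>
      \<gamma> is injective near x.\<close>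
    have "\<nu> t \<noteq> y"
    proof
      assume "\<nu> t = y"
      hence "tr g t = tr g x" using \<nu>(1,2) \<nu>(4)[of t] \<nu>(4)[of x] t by simp
      moreover have "t \<in> ball x \<delta>'" "x \<in> ball x \<delta>'" using t \<delta>'(1) by (auto simp: dist_real_def abs_minus_commute)
      ultimately show False using \<delta>'(2) t(2) by (auto dest: inj_onD)
    qed
    thus "\<exists>t s. t \<noteq> y \<and> \<bar>t - y\<bar> < d \<and> \<bar>s - x\<bar> < d \<and> tr (inv g) t = \<gamma> s"
      using t inv_tr[of t] by (intro exI[of _ "\<nu> t"] exI[of _ t]) (auto simp: dist_real_def)
  qed
  then obtain e' where e': "germ (inv g) y x e'"
    using germI_accumulate[OF inv_closed[OF g] xy(2,1)] by blast
  from germ_mult[OF assms e'] have "germ \<one> x x (e * e')" using g by simp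
  from germ_sign_unique[OF this germ_one[OF xy(1)]] have "e * e' = 1" .
  with germ_sign[OF assms] germ_sign[OF e'] have "e = e'" by auto
  with e' show ?thesis by simp
qed

text \<open>This is where a germ compensates for a stabilizer that may fail to be normal: near x the
  curve k \<cdot> \<gamma> runs inside \<gamma>, where g and h agree, and \<open>tr_identity\<close>
  spreads the equality over I.\<close>

lemma same_translate_mult_right:
  assumes "g \<doteq> h" and k: "germ k x y e"
  shows "g \<otimes> k \<doteq> h \<otimes> k"
proof -
  from k obtain \<nu> where k': "k \<in> carrier G" and xy: "x \<in> I" "y \<in> I"
    and \<nu>: "real_analytic_at \<nu> x" "\<nu> x = y" 
      "eventually (\<lambda>t. tr k t = \<gamma> (\<nu> t)) (nhds x)"
    unfolding germ_def by blast
  have lim: "filterlim \<nu> (nhds y) (nhds x)"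
    using real_analytic_at_isCont[OF \<nu>(1)] \<nu>(2) isCont_def tendsto_at_iff_tendsto_nhds by blast
  have "eventually (\<lambda>t. tr (g \<otimes> k) t = tr (h \<otimes> k) t) (nhds x)"
    using eventually_compose_filterlim[OF eventually_nhds_in_open[OF open_I xy(2)] lim] \<nu>(3)
      eventually_nhds_in_open[OF open_I xy(1)]
    by eventually_elim (use assms(1) k' in \<open>auto simp: act_mult \<gamma>_top same_translate_def translate_def\<close>)
  with assms(1) k' xy(1) show ?thesis by (intro tr_identity) (auto simp: same_translate_def)
qed

lemma same_translate_inv:
  assumes gh: "g \<doteq> h" and g: "germ g x y e"
  shows "inv g \<doteq> inv h"
proof -
  have c: "g \<in> carrier G" "h \<in> carrier G" using gh by (auto simp: same_translate_def)
  have "germ (inv h) y x e" by (rule germ_inv[OF germ_cong[OF gh g]])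
  moreover have "inv g \<otimes> h \<doteq> \<one>" using gh same_translate_iff[OF c] stab_iff by blast
  ultimately have "inv g \<otimes> h \<otimes> inv h \<doteq> \<one> \<otimes> inv h" by (rule same_translate_mult_right[rotated])
  thus ?thesis using c by (simp add: m_assoc)
qed

end

lemma isCont_eventually_in_open:
  "isCont f x \<Longrightarrow> open U \<Longrightarrow> f x \<in> U \<Longrightarrow> eventually (\<lambda>t. f t \<in> U) (nhds x)"
  unfolding continuous_at_open eventually_nhds by blast

section \<open>Freeness of intervals in terms of germs\<close>

context acted_curve
begin

lemma is_interval_I: "is_interval I"
  using connected_I by (simp add: is_interval_connected_1)

lemma I_between: "a \<in> I \<Longrightarrow> b \<in> I \<Longrightarrow> a \<le> x \<Longrightarrow> x \<le> b \<Longrightarrow> x \<in> I"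
  using is_interval_I unfolding is_interval_1 by blast

lemma I_segment: "a \<in> I \<Longrightarrow> b \<in> I \<Longrightarrow> {a..b} \<subseteq> I"
  unfolding subset_eq Ball_def atLeastAtMost_iff using I_between by blast

lemma germ_eq: "germ g x y e \<Longrightarrow> tr g x = \<gamma> y"
  unfolding germ_def using eventually_nhds_x_imp_x by blast

lemma analytic_immersion_tr:
  assumes "g \<in> carrier G" "real_interval D" "D \<subseteq> I"
  shows "analytic_immersion M D (tr g)"
  unfolding analytic_immersion_def using open_immersion_tr[OF assms(1)] assms(2,3) by blast

lemma analytic_immersion_\<gamma>: "real_interval D \<Longrightarrow> D \<subseteq> I \<Longrightarrow> analytic_immersion M D \<gamma>"
  unfolding analytic_immersion_def using open_immersion_\<gamma> by blast

definition rigid :: "real set \<Rightarrow> bool" where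
  "rigid D \<longleftrightarrow> (\<forall>g x y e. x \<in> interior D \<longrightarrow> y \<in> interior D \<longrightarrow> germ g x y e \<longrightarrow> g \<in> stab)"

lemma rigidD: "rigid D \<Longrightarrow> x \<in> interior D \<Longrightarrow> y \<in> interior D \<Longrightarrow> germ g x y e \<Longrightarrow> g \<in> stab"
  unfolding rigid_def by blast

lemma rigid_subset: "rigid D \<Longrightarrow> E \<subseteq> D \<Longrightarrow> rigid E"
  unfolding rigid_def using interior_mono by blast

lemma open_interval_ball: "r > 0 \<Longrightarrow> open_interval (ball (x::real) r)"
  unfolding open_interval_def real_interval_def
  by (auto simp: interior_open)

lemma open_interval_nonempty: "open_interval J \<Longrightarrow> J \<noteq> {}"
  unfolding open_interval_def real_interval_def by auto

text \<open>Near the two ends both curves are embeddings, and \<nu> maps a small ball around x onto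
  an open interval around y with the same image.\<close>

lemma overlap_of_germ:
  assumes germ: "germ g x y e" and D: "D \<subseteq> I" and xD: "x \<in> interior D" and yD: "y \<in> interior D"
  shows "overlap M D (tr g) D \<gamma>"
proof -
  have g: "g \<in> carrier G" and xy: "x \<in> I" "y \<in> I" using germ by (auto simp: germ_def)
  obtain \<nu> \<delta> where "germ_chart g x y e \<nu> \<delta>" using germE[OF germ] .
  note \<nu> = germ_chartD[OF this]
  obtain d1 where d1: "d1 > 0" "ball x d1 \<subseteq> I"
    "\<And>D. D \<subseteq> ball x d1 \<Longrightarrow> embedding_map (top_of_set D) (mtop M) (tr g)"
    using immersed_at_locally_embedding[OF manifold open_immersion_tr[OF g] xy(1)] by blast
  obtain d2 where d2: "d2 > 0" "ball y d2 \<subseteq> I"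
    "\<And>D. D \<subseteq> ball y d2 \<Longrightarrow> embedding_map (top_of_set D) (mtop M) \<gamma>"
    using immersed_at_locally_embedding[OF manifold open_immersion_\<gamma> xy(2)] by blast
  have cont: "isCont \<nu> x" using \<nu>(1) \<nu>(3)[of x] by (intro real_analytic_at_isCont) auto
  have "open (ball y d2 \<inter> interior D)" "\<nu> x \<in> ball y d2 \<inter> interior D" using d2(1) yD \<nu>(2) by auto
  hence "eventually (\<lambda>t. \<nu> t \<in> ball y d2 \<inter> interior D) (nhds x)"
    by (rule isCont_eventually_in_open[OF cont])
  moreover have "eventually (\<lambda>t. t \<in> interior D \<inter> ball x (min \<delta> d1)) (nhds x)"
    using xD \<nu>(1) d1(1) by (intro eventually_nhds_in_open) auto
  ultimately have "eventually (\<lambda>t. \<nu> t \<in> ball y d2 \<inter> interior D \<and> t \<in> interior D \<inter> ball x (min \<delta> d1)) (nhds x)"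
    by eventually_elim auto
  then obtain r where r: "r > 0"
    and *: "\<forall>t. dist t x < r \<longrightarrow> \<nu> t \<in> ball y d2 \<inter> interior D \<and> t \<in> interior D \<inter> ball x (min \<delta> d1)"
    unfolding eventually_nhds_metric by blast
  have r': "\<nu> t \<in> ball y d2 \<inter> interior D \<and> t \<in> interior D \<inter> ball x (min \<delta> d1)" if "t \<in> ball x r" for t
    using * that by (simp add: dist_commute)
  define J where "J = ball x r"
  have emb: "embedding_map (top_of_set J) (mtop M) (tr g)" using r' by (intro d1(3)) (auto simp: J_def)
  have eq: "tr g t = \<gamma> (\<nu> t)" if "t \<in> J" for t
    using r'[of t] that \<nu>(4)[of t] by (auto simp: J_def dist_real_def abs_minus_commute)
  have "inj_on (tr g) J" 
    using homeomorphic_imp_injective_map[OF emb[unfolded embedding_map_def]] by simp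
  hence inj: "inj_on \<nu> J" by (auto simp: inj_on_def eq)
  have contJ: "continuous_on J \<nu>"
    using r' \<nu>(3) by (intro continuous_at_imp_continuous_on ballI real_analytic_at_isCont)
      (auto simp: J_def dist_real_def abs_minus_commute)
  have opJ': "open (\<nu> ` J)" by (rule injective_into_1d_imp_open_map_UNIV[OF _ contJ inj]) (auto simp: J_def)
  have oiJ: "open_interval J" unfolding J_def by (rule open_interval_ball[OF r])
  have J'ne: "\<nu> ` J \<noteq> {}" using r by (auto simp: J_def)
  have oiJ': "open_interval (\<nu> ` J)"
    unfolding open_interval_def real_interval_def interior_open[OF opJ']
    using opJ' J'ne connected_continuous_image[OF contJ] by (auto simp: J_def)
  have emb': "embedding_map (top_of_set (\<nu> ` J)) (mtop M) \<gamma>" using r' by (intro d2(3)) (auto simp: J_def)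
  have JD: "J \<subseteq> D" "\<nu> ` J \<subseteq> D" using r' interior_subset by (fastforce simp: J_def)+
  have im: "open_analytic_immersion M J (tr g)" "open_analytic_immersion M (\<nu> ` J) \<gamma>"
    unfolding open_analytic_immersion_iff using oiJ oiJ' JD D immersed_tr[OF g] immersed_\<gamma> by blast+
  have "analytic_embedding M J (tr g)"
    unfolding analytic_embedding_def using oiJ im(1) emb by (auto simp: open_interval_def)
  moreover have "analytic_embedding M (\<nu> ` J) \<gamma>"
    unfolding analytic_embedding_def using oiJ' im(2) emb' by (auto simp: open_interval_def)
  moreover have "tr g ` J = \<gamma> ` \<nu> ` J" using eq by (auto simp: image_image)
  ultimately show ?thesis unfolding overlap_def using oiJ oiJ' JD by blast
qed

text \<open>Because \<gamma> is an embedding on J', points of the common image that are close to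
  \<open>\<gamma> y\<close> have parameters close to y. Hence meeting points accumulate at (x,
  y).\<close>

lemma germ_of_overlap:
  assumes g: "g \<in> carrier G" and D: "D \<subseteq> I" and ov: "overlap M D (tr g) D \<gamma>"
  obtains x y e where "x \<in> interior D" "y \<in> interior D" "germ g x y e"
proof -
  obtain J J' where J: "open_interval J" "J \<subseteq> D" and J': "open_interval J'" "J' \<subseteq> D"
    and emb: "analytic_embedding M J' \<gamma>" and im: "tr g ` J = \<gamma> ` J'"
    using ov unfolding overlap_def by blast
  obtain K \<delta> where K: "J' \<subseteq> K" "embedding_map (top_of_set K) (mtop M) \<delta>" "\<And>t. t \<in> J' \<Longrightarrow> \<delta> t = \<gamma> t"
    using emb unfolding analytic_embedding_def by blast
  have op: "open J" "open J'" using J J' by (auto simp: open_interval_def)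
  obtain x where x: "x \<in> J" using open_interval_nonempty[OF J(1)] by blast
  then obtain y where y: "y \<in> J'" "tr g x = \<gamma> y" using im by blast
  have int: "x \<in> interior D" "y \<in> interior D" using x y op J J' interior_maximal by blast+
  have xy: "x \<in> I" "y \<in> I" using x y J J' D by auto
  have "curves_accumulate (tr g) \<gamma> x y"
    unfolding curves_accumulate_def
  proof (intro allI impI)
    fix d :: real assume d: "d > 0"
    have "openin (top_of_set K) (J' \<inter> ball y d)"
      using op K(1) by (intro open_subset) auto
    hence "openin (subtopology (mtop M) (\<delta> ` K)) (\<delta> ` (J' \<inter> ball y d))"
      using K(2) unfolding embedding_map_def
      by (metis homeomorphic_imp_open_map open_map_def topspace_euclidean_subtopology)
    then obtain U where U: "openin (mtop M) U" "\<delta> ` (J' \<inter> ball y d) = U \<inter> \<delta> ` K"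
      unfolding openin_subtopology by blast
    have "\<delta> y \<in> U" using U(2) y(1) d by auto
    hence "tr g x \<in> U" using K(3)[OF y(1)] y(2) by simp
    hence "eventually (\<lambda>t. tr g t \<in> U) (nhds x)"
      using immersed_tr[OF g xy(1)] U(1) unfolding immersed_at_def analytic_curve_at_def limitin_def by blast
    moreover have "eventually (\<lambda>t. t \<in> J \<inter> ball x d) (nhds x)"
      by (rule eventually_nhds_in_open) (use op x d in auto)
    ultimately have "eventually (\<lambda>t. t \<noteq> x \<longrightarrow> tr g t \<in> U \<and> t \<in> J \<inter> ball x d \<and> t \<noteq> x) (nhds x)"
      by eventually_elim blast
    hence "eventually (\<lambda>t. tr g t \<in> U \<and> t \<in> J \<inter> ball x d \<and> t \<noteq> x) (at x)"
      by (simp add: eventually_at_filter)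
    from eventually_happens[OF this] obtain t where t: "tr g t \<in> U" "t \<in> J" "t \<in> ball x d" "t \<noteq> x" by auto
    have "tr g t \<in> \<gamma> ` J'" using im t(2) by blast
    then obtain s' where "s' \<in> J'" "tr g t = \<gamma> s'" by blast
    hence "tr g t = \<delta> s'" "s' \<in> K" using K(1,3) by auto
    hence "tr g t \<in> \<delta> ` K" by blast
    with t(1) U(2) have "tr g t \<in> \<delta> ` (J' \<inter> ball y d)" by blast
    then obtain s where "s \<in> J'" "s \<in> ball y d" "tr g t = \<delta> s" by blast
    hence "tr g t = \<gamma> s" "\<bar>s - y\<bar> < d" "\<bar>t - x\<bar> < d"
      using t(3) K(3) by (auto simp: dist_real_def abs_minus_commute)
    with t(4) show "\<exists>t s. t \<noteq> x \<and> \<bar>t - x\<bar> < d \<and> \<bar>s - y\<bar> < d \<and> tr g t = \<gamma> s" by blast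
  qed
  then obtain e where "germ g x y e" using germI_accumulate[OF g xy] by blast
  with int show ?thesis by (rule that)
qed

lemma free_interval_iff_rigid:
  assumes D: "real_interval D" "D \<subseteq> I"
  shows "free_interval G M \<phi> I \<gamma> D \<longleftrightarrow> rigid D"
proof
  assume f: "free_interval G M \<phi> I \<gamma> D"
  show "rigid D" unfolding rigid_def
  proof (intro allI impI)
    fix g x y e assume a: "x \<in> interior D" "y \<in> interior D" "germ g x y e"
    have g: "g \<in> carrier G" using a(3) by (rule germ_carrier)
    from overlap_of_germ[OF a(3) D(2) a(1,2)] f g have "g \<in> curve_stabilizer G \<phi> D \<gamma>"
      unfolding free_interval_def free_segment_def by blast
    hence st: "\<And>t. t \<in> D \<Longrightarrow> tr g t = \<gamma> t" by (simp add: curve_stabilizer_def)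
    \<comment> \<open>Freeness of D only says that g fixes the restriction to D; continuation from x
      extends this to I.\<close>
    have "eventually (\<lambda>t. tr g t = tr \<one> t) (nhds x)"
      using eventually_nhds_in_open[OF open_interior a(1)]
    proof (rule eventually_mono)
      fix t assume "t \<in> interior D"
      hence "t \<in> D" "t \<in> I" using interior_subset D(2) by auto
      thus "tr g t = tr \<one> t" using st tr_one by simp
    qed
    from tr_identity[OF g one_closed _ this] a(3) show "g \<in> stab"
      by (auto simp: stab_iff germ_def)
  qed
next
  assume r: "rigid D"
  have "g \<in> curve_stabilizer G \<phi> D \<gamma>" if g: "g \<in> carrier G" "overlap M D (tr g) D \<gamma>" for g
  proof -
    obtain x y e where "x \<in> interior D" "y \<in> interior D" "germ g x y e"
      using germ_of_overlap[OF g(1) D(2) g(2)] by metis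
    with r have "g \<in> stab" unfolding rigid_def by blast
    thus ?thesis using D(2) by (auto simp: curve_stabilizer_def)
  qed
  thus "free_interval G M \<phi> I \<gamma> D"
    unfolding free_interval_def free_segment_def using D analytic_immersion_\<gamma>[OF D] by blast
qed

section \<open>Continuation of germs\<close>

text \<open>A continuous branch of g \<cdot> \<gamma> = \<gamma> \<circ> \<rho> over an interval.
  Continuity is enough: by the uniqueness clause of \<open>germ_chart\<close> the branch follows the
  local charts and is analytic, see \<open>lift_analytic\<close>.\<close>

definition lift :: "'g \<Rightarrow> real \<Rightarrow> real set \<Rightarrow> (real \<Rightarrow> real) \<Rightarrow> bool" where
  "lift g e D \<rho> \<longleftrightarrow> open D \<and> connected D \<and> continuous_on D \<rho> \<and> (\<forall>x\<in>D. germ g x (\<rho> x) e)"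

lemma lift_subset_I: "lift g e D \<rho> \<Longrightarrow> D \<subseteq> I"
  and lift_in_I: "lift g e D \<rho> \<Longrightarrow> x \<in> D \<Longrightarrow> \<rho> x \<in> I"
  and lift_germ: "lift g e D \<rho> \<Longrightarrow> x \<in> D \<Longrightarrow> germ g x (\<rho> x) e"
  and lift_isCont: "lift g e D \<rho> \<Longrightarrow> x \<in> D \<Longrightarrow> isCont \<rho> x"
  unfolding lift_def germ_def using continuous_on_eq_continuous_at by blast+

lemma lift_of_germ_chart:
  assumes "germ_chart g x y e \<nu> \<delta>"
  shows "lift g e (ball x \<delta>) \<nu>"
proof -
  note \<nu> = germ_chartD[OF assms]
  have *: "t \<in> ball x \<delta> \<Longrightarrow> \<bar>t - x\<bar> < \<delta>" for t by (simp add: dist_real_def abs_minus_commute)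
  have "continuous_on (ball x \<delta>) \<nu>"
    using \<nu>(3)[OF *] by (intro continuous_at_imp_continuous_on ballI real_analytic_at_isCont) blast
  thus ?thesis unfolding lift_def using \<nu>(5)[OF *] by simp
qed

lemma lift_eventually_eq:
  assumes l: "lift g e D \<rho>" and x: "x \<in> D" and c: "germ_chart g x (\<rho> x) e' \<nu> \<delta>"
  shows "eventually (\<lambda>t. \<rho> t = \<nu> t) (nhds x)"
proof -
  note \<nu> = germ_chartD[OF c]
  have "eventually (\<lambda>t. dist (\<rho> t) (\<rho> x) < \<delta>) (at x)"
    using lift_isCont[OF l x] \<nu>(1) unfolding isCont_def by (rule tendstoD)
  hence "eventually (\<lambda>t. dist (\<rho> t) (\<rho> x) < \<delta>) (nhds x)"
    using \<nu>(1) by (auto simp: eventually_at_filter elim: eventually_mono)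
  moreover have "eventually (\<lambda>t. t \<in> D \<inter> ball x \<delta>) (nhds x)"
    using l x \<nu>(1) by (intro eventually_nhds_in_open) (auto simp: lift_def)
  ultimately show ?thesis
  proof eventually_elim
    case (elim t)
    thus ?case using germ_eq[OF lift_germ[OF l]] \<nu>(6)[of t "\<rho> t"]
      by (simp add: dist_real_def abs_minus_commute)
  qed
qed

text \<open>The set of agreement is open because both branches follow the same
  \<open>germ_chart\<close>, and relatively closed by continuity.\<close>

lemma lift_unique:
  assumes l: "lift g e D \<rho>" and l': "lift g e' D' \<rho>'" and x: "x \<in> D \<inter> D'" "\<rho> x = \<rho>' x"
    and t: "t \<in> D \<inter> D'"
  shows "\<rho> t = \<rho>' t"
proof -
  have op: "open (D \<inter> D')" using l l' by (auto simp: lift_def)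
  have con: "connected (D \<inter> D')"
    using l l' by (auto simp: lift_def is_interval_connected_1[symmetric] is_interval_Int)
  define T where "T = {u \<in> D \<inter> D'. \<rho> u = \<rho>' u}"
  have "open T"
  proof (subst open_subopen, clarify)
    fix u assume u: "u \<in> T"
    hence uD: "u \<in> D" "u \<in> D'" "\<rho> u = \<rho>' u" by (auto simp: T_def)
    obtain \<nu> \<delta> where c: "germ_chart g u (\<rho> u) e \<nu> \<delta>" using germE[OF lift_germ[OF l uD(1)]] .
    have "eventually (\<lambda>t. \<rho> t = \<nu> t) (nhds u)" "eventually (\<lambda>t. \<rho>' t = \<nu> t) (nhds u)"
      using lift_eventually_eq[OF l uD(1) c] lift_eventually_eq[OF l' uD(2)] c uD(3) by auto
    moreover have "eventually (\<lambda>t. t \<in> D \<inter> D') (nhds u)"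
      by (rule eventually_nhds_in_open[OF op]) (use uD in blast)
    ultimately have "eventually (\<lambda>t. t \<in> T) (nhds u)"
      unfolding T_def by eventually_elim simp
    thus "\<exists>V. open V \<and> u \<in> V \<and> V \<subseteq> T" unfolding eventually_nhds by blast
  qed
  moreover have "open (D \<inter> D' - T)"
  proof -
    have "continuous_on (D \<inter> D') (\<lambda>u. \<rho> u - \<rho>' u)"
      using l l' by (intro continuous_on_diff) (auto simp: lift_def intro: continuous_on_subset)
    hence "open ((\<lambda>u. \<rho> u - \<rho>' u) -` (- {0}) \<inter> (D \<inter> D'))"
      using continuous_on_open_vimage[OF op] open_Compl[OF closed_singleton] by blast
    also have "(\<lambda>u. \<rho> u - \<rho>' u) -` (- {0}) \<inter> (D \<inter> D') = D \<inter> D' - T" by (auto simp: T_def)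
    finally show ?thesis .
  qed
  moreover have "x \<in> T" using x by (auto simp: T_def)
  ultimately have "D \<inter> D' - T = {}"
    using connectedD[OF con \<open>open T\<close> \<open>open (D \<inter> D' - T)\<close>] by (auto simp: T_def)
  with t show ?thesis by (auto simp: T_def)
qed

lemma lift_analytic:
  assumes l: "lift g e D \<rho>" and x: "x \<in> D"
  shows "real_analytic_at \<rho> x" "sgn (deriv \<rho> x) = e"
proof -
  obtain \<nu> \<delta> where c: "germ_chart g x (\<rho> x) e \<nu> \<delta>" using germE[OF lift_germ[OF l x]] .
  note \<nu> = germ_chartD[OF c]
  have ev: "eventually (\<lambda>t. \<rho> t = \<nu> t) (nhds x)" by (rule lift_eventually_eq[OF l x c])
  have "real_analytic_at \<nu> x" "sgn (deriv \<nu> x) = e" using \<nu>(1) \<nu>(3)[of x] by auto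
  thus "real_analytic_at \<rho> x" "sgn (deriv \<rho> x) = e"
    using real_analytic_at_cong[OF ev] deriv_cong_ev[OF ev refl] by simp_all
qed

lemma lift_interval: "lift g e D \<rho> \<Longrightarrow> x \<in> D \<Longrightarrow> y \<in> D \<Longrightarrow> x \<le> t \<Longrightarrow> t \<le> y \<Longrightarrow> t \<in> D"
  unfolding lift_def is_interval_connected_1[symmetric] is_interval_1 by blast

lemma lift_less:
  assumes l: "lift g 1 D \<rho>" and xy: "x \<in> D" "y \<in> D" "x < y"
  shows "\<rho> x < \<rho> y"
proof (rule DERIV_pos_imp_increasing[OF xy(3)])
  fix t assume "x \<le> t" "t \<le> y"
  hence t: "t \<in> D" using lift_interval[OF l xy(1,2)] by blast
  show "\<exists>y. (\<rho> has_real_derivative y) (at t) \<and> 0 < y"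
    using real_analytic_at_has_deriv[OF lift_analytic(1)[OF l t]] lift_analytic(2)[OF l t]
    by (auto simp: sgn_if split: if_splits)
qed

lemma lift_greater:
  assumes l: "lift g (-1) D \<rho>" and xy: "x \<in> D" "y \<in> D" "x < y"
  shows "\<rho> x > \<rho> y"
proof (rule DERIV_neg_imp_decreasing[OF xy(3)])
  fix t assume "x \<le> t" "t \<le> y"
  hence t: "t \<in> D" using lift_interval[OF l xy(1,2)] by blast
  show "\<exists>y. (\<rho> has_real_derivative y) (at t) \<and> y < 0"
    using real_analytic_at_has_deriv[OF lift_analytic(1)[OF l t]] lift_analytic(2)[OF l t]
    by (auto simp: sgn_if split: if_splits)
qed

lemma lift_union:
  assumes l: "lift g e D \<rho>" and l': "lift g e D' \<rho>'" and x: "x \<in> D \<inter> D'" "\<rho> x = \<rho>' x"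
  shows "lift g e (D \<union> D') (\<lambda>t. if t \<in> D then \<rho> t else \<rho>' t)" (is "lift g e _ ?f")
proof -
  have eq': "?f t = \<rho>' t" if "t \<in> D'" for t using lift_unique[OF l l' x, of t] that by auto
  have "continuous_on D ?f" using l by (auto simp: lift_def intro: continuous_on_eq)
  moreover have "continuous_on D' ?f" using l' eq' by (auto simp: lift_def intro: continuous_on_eq)
  ultimately have "continuous_on (D \<union> D') ?f" using l l' by (intro continuous_on_open_Un) (auto simp: lift_def)
  moreover have "connected (D \<union> D')" using l l' x by (intro connected_Un) (auto simp: lift_def)
  ultimately show ?thesis using l l' unfolding lift_def by auto
qed

text \<open>Maximality is stated with cluster points of the graph instead of limits of \<open>\<rho>\<close>, so that compactness
  alone suffices to extend the domain.\<close>

definition maximal_lift :: "'g \<Rightarrow> real \<Rightarrow> real set \<Rightarrow> (real \<Rightarrow> real) \<Rightarrow> bool" where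
  "maximal_lift g e D \<rho> \<longleftrightarrow> lift g e D \<rho> \<and>
     (\<forall>x\<in>I. \<forall>y\<in>I. (\<forall>\<delta>>0. \<exists>t\<in>D. \<bar>t - x\<bar> < \<delta> \<and> \<bar>\<rho> t - y\<bar> < \<delta>) \<longrightarrow> x \<in> D)"

text \<open>The union of all lifts with value y0 at x0 is again a lift by
  \<open>lift_unique\<close>. At a cluster point (x, y) of its graph with x outside the domain,
  meeting points would accumulate and give a germ whose chart could be glued on.\<close>

lemma maximal_lift_exists:
  assumes germ: "germ g x0 y0 e"
  obtains D \<rho> where "maximal_lift g e D \<rho>" "x0 \<in> D" "\<rho> x0 = y0"
proof -
  have g: "g \<in> carrier G" using germ by (rule germ_carrier)
  define F where "F = {(D, \<rho>). lift g e D \<rho> \<and> x0 \<in> D \<and> \<rho> x0 = y0}"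
  define D where "D = \<Union>(fst ` F)"
  define \<rho> where "\<rho> = (\<lambda>t. snd (SOME f. f \<in> F \<and> t \<in> fst f) t)"
  have FD: "E \<subseteq> D" if "(E, \<sigma>) \<in> F" for E \<sigma> using that by (force simp: D_def)
  have \<rho>: "\<rho> t = \<sigma> t" if E: "(E, \<sigma>) \<in> F" "t \<in> E" for E \<sigma> t
  proof -
    define f where "f = (SOME f. f \<in> F \<and> t \<in> fst f)"
    have "f \<in> F \<and> t \<in> fst f" unfolding f_def by (rule someI[of _ "(E, \<sigma>)"]) (use E in simp)
    hence "snd f t = \<sigma> t" using E lift_unique[of g e "fst f" "snd f" e E \<sigma> x0 t] by (auto simp: F_def)
    thus ?thesis by (simp add: \<rho>_def f_def)
  qed
  obtain \<nu> \<delta> where c: "germ_chart g x0 y0 e \<nu> \<delta>" using germE[OF germ] .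
  have inF: "(ball x0 \<delta>, \<nu>) \<in> F"
    unfolding F_def using lift_of_germ_chart[OF c] germ_chartD(1,2)[OF c] by simp
  have x0: "x0 \<in> D" using FD[OF inF] germ_chartD(1)[OF c] by auto
  have \<rho>x0: "\<rho> x0 = y0" using \<rho>[OF inF, of x0] germ_chartD(1,2)[OF c] by simp
  have l: "lift g e D \<rho>"
    unfolding lift_def
  proof (intro conjI ballI)
    show "open D" unfolding D_def F_def lift_def by (intro open_Union) auto
    show "connected D" unfolding D_def F_def lift_def by (rule connected_Union) auto
    show "continuous_on D \<rho>"
    proof (intro continuous_at_imp_continuous_on ballI)
      fix t assume "t \<in> D"
      then obtain E \<sigma> where E: "(E, \<sigma>) \<in> F" "t \<in> E" by (auto simp: D_def)
      have "open E" "isCont \<sigma> t" using E lift_isCont[of g e E \<sigma> t] by (auto simp: F_def lift_def)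
      moreover have "eventually (\<lambda>u. \<rho> u = \<sigma> u) (nhds t)"
        using eventually_nhds_in_open[OF \<open>open E\<close> E(2)] by (rule eventually_mono) (rule \<rho>[OF E(1)])
      ultimately show "isCont \<rho> t" using isCont_cong by blast
    qed
    fix t assume "t \<in> D"
    then obtain E \<sigma> where E: "(E, \<sigma>) \<in> F" "t \<in> E" by (auto simp: D_def)
    thus "germ g t (\<rho> t) e" using \<rho>[OF E] lift_germ[of g e E \<sigma> t] by (simp add: F_def)
  qed
  have "x \<in> D" if x: "x \<in> I" and y: "y \<in> I" and cl: "\<forall>\<delta>>0. \<exists>t\<in>D. \<bar>t - x\<bar> < \<delta> \<and> \<bar>\<rho> t - y\<bar> < \<delta>" for x y
  proof (rule ccontr)
    assume xD: "x \<notin> D"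
    have "curves_accumulate (tr g) \<gamma> x y"
      unfolding curves_accumulate_def
    proof (intro allI impI)
      fix d :: real assume "d > 0"
      with cl obtain t where t: "t \<in> D" "\<bar>t - x\<bar> < d" "\<bar>\<rho> t - y\<bar> < d" by blast
      have "t \<noteq> x" using t(1) xD by blast
      with t germ_eq[OF lift_germ[OF l t(1)]]
      show "\<exists>t s. t \<noteq> x \<and> \<bar>t - x\<bar> < d \<and> \<bar>s - y\<bar> < d \<and> tr g t = \<gamma> s"
        by (intro exI[of _ t] exI[of _ "\<rho> t"]) simp
    qed
    then obtain e' where "germ g x y e'" using germI_accumulate[OF g x y] by blast
    then obtain \<nu> \<delta> where c: "germ_chart g x y e' \<nu> \<delta>" by (rule germE)
    note \<nu> = germ_chartD[OF c]
    obtain t where t: "t \<in> D" "\<bar>t - x\<bar> < \<delta>" "\<bar>\<rho> t - y\<bar> < \<delta>" using cl \<nu>(1) by blast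
    have eq: "\<rho> t = \<nu> t" using \<nu>(6)[OF t(2,3)] germ_eq[OF lift_germ[OF l t(1)]] by simp
    \<comment> \<open>The sign of the germ obtained by accumulation is unknown at first; it is
      compared with e at the common parameter t.\<close>
    have "e = e'" using germ_sign_unique[OF lift_germ[OF l t(1)]] \<nu>(5)[OF t(2)] eq by simp
    hence l': "lift g e (ball x \<delta>) \<nu>" using lift_of_germ_chart[OF c] by simp
    have "t \<in> D \<inter> ball x \<delta>" using t by (simp add: dist_real_def abs_minus_commute)
    from lift_union[OF l l' this eq]
    have "(D \<union> ball x \<delta>, \<lambda>t. if t \<in> D then \<rho> t else \<nu> t) \<in> F" using x0 \<rho>x0 by (simp add: F_def)
    from FD[OF this] have "ball x \<delta> \<subseteq> D" by blast
    with xD \<nu>(1) centre_in_ball show False by blast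
  qed
  with l have "maximal_lift g e D \<rho>" unfolding maximal_lift_def by blast
  thus ?thesis using x0 \<rho>x0 by (rule that)
qed

lemma maximal_lift_lift: "maximal_lift g e D \<rho> \<Longrightarrow> lift g e D \<rho>"
  by (simp add: maximal_lift_def)

text \<open>If x1 were not reached, some point of the segment missing from D would be a limit of
  points of D. By compactness the values along a sequence cluster in K, against maximality. Each use
  supplies K by an order argument.\<close>

lemma maximal_lift_bounded:
  assumes m: "maximal_lift g e D \<rho>" and x0: "x0 \<in> D" and x1: "x1 \<in> I"
    and K: "compact K" "K \<subseteq> I" and bd: "\<And>t. t \<in> D \<Longrightarrow> t \<in> closed_segment x0 x1 \<Longrightarrow> \<rho> t \<in> K"
  shows "x1 \<in> D"
proof (rule ccontr)
  assume x1D: "x1 \<notin> D"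
  have l: "lift g e D \<rho>" using m by (rule maximal_lift_lift)
  define S where "S = closed_segment x0 x1"
  have SI: "S \<subseteq> I" unfolding S_def
    using lift_subset_I[OF l] x0 x1 is_interval_I by (meson closed_segment_subset is_interval_convex subsetD)
  have S: "connected S" "closed S" "x0 \<in> S" "x1 \<in> S" by (auto simp: S_def)
  have "\<not> closed (D \<inter> S)"
  proof
    assume cl: "closed (D \<inter> S)"
    have "open D" using l by (simp add: lift_def)
    moreover have "open (- (D \<inter> S))" using cl by (rule open_Compl)
    ultimately have "D \<inter> S = {} \<or> - (D \<inter> S) \<inter> S = {}"
      using connectedD[OF S(1), of D "- (D \<inter> S)"] by blast
    thus False using x0 x1D S by blast
  qed
  then obtain x where x: "x \<in> closure (D \<inter> S)" "x \<notin> D \<inter> S"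
    using closure_subset_eq by blast
  then obtain f where f: "\<And>n. f n \<in> D \<inter> S" "f \<longlonglongrightarrow> x" unfolding closure_sequential by blast
  have xS: "x \<in> S" using f S(2) by (meson IntD2 closed_sequentially)
  have "\<forall>n. \<rho> (f n) \<in> K" using f(1) bd unfolding S_def by blast
  then obtain y r where y: "y \<in> K" "strict_mono r" "((\<lambda>n. \<rho> (f n)) \<circ> r) \<longlonglongrightarrow> y"
    using K(1) unfolding compact_def by meson
  have fr: "(f \<circ> r) \<longlonglongrightarrow> x" using f(2) y(2) by (rule LIMSEQ_subseq_LIMSEQ)
  have "\<forall>\<delta>>0. \<exists>t\<in>D. \<bar>t - x\<bar> < \<delta> \<and> \<bar>\<rho> t - y\<bar> < \<delta>"
  proof (intro allI impI)
    fix \<delta> :: real assume "\<delta> > 0"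
    hence "eventually (\<lambda>n. dist ((f \<circ> r) n) x < \<delta>) sequentially" "eventually (\<lambda>n. dist (((\<lambda>n. \<rho> (f n)) \<circ> r) n) y < \<delta>) sequentially"
      using tendstoD[OF fr] tendstoD[OF y(3)] by auto
    hence "eventually (\<lambda>n. \<bar>f (r n) - x\<bar> < \<delta> \<and> \<bar>\<rho> (f (r n)) - y\<bar> < \<delta>) sequentially"
      by eventually_elim (simp add: dist_real_def)
    from eventually_happens[OF this] f(1) show "\<exists>t\<in>D. \<bar>t - x\<bar> < \<delta> \<and> \<bar>\<rho> t - y\<bar> < \<delta>" by auto
  qed
  hence "x \<in> D" using m xS SI y(1) K(2) unfolding maximal_lift_def by blast
  with x xS show False by blast
qed

text \<open>Intermediate value theorem for \<rho> t - t; it serves to keep a continuation on one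
  side of the diagonal.\<close>

lemma lift_value_between:
  assumes l: "lift g e D \<rho>" and ab: "a \<in> D" "b \<in> D" "a \<le> b"
    and sgn: "(\<rho> a \<le> a \<and> b \<le> \<rho> b) \<or> (a \<le> \<rho> a \<and> \<rho> b \<le> b)"
  obtains u where "a \<le> u" "u \<le> b" "u \<in> D" "\<rho> u = u"
proof -
  have sub: "{a..b} \<subseteq> D" using lift_interval[OF l ab(1,2)] by auto
  have cont: "continuous_on {a..b} (\<lambda>t. \<rho> t - t)" "continuous_on {a..b} (\<lambda>t. t - \<rho> t)"
    using l sub by (auto simp: lift_def intro!: continuous_intros intro: continuous_on_subset)
  have "\<exists>u\<ge>a. u \<le> b \<and> \<rho> u = u" using sgn
  proof
    assume "\<rho> a \<le> a \<and> b \<le> \<rho> b"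
    hence "\<exists>u. a \<le> u \<and> u \<le> b \<and> \<rho> u - u = 0" by (intro IVT' ab(3) cont(1)) simp_all
    thus ?thesis by force
  next
    assume "a \<le> \<rho> a \<and> \<rho> b \<le> b"
    hence "\<exists>u. a \<le> u \<and> u \<le> b \<and> u - \<rho> u = 0" by (intro IVT' ab(3) cont(2)) simp_all
    thus ?thesis by force
  qed
  thus ?thesis using sub that by auto
qed

text \<open>A decreasing continuation starting with \<rho> a = b > a stays above the diagonal, where
  it cannot meet a fixed point, and below b. So it continues up to b, where \<rho> b would have to
  exceed b and be at most b.\<close>

lemma no_flip: "\<not> germ \<one> x y (-1)"
proof
  assume g0: "germ \<one> x y (-1)"
  have diag: "\<not> germ \<one> u u (-1)" for u
    using germ_sign_unique[OF germ_one[of u]] germ_in_I(1) by (metis one_neq_neg_one)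
  \<comment> \<open>Inverting the germ if necessary puts a left of b; equal ends are excluded
    because the identity has sign 1 on the diagonal.\<close>
  obtain a b where ab: "germ \<one> a b (-1)" "a < b"
    using g0 germ_inv[OF g0] diag by (cases x y rule: linorder_cases) auto
  obtain D \<rho> where m: "maximal_lift \<one> (-1) D \<rho>" "a \<in> D" "\<rho> a = b"
    using maximal_lift_exists[OF ab(1)] .
  note l = maximal_lift_lift[OF m(1)]
  have nofix: "\<rho> u \<noteq> u" if "u \<in> D" for u using lift_germ[OF l that] diag by metis
  have up: "\<rho> t > t" if "t \<in> D" "a \<le> t" for t
    using lift_value_between[OF l m(2) that] nofix m(3) ab(2) by (metis less_imp_le not_less)
  have down: "\<rho> t \<le> b" if "t \<in> D" "a \<le> t" for t
    using lift_greater[OF l m(2) that(1)] that(2) m(3) by (cases "t = a") auto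
  have "b \<in> D"
  proof (rule maximal_lift_bounded[OF m(1,2)])
    show "b \<in> I" using ab by (auto simp: germ_def)
    show "compact {a..b}" by simp
    show "{a..b} \<subseteq> I" by (rule I_segment[OF germ_in_I[OF ab(1)]])
    show "\<rho> t \<in> {a..b}" if "t \<in> D" "t \<in> closed_segment a b" for t
      using up[OF that(1)] down[OF that(1)] that(2) ab(2) by (auto simp: closed_segment_eq_real_ivl)
  qed
  from up[OF this] down[OF this] ab(2) show False by simp
qed

text \<open>Serves to push ends of a germ that lie on the boundary of an interval into its interior.
  A shift of x in direction d moves y in direction d * e.\<close>

lemma germ_perturb:
  assumes germ: "germ g x y e" and d: "d = 1 \<or> d = -1" and \<epsilon>: "\<epsilon> > 0"
  obtains t s where "0 < d * (t - x)" "d * (t - x) < \<epsilon>" "0 < d * e * (s - y)" "d * e * (s - y) < \<epsilon>" "germ g t s e"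
proof -
  obtain \<nu> \<delta> where c: "germ_chart g x y e \<nu> \<delta>" using germE[OF germ] .
  note \<nu> = germ_chartD[OF c] and l = lift_of_germ_chart[OF c]
  have e: "e = 1 \<or> e = -1" using germ_sign[OF germ] .
  have "isCont \<nu> x" using \<nu>(1) by (intro lift_isCont[OF l]) simp
  then obtain r where r: "r > 0" "\<And>t. \<bar>t - x\<bar> < r \<Longrightarrow> \<bar>\<nu> t - y\<bar> < \<epsilon>"
    using \<epsilon> \<nu>(2) unfolding continuous_at_eps_delta dist_real_def by blast
  define t where "t = x + d * (min r (min \<delta> \<epsilon>) / 2)"
  have tx: "\<bar>t - x\<bar> < r" "\<bar>t - x\<bar> < \<delta>" "0 < d * (t - x)" "d * (t - x) < \<epsilon>"
    using d r(1) \<nu>(1) \<epsilon> by (auto simp: t_def)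
  have tb: "t \<in> ball x \<delta>" "x \<in> ball x \<delta>" using tx \<nu>(1) by (auto simp: dist_real_def)
  have "0 < d * e * (\<nu> t - y)"
    using d e lift_less[of g "ball x \<delta>" \<nu>, OF _ tb] lift_less[of g "ball x \<delta>" \<nu>, OF _ tb(2,1)]
      lift_greater[of g "ball x \<delta>" \<nu>, OF _ tb] lift_greater[of g "ball x \<delta>" \<nu>, OF _ tb(2,1)] l tx(3) \<nu>(2)
    by auto
  moreover have "d * e * (\<nu> t - y) < \<epsilon>" using r(2)[OF tx(1)] d e by auto
  ultimately show ?thesis using that tx(3,4) \<nu>(5)[OF tx(2)] by blast
qed

lemma lift_identity: "lift \<one> 1 I (\<lambda>t. t)"
  unfolding lift_def using open_I connected_I germ_one by (auto intro: continuous_intros)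

text \<open>Continuing a self-overlap up to the right end \<open>q\<close> and composing it with the germ of \<open>h\<close> at \<open>p\<close> would
  produce a germ of \<open>h\<close> with both ends inside the interval.\<close>

lemma rigid_no_self_overlap:
  assumes rig: "rigid {p..q}" and h: "germ h p q 1" "h \<notin> stab"
    and x: "p < x" "x < q" and y: "p < y" "y < q" and germ: "germ \<one> x y e"
  shows "x = y"
proof (rule ccontr)
  assume "x \<noteq> y"
  have "e = 1" using germ germ_sign[OF germ] no_flip by auto
  obtain a b where ab: "germ \<one> a b 1" "b < a" "p < b" "a < q"
    using germ germ_inv[OF germ] \<open>x \<noteq> y\<close> \<open>e = 1\<close> x y by (cases x y rule: linorder_cases) auto
  obtain D \<rho> where m: "maximal_lift \<one> 1 D \<rho>" "a \<in> D" "\<rho> a = b"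
    using maximal_lift_exists[OF ab(1)] .
  note l = maximal_lift_lift[OF m(1)]
  \<comment> \<open>If \<rho> met the diagonal, it would coincide with \<open>lift_identity\<close>
    on its domain, against \<rho> a = b < a.\<close>
  have nofix: "\<rho> u \<noteq> u" if "u \<in> D" for u
    using lift_unique[OF l lift_identity, of u a] that m(2,3) ab(2) lift_subset_I[OF l] by auto
  have down: "\<rho> t < t" if "t \<in> D" "a \<le> t" for t
    using lift_value_between[OF l m(2) that] nofix m(3) ab(2) by (metis less_imp_le not_less)
  have up: "b \<le> \<rho> t" if "t \<in> D" "a \<le> t" for t
    using lift_less[OF l m(2) that(1)] that(2) m(3) by (cases "t = a") auto
  have q: "q \<in> D"
  proof (rule maximal_lift_bounded[OF m(1,2)])
    show "q \<in> I" using h by (auto simp: germ_def)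
    show "compact {b..q}" by simp
    show "{b..q} \<subseteq> I" by (rule I_segment[OF germ_in_I(2)[OF ab(1)] germ_in_I(2)[OF h(1)]])
    show "\<rho> t \<in> {b..q}" if "t \<in> D" "t \<in> closed_segment a q" for t
      using up[OF that(1)] down[OF that(1)] that(2) ab(4) by (auto simp: closed_segment_eq_real_ivl)
  qed
  have \<rho>q: "p < \<rho> q" "\<rho> q < q" using up[OF q] down[OF q] ab by auto
  have "germ (\<one> \<otimes> h) p (\<rho> q) (1 * 1)" by (rule germ_mult[OF h(1) lift_germ[OF l q]])
  hence hg: "germ h p (\<rho> q) 1" using germ_carrier[OF h(1)] by simp
  \<comment> \<open>Both ends move to the right by less than q - \<rho> q: p enters the interval and
    \<rho> q stays below q.\<close>
  obtain t s where ts: "0 < 1 * (t - p)" "1 * (t - p) < q - \<rho> q" "0 < 1 * 1 * (s - \<rho> q)" "1 * 1 * (s - \<rho> q) < q - \<rho> q" "germ h t s 1"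
    using germ_perturb[OF hg, of 1 "q - \<rho> q"] \<rho>q by auto
  have "h \<in> stab" using ts \<rho>q by (intro rigidD[OF rig _ _ ts(5)]) auto
  with h(2) show False ..
qed

end

section \<open>Iteration and fixed points of real functions\<close>

lemma iterates_tendsto_upper:
  fixes f :: "real \<Rightarrow> real"
  assumes f: "\<And>t. a \<le> t \<Longrightarrow> t < b \<Longrightarrow> t < f t \<and> f t < b"
    and cont: "\<And>t. a \<le> t \<Longrightarrow> t < b \<Longrightarrow> isCont f t" and x: "a \<le> x" "x < b"
  shows "(\<lambda>n. (f ^^ n) x) \<longlonglongrightarrow> b" "\<And>n. a \<le> (f ^^ n) x \<and> (f ^^ n) x < b"
proof -
  show bd: "a \<le> (f ^^ n) x \<and> (f ^^ n) x < b" for n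
  proof (induction n)
    case (Suc n)
    with f[of "(f ^^ n) x"] show ?case by simp
  qed (use x in simp)
  have inc: "incseq (\<lambda>n. (f ^^ n) x)"
    using f bd by (intro incseq_SucI) (simp add: less_imp_le)
  obtain L where L: "(\<lambda>n. (f ^^ n) x) \<longlonglongrightarrow> L" "\<And>n. (f ^^ n) x \<le> L"
    using incseq_convergent[OF inc, of b] bd less_imp_le by blast
  have "a \<le> L" using bd[of 0] L(2)[of 0] by simp
  have "L \<le> b" using L(1) bd by (intro LIMSEQ_le_const2[OF L(1)]) (auto intro: less_imp_le)
  \<comment> \<open>A limit below b would be a fixed point of f by continuity.\<close>
  have "\<not> L < b"
  proof
    assume "L < b"
    have "(\<lambda>n. f ((f ^^ n) x)) \<longlonglongrightarrow> f L"
      using cont[OF \<open>a \<le> L\<close> \<open>L < b\<close>] L(1) by (rule isCont_tendsto_compose)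
    moreover have "(\<lambda>n. f ((f ^^ n) x)) \<longlonglongrightarrow> L"
      using LIMSEQ_Suc[OF L(1)] by simp
    ultimately have "f L = L" by (rule LIMSEQ_unique)
    with f[OF \<open>a \<le> L\<close> \<open>L < b\<close>] show False by simp
  qed
  with \<open>L \<le> b\<close> have "L = b" by simp
  with L(1) show "(\<lambda>n. (f ^^ n) x) \<longlonglongrightarrow> b" by simp
qed

text \<open>The previous lemma for the conjugate of f by negation.\<close>

lemma iterates_tendsto_lower:
  fixes f :: "real \<Rightarrow> real"
  assumes f: "\<And>t. a < t \<Longrightarrow> t \<le> b \<Longrightarrow> f t < t \<and> a < f t"
    and cont: "\<And>t. a < t \<Longrightarrow> t \<le> b \<Longrightarrow> isCont f t" and x: "a < x" "x \<le> b"
  shows "(\<lambda>n. (f ^^ n) x) \<longlonglongrightarrow> a" "\<And>n. a < (f ^^ n) x \<and> (f ^^ n) x \<le> b"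
proof -
  define g where "g = (\<lambda>t. - f (- t))"
  have gf: "(g ^^ n) (- x) = - (f ^^ n) x" for n by (induction n) (auto simp: g_def)
  have g: "t < g t \<and> g t < - a" if "- b \<le> t" "t < - a" for t
    using f[of "- t"] that by (auto simp: g_def)
  have cg: "isCont g t" if "- b \<le> t" "t < - a" for t
  proof -
    have "isCont f (- t)" using that by (intro cont) auto
    moreover have "isCont (\<lambda>t::real. - t) t" by simp
    ultimately have "isCont (\<lambda>t. f (- t)) t" using isCont_o2[of t "\<lambda>t. - t" f] by blast
    thus ?thesis unfolding g_def by (rule continuous_minus)
  qed
  have "(\<lambda>n. (g ^^ n) (- x)) \<longlonglongrightarrow> - a"
    by (rule iterates_tendsto_upper(1)[OF g cg]) (use x in auto)
  hence "(\<lambda>n. - (f ^^ n) x) \<longlonglongrightarrow> - a" by (simp add: gf)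
  thus "(\<lambda>n. (f ^^ n) x) \<longlonglongrightarrow> a" by (rule tendsto_minus_cancel)
  show "a < (f ^^ n) x \<and> (f ^^ n) x \<le> b" for n
    using iterates_tendsto_upper(2)[where a="- b" and b="- a" and x="- x" and n=n, OF g cg] x by (auto simp: gf)
qed

lemma compact_fixed_points:
  fixes f :: "real \<Rightarrow> real"
  assumes "continuous_on {a..b} f"
  shows "compact {u \<in> {a..b}. f u = u}"
proof -
  have "continuous_on {a..b} (\<lambda>u. f u - u)" by (intro continuous_on_diff assms continuous_on_id)
  hence "closed {u \<in> {a..b}. f u - u = 0}" by (rule continuous_closed_preimage_constant) simp
  hence "compact ({a..b} \<inter> {u \<in> {a..b}. f u - u = 0})" by (intro compact_Int_closed compact_Icc)
  also have "{a..b} \<inter> {u \<in> {a..b}. f u - u = 0} = {u \<in> {a..b}. f u = u}" by auto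
  finally show ?thesis .
qed

text \<open>An extreme fixed point is singled out so that no other one lies between it and the
  starting point, as the iteration lemmas require.\<close>

lemma least_fixed_point:
  fixes f :: "real \<Rightarrow> real"
  assumes "continuous_on {a..b} f" "f b = b" "a \<le> b"
  obtains m where "a \<le> m" "m \<le> b" "f m = m" "\<And>u. a \<le> u \<Longrightarrow> u < m \<Longrightarrow> f u \<noteq> u"
proof -
  define S where "S = {u \<in> {a..b}. f u = u}"
  have "compact S" unfolding S_def by (rule compact_fixed_points[OF assms(1)])
  moreover have "S \<noteq> {}" using assms(2,3) by (auto simp: S_def)
  ultimately obtain m where m: "m \<in> S" "\<forall>t\<in>S. m \<le> t" using compact_attains_inf by metis
  have "f u \<noteq> u" if "a \<le> u" "u < m" for u
  proof
    assume "f u = u"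
    with that m(1) have "u \<in> S" by (auto simp: S_def)
    with m(2) that(2) show False by auto
  qed
  with m(1) show ?thesis by (intro that[of m]) (auto simp: S_def)
qed

lemma greatest_fixed_point:
  fixes f :: "real \<Rightarrow> real"
  assumes "continuous_on {a..b} f" "f a = a" "a \<le> b"
  obtains m where "a \<le> m" "m \<le> b" "f m = m" "\<And>u. m < u \<Longrightarrow> u \<le> b \<Longrightarrow> f u \<noteq> u"
proof -
  define S where "S = {u \<in> {a..b}. f u = u}"
  have "compact S" unfolding S_def by (rule compact_fixed_points[OF assms(1)])
  moreover have "S \<noteq> {}" using assms(2,3) by (auto simp: S_def)
  ultimately obtain m where m: "m \<in> S" "\<forall>t\<in>S. t \<le> m" using compact_attains_sup by metis
  have "f u \<noteq> u" if "m < u" "u \<le> b" for u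
  proof
    assume "f u = u"
    with that m(1) have "u \<in> S" by (auto simp: S_def)
    with m(2) that(1) show False by auto
  qed
  with m(1) show ?thesis by (intro that[of m]) (auto simp: S_def)
qed

context acted_curve
begin

lemma lift_inj: "lift g e D \<rho> \<Longrightarrow> inj_on \<rho> D"
proof (rule inj_onI)
  fix x y assume l: "lift g e D \<rho>" and xy: "x \<in> D" "y \<in> D" "\<rho> x = \<rho> y"
  have "e = 1 \<or> e = -1" using germ_sign[OF lift_germ[OF l xy(1)]] .
  thus "x = y"
    using xy l lift_less[of g D \<rho> x y] lift_less[of g D \<rho> y x] lift_greater[of g D \<rho> x y] lift_greater[of g D \<rho> y x]
    by (cases x y rule: linorder_cases) auto
qed

lemma lift_inverse:
  assumes l: "lift g e D \<rho>"
  shows "lift (inv g) e (\<rho> ` D) (the_inv_into D \<rho>)"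
proof -
  have op: "open D" and con: "connected D" and cont: "continuous_on D \<rho>" using l by (auto simp: lift_def)
  note inj = lift_inj[OF l]
  have om: "open (\<rho> ` U)" if "open U" "U \<subseteq> D" for U
    by (rule injective_into_1d_imp_open_map_UNIV[OF that(1) cont inj that(2)])
  have "continuous_on (\<rho> ` D) (the_inv_into D \<rho>)"
  proof (rule continuous_on_inverse_open_map[OF cont refl])
    show "the_inv_into D \<rho> (\<rho> x) = x" if "x \<in> D" for x using inj that by (rule the_inv_into_f_f)
    show "openin (top_of_set (\<rho> ` D)) (\<rho> ` U)" if "openin (top_of_set D) U" for U
      using that op om by (intro open_subset) (auto simp: openin_open_eq)
  qed
  moreover have "germ (inv g) y (the_inv_into D \<rho> y) e" if "y \<in> \<rho> ` D" for y
    using that germ_inv[OF lift_germ[OF l]] the_inv_into_f_f[OF inj] by auto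
  ultimately show ?thesis
    unfolding lift_def using om[OF op] connected_continuous_image[OF cont con] by blast
qed

lemma lift_iterate:
  assumes l: "lift g e D \<rho>" and x: "x \<in> I" and k: "\<And>k. k < n \<Longrightarrow> (\<rho> ^^ k) x \<in> D" and g: "g \<in> carrier G"
  shows "tr (g [^] n) x = \<gamma> ((\<rho> ^^ n) x)"
  using k
proof (induction n)
  case 0
  thus ?case using x by (simp add: tr_one)
next
  case (Suc n)
  hence "tr (g [^] n) x = \<gamma> ((\<rho> ^^ n) x)" by simp
  moreover have "tr g ((\<rho> ^^ n) x) = \<gamma> (\<rho> ((\<rho> ^^ n) x))"
    using Suc.prems by (intro germ_eq[OF lift_germ[OF l]]) simp
  moreover have "g [^] Suc n = g \<otimes> g [^] n" using g by (rule nat_pow_Suc2)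
  ultimately show ?case using x g by (simp add: act_mult \<gamma>_top translate_def del: nat_pow_Suc)
qed

text \<open>Three parameters near x0 have different images, and at most one of these is
  \<open>\<gamma> m\<close>. The other two are driven to \<open>\<gamma> m\<close> by the same
  sequence of group elements, which satedness forbids.\<close>

lemma sated_no_collapse:
  assumes sat: "sated G M \<phi>" and T: "open T" "x0 \<in> T" "T \<subseteq> I" and m: "m \<in> I"
    and k: "\<And>n. k n \<in> carrier G" and f: "\<And>n x. x \<in> T \<Longrightarrow> tr (k n) x = \<gamma> (f n x)"
    and lim: "\<And>x. x \<in> T \<Longrightarrow> (\<lambda>n. f n x) \<longlonglongrightarrow> m"
  shows False
proof -
  have x0: "x0 \<in> I" using T by blast
  obtain \<delta> where \<delta>: "\<delta> > 0" "inj_on \<gamma> (ball x0 \<delta>)"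
    using immersed_at_locally_injective[OF manifold immersed_\<gamma>[OF x0]] .
  have "open (T \<inter> ball x0 \<delta>)" "x0 \<in> T \<inter> ball x0 \<delta>" using T \<delta> by auto
  then obtain e where e: "e > 0" "ball x0 e \<subseteq> T \<inter> ball x0 \<delta>" by (meson openE)
  have mem: "x0 \<in> T \<inter> ball x0 \<delta>" "x0 + e/2 \<in> T \<inter> ball x0 \<delta>" "x0 - e/2 \<in> T \<inter> ball x0 \<delta>"
    by (rule subsetD[OF e(2)], use e(1) in \<open>simp add: dist_real_def\<close>)+
  have ne: "\<gamma> x0 \<noteq> \<gamma> (x0 + e/2)" "\<gamma> x0 \<noteq> \<gamma> (x0 - e/2)" "\<gamma> (x0 + e/2) \<noteq> \<gamma> (x0 - e/2)"
    using mem e(1) inj_onD[OF \<delta>(2)] by force+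
  obtain y z where yz: "y \<in> T" "z \<in> T" "\<gamma> y \<noteq> \<gamma> z" "\<gamma> y \<noteq> \<gamma> m" "\<gamma> z \<noteq> \<gamma> m"
    using ne mem by (metis IntD1)
  have L: "limitin (mtop M) (\<lambda>n. \<phi> (k n) (\<gamma> u)) (\<gamma> m) sequentially" if u: "u \<in> T" for u
  proof -
    have "limitin (mtop M) \<gamma> (\<gamma> m) (nhds m)"
      by (rule analytic_curve_at_limitin[OF immersed_at_imp_analytic_curve_at[OF immersed_\<gamma>[OF m]]])
    hence "limitin (mtop M) (\<lambda>n. \<gamma> (f n u)) (\<gamma> m) sequentially"
      unfolding limitin_def using eventually_compose_filterlim[OF _ lim[OF u]] by blast
    thus ?thesis using f[OF u] by (simp add: translate_def)
  qed
  have "\<gamma> m \<in> topspace (mtop M)" "\<gamma> y \<in> topspace (mtop M)" "\<gamma> z \<in> topspace (mtop M)"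
    using \<gamma>_top m T(3) yz by auto
  moreover have "range k \<subseteq> carrier G" using k by auto
  ultimately show False using sat L[OF yz(1)] L[OF yz(2)] yz(3-5) unfolding sated_def by metis
qed

end

section \<open>The translation along a positive curve\<close>

text \<open>Besides satedness, only a germ of h and the freeness of [p, q] are kept from a positive
  interval. This allows an instance for every representative of the class of h.\<close>

locale translated_curve = acted_curve +
  fixes h and p q :: real
  assumes sated: "sated G M \<phi>" and germ_h: "germ h p q 1" and h_notin: "h \<notin> stab"
    and p_less_q: "p < q" and rigid_pq: "rigid {p..q}"
begin

lemma h_carrier: "h \<in> carrier G" using germ_h by (rule germ_carrier)

lemma p_I: "p \<in> I" and q_I: "q \<in> I" using germ_in_I[OF germ_h] by auto

definition dom :: "real set" where
  "dom = (SOME D. \<exists>\<rho>. maximal_lift h 1 D \<rho> \<and> p \<in> D \<and> \<rho> p = q)"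

definition rho :: "real \<Rightarrow> real" where "rho = (SOME \<rho>. maximal_lift h 1 dom \<rho> \<and> p \<in> dom \<and> \<rho> p = q)"

lemma maximal_rho: "maximal_lift h 1 dom rho" and p_dom: "p \<in> dom" and rho_p: "rho p = q"
proof -
  obtain D \<rho> where "maximal_lift h 1 D \<rho>" "p \<in> D" "\<rho> p = q" using maximal_lift_exists[OF germ_h] .
  hence "\<exists>D \<rho>. maximal_lift h 1 D \<rho> \<and> p \<in> D \<and> \<rho> p = q" by blast
  from someI_ex[OF this] have "\<exists>\<rho>. maximal_lift h 1 dom \<rho> \<and> p \<in> dom \<and> \<rho> p = q"
    unfolding dom_def .
  from someI_ex[OF this] show "maximal_lift h 1 dom rho" "p \<in> dom" "rho p = q"
    unfolding rho_def[symmetric] by auto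
qed

lemmas lift_rho = maximal_lift_lift[OF maximal_rho]

definition ran :: "real set" where "ran = rho ` dom"

definition sigma :: "real \<Rightarrow> real" where "sigma = the_inv_into dom rho"

lemma lift_sigma: "lift (inv h) 1 ran sigma"
  unfolding ran_def sigma_def by (rule lift_inverse[OF lift_rho])

lemma sigma_rho: "t \<in> dom \<Longrightarrow> sigma (rho t) = t"
  unfolding sigma_def by (rule the_inv_into_f_f[OF lift_inj[OF lift_rho]])

lemma rho_sigma: "t \<in> ran \<Longrightarrow> rho (sigma t) = t"
  unfolding ran_def using sigma_rho by auto

lemma sigma_dom: "t \<in> ran \<Longrightarrow> sigma t \<in> dom"
  unfolding ran_def using sigma_rho by auto

lemma rho_ran: "t \<in> dom \<Longrightarrow> rho t \<in> ran" by (simp add: ran_def)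

lemma dom_I: "t \<in> dom \<Longrightarrow> t \<in> I" and ran_I: "t \<in> ran \<Longrightarrow> t \<in> I"
  using lift_subset_I[OF lift_rho] lift_subset_I[OF lift_sigma] by auto

lemmas rho_less = lift_less[OF lift_rho] and sigma_less = lift_less[OF lift_sigma]
  and dom_interval = lift_interval[OF lift_rho] and ran_interval = lift_interval[OF lift_sigma]

lemma rho_less_iff: "x \<in> dom \<Longrightarrow> y \<in> dom \<Longrightarrow> rho x < rho y \<longleftrightarrow> x < y"
  using rho_less by (metis less_asym linorder_neqE_linordered_idom)

lemma rho_le_iff: "x \<in> dom \<Longrightarrow> y \<in> dom \<Longrightarrow> rho x \<le> rho y \<longleftrightarrow> x \<le> y"
  using rho_less_iff by (metis linorder_not_less)

lemma q_ran: "q \<in> ran" using p_dom rho_p rho_ran by force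

text \<open>With m0 the least fixed point above p, \<open>rho\<close> pushes all of (p, m0) towards
  m0, so the powers of h collapse this arc.\<close>

lemma rho_no_fixed_point_above:
  assumes m: "m \<in> dom" "p < m" shows "rho m \<noteq> m"
proof
  assume fix_m: "rho m = m"
  have sub: "{p..m} \<subseteq> dom" using dom_interval[OF p_dom m(1)] by auto
  have "continuous_on {p..m} rho" using lift_rho sub by (auto simp: lift_def intro: continuous_on_subset)
  then obtain m0 where m0: "p \<le> m0" "m0 \<le> m" "rho m0 = m0" "\<And>u. p \<le> u \<Longrightarrow> u < m0 \<Longrightarrow> rho u \<noteq> u"
    using least_fixed_point[of p m rho] fix_m m(2) by auto
  hence m0': "p < m0" "m0 \<in> dom" "rho m0 = m0" using rho_p p_less_q sub by (auto simp: less_le)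
  have step: "t < rho t \<and> rho t < m0" if t: "p \<le> t" "t < m0" for t
  proof
    have td: "t \<in> dom" using dom_interval[OF p_dom m0'(2)] t by simp
    show "rho t < m0" using rho_less[OF td m0'(2) t(2)] m0'(3) by simp
    show "t < rho t"
    proof (rule ccontr)
      assume "\<not> t < rho t"
      then obtain u where "p \<le> u" "u \<le> t" "rho u = u"
        using lift_value_between[OF lift_rho p_dom td t(1)] rho_p p_less_q by auto
      with m0(4)[of u] t show False by auto
    qed
  qed
  have cont: "isCont rho t" if "p \<le> t" "t < m0" for t
    using that by (intro lift_isCont[OF lift_rho] dom_interval[OF p_dom m0'(2)]) auto
  note it = iterates_tendsto_upper[where a=p and b=m0 and f=rho, OF step cont]
  have itd: "(rho ^^ n) x \<in> dom" if "x \<in> {p<..<m0}" for n x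
    using it(2)[where x=x and n=n] that by (intro dom_interval[OF p_dom m0'(2)]) auto
  show False
  proof (rule sated_no_collapse[OF sated, of "{p<..<m0}" "(p + m0) / 2" m0 "\<lambda>n. h [^] n" "\<lambda>n. rho ^^ n"])
    show "{p<..<m0} \<subseteq> I" using dom_interval[OF p_dom m0'(2)] dom_I by auto
    show "m0 \<in> I" using m0'(2) dom_I by simp
    show "tr (h [^] n) x = \<gamma> ((rho ^^ n) x)" if "x \<in> {p<..<m0}" for n x
      using that itd by (intro lift_iterate[OF lift_rho _ _ h_carrier] dom_I itd[of x 0, simplified]) auto
    show "(\<lambda>n. (rho ^^ n) x) \<longlonglongrightarrow> m0" if "x \<in> {p<..<m0}" for x
      using that by (intro it(1)) auto
  qed (use m0'(1) h_carrier in auto)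
qed

text \<open>Below p the iterates of \<open>rho\<close> move away from a fixed point. Hence
  \<open>sigma\<close> and the powers of \<open>inv h\<close> are used, with the greatest fixed
  point below p.\<close>

lemma rho_no_fixed_point_below:
  assumes m: "m \<in> dom" "m < p" shows "rho m \<noteq> m"
proof
  assume fix_m: "rho m = m"
  have sub: "{m..p} \<subseteq> dom" using dom_interval[OF m(1) p_dom] by auto
  have "continuous_on {m..p} rho" using lift_rho sub by (auto simp: lift_def intro: continuous_on_subset)
  then obtain m0 where m0: "m \<le> m0" "m0 \<le> p" "rho m0 = m0" "\<And>u. m0 < u \<Longrightarrow> u \<le> p \<Longrightarrow> rho u \<noteq> u"
    using greatest_fixed_point[of m p rho] fix_m m(2) by auto
  hence m0': "m0 < p" "m0 \<in> dom" "rho m0 = m0" using rho_p p_less_q sub by (auto simp: less_le)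
  have m0_ran: "m0 \<in> ran" "sigma m0 = m0" using m0'(2,3) rho_ran[of m0] sigma_rho[of m0] by auto
  have ran: "t \<in> ran" if t: "m0 < t" "t \<le> p" for t
    using ran_interval[OF m0_ran(1) q_ran, of t] t p_less_q by simp
  have step: "sigma t < t \<and> m0 < sigma t" if t: "m0 < t" "t \<le> p" for t
  proof
    have td: "t \<in> dom" using dom_interval[OF m0'(2) p_dom] t by simp
    show "m0 < sigma t" using sigma_less[OF m0_ran(1) ran[OF t] t(1)] m0_ran(2) by simp
    have "t < rho t"
    proof (rule ccontr)
      assume "\<not> t < rho t"
      then obtain u where "t \<le> u" "u \<le> p" "rho u = u"
        using lift_value_between[OF lift_rho td p_dom t(2)] rho_p p_less_q by auto
      with m0(4)[of u] t show False by auto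
    qed
    thus "sigma t < t" using sigma_less[OF ran[OF t] rho_ran[OF td]] sigma_rho[OF td] by simp
  qed
  have cont: "isCont sigma t" if "m0 < t" "t \<le> p" for t
    using that by (intro lift_isCont[OF lift_sigma] ran) auto
  note it = iterates_tendsto_lower[where a=m0 and b=p and f=sigma, OF step cont]
  have itd: "(sigma ^^ n) x \<in> ran" if "x \<in> {m0<..<p}" for n x
    using it(2)[where x=x and n=n] that by (intro ran) auto
  show False
  proof (rule sated_no_collapse[OF sated, of "{m0<..<p}" "(m0 + p) / 2" m0 "\<lambda>n. inv h [^] n" "\<lambda>n. sigma ^^ n"])
    show "{m0<..<p} \<subseteq> I" using ran ran_I by auto
    show "m0 \<in> I" using m0'(2) dom_I by simp
    show "tr (inv h [^] n) x = \<gamma> ((sigma ^^ n) x)" if "x \<in> {m0<..<p}" for n x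
      using that itd h_carrier by (intro lift_iterate[OF lift_sigma] ran_I itd[of x 0, simplified]) auto
    show "(\<lambda>n. (sigma ^^ n) x) \<longlonglongrightarrow> m0" if "x \<in> {m0<..<p}" for x
      using that by (intro it(1)) auto
  qed (use m0'(1) h_carrier in auto)
qed

lemma rho_greater: "t \<in> dom \<Longrightarrow> t < rho t"
proof (rule ccontr)
  assume t: "t \<in> dom" "\<not> t < rho t"
  have no: "rho u \<noteq> u" if "u \<in> dom" for u
    using rho_no_fixed_point_above[OF that] rho_no_fixed_point_below[OF that] rho_p p_less_q
    by (cases u p rule: linorder_cases) auto
  show False
  proof (cases "p \<le> t")
    case True
    from lift_value_between[OF lift_rho p_dom t(1) True] t(2) no rho_p p_less_q show False by auto
  next
    case False
    hence "t \<le> p" by simp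
    from lift_value_between[OF lift_rho t(1) p_dom this] t(2) no rho_p p_less_q show False by auto
  qed
qed

text \<open>Left of p the values of \<open>rho\<close> stay between x and q: they exceed the
  argument and by monotonicity are at most \<open>rho p\<close>. So the continuation does not stop
  before x.\<close>

lemma dom_downward: "t \<in> dom \<Longrightarrow> x \<in> I \<Longrightarrow> x \<le> t \<Longrightarrow> x \<in> dom"
proof -
  assume t: "t \<in> dom" and x: "x \<in> I" "x \<le> t"
  show "x \<in> dom"
  proof (cases "p \<le> x")
    case True thus ?thesis using dom_interval[OF p_dom t] x by simp
  next
    case False
    show ?thesis
    proof (rule maximal_lift_bounded[OF maximal_rho p_dom x(1)])
      show "compact {x..q}" by simp
      show "{x..q} \<subseteq> I" by (rule I_segment[OF x(1) q_I])
      show "rho s \<in> {x..q}" if "s \<in> dom" "s \<in> closed_segment p x" for s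
        using that False rho_greater[OF that(1)] rho_le_iff[OF that(1) p_dom] rho_p
        by (auto simp: closed_segment_eq_real_ivl)
    qed
  qed
qed

text \<open>If y were missed, all values of \<open>rho\<close> would lie below y. Being bounded,
  \<open>rho\<close> would continue from p up to y and take there a value beyond y.\<close>

lemma ran_upward: "s \<in> ran \<Longrightarrow> y \<in> I \<Longrightarrow> s \<le> y \<Longrightarrow> y \<in> ran"
proof (rule ccontr)
  assume s: "s \<in> ran" and y: "y \<in> I" "s \<le> y" and yr: "y \<notin> ran"
  have below: "r < y" if "r \<in> ran" for r
    using ran_interval[OF s that] y(2) yr by force
  have qy: "q < y" by (rule below[OF q_ran])
  have "y \<in> dom"
  proof (rule maximal_lift_bounded[OF maximal_rho p_dom y(1)])
    show "compact {q..y}" by simp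
    show "{q..y} \<subseteq> I" by (rule I_segment[OF q_I y(1)])
    show "rho t \<in> {q..y}" if "t \<in> dom" "t \<in> closed_segment p y" for t
      using that below[OF rho_ran[OF that(1)]] rho_le_iff[OF p_dom that(1)] rho_p qy p_less_q
      by (auto simp: closed_segment_eq_real_ivl)
  qed
  from rho_greater[OF this] below[OF rho_ran[OF this]] show False by simp
qed

lemma sigma_smaller: "t \<in> ran \<Longrightarrow> sigma t < t"
  using rho_greater[OF sigma_dom] rho_sigma by force

lemma germ_rho: "t \<in> dom \<Longrightarrow> germ h t (rho t) 1"
  by (rule lift_germ[OF lift_rho])

lemma germ_sigma: "t \<in> ran \<Longrightarrow> germ (inv h) t (sigma t) 1"
  by (rule lift_germ[OF lift_sigma])

text \<open>A rigid interval contains no self-overlap, hence \<open>x\<close> and \<open>y\<close> have the same image under \<open>f\<close>.\<close>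

lemma rigid_transport:
  assumes rig: "rigid {a..b}" and ab: "germ h a b 1"
    and f: "\<And>x. x \<in> Z \<Longrightarrow> a < f x \<and> f x < b" "inj_on f Z" "\<And>x. x \<in> Z \<Longrightarrow> \<exists>k e. germ k x (f x) e"
    and x: "x \<in> Z" and y: "y \<in> Z" and g: "germ g x y e"
  shows "g \<in> stab"
proof -
  obtain kx ex where kx: "germ kx x (f x) ex" using f(3)[OF x] by blast
  obtain ky ey where ky: "germ ky y (f y) ey" using f(3)[OF y] by blast
  have fx: "f x \<in> interior {a..b}" "f y \<in> interior {a..b}" using f(1)[OF x] f(1)[OF y] by auto
  \<comment> \<open>The transport germs at x and y move both ends of g into (a, b).\<close>
  note k = germ_mult[OF germ_mult[OF germ_inv[OF kx] g] ky]
  have "ky \<otimes> (g \<otimes> inv kx) \<in> stab" by (rule rigidD[OF rig fx k])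
  hence "ky \<otimes> (g \<otimes> inv kx) \<doteq> \<one>" by (simp add: stab_iff)
  from germ_cong[OF this k] have "f x = f y"
    using f(1)[OF x] f(1)[OF y] by (intro rigid_no_self_overlap[OF rig ab h_notin]) auto
  hence "x = y" using f(2) x y by (auto dest: inj_onD)
  \<comment> \<open>Now that x = y, the same kx serves at both ends, so the product is a true
    conjugate of g and membership in the stabilizer can be undone.\<close>
  note k' = germ_mult[OF germ_mult[OF germ_inv[OF kx] g[folded \<open>x = y\<close>]] kx]
  have c: "kx \<in> carrier G" "g \<in> carrier G" using kx g by (auto dest: germ_carrier)
  have "kx \<otimes> (g \<otimes> inv kx) \<in> stab" by (rule rigidD[OF rig fx(1) fx(1) k'])
  hence "kx \<otimes> (g \<otimes> inv kx) \<doteq> \<one>" by (simp add: stab_iff)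
  from same_translate_mult_right[OF this kx] c have "kx \<otimes> g \<doteq> kx" by (simp add: m_assoc)
  from same_translate_mult_left[OF this, of "inv kx"] c have "g \<doteq> \<one>" by (simp flip: m_assoc)
  thus ?thesis by (simp add: stab_iff)
qed

text \<open>A small shift moves the ends of a germ off c. This permits transport maps with a break
  at c in the next two lemmas.\<close>

lemma rigid_remove_point:
  assumes "\<And>g x y e. x \<in> {a<..<b} - {c} \<Longrightarrow> y \<in> {a<..<b} - {c} \<Longrightarrow> germ g x y e \<Longrightarrow> g \<in> stab"
  shows "rigid {a..b}"
  unfolding rigid_def
proof (intro allI impI)
  fix g x y e assume x: "x \<in> interior {a..b}" and y: "y \<in> interior {a..b}" and g: "germ g x y e"
  have e: "e = 1 \<or> e = -1" using germ_sign[OF g] .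
  have xy: "a < x" "x < b" "a < y" "y < b" using x y by auto
  \<comment> \<open>Shifts shorter than the distance to c cannot reach c. If z is c itself, every
    nonzero shift leaves it, and 1 is a mere placeholder.\<close>
  define \<delta> where "\<delta> z = (if z = c then 1 else \<bar>z - c\<bar>)" for z
  define \<epsilon> where "\<epsilon> = min (min (min (x - a) (b - x)) (min (y - a) (b - y))) (min (\<delta> x) (\<delta> y))"
  have "\<delta> z > 0" for z by (simp add: \<delta>_def)
  hence \<epsilon>: "\<epsilon> > 0" "\<epsilon> \<le> x - a" "\<epsilon> \<le> b - x" "\<epsilon> \<le> y - a" "\<epsilon> \<le> b - y" "\<epsilon> \<le> \<delta> x" "\<epsilon> \<le> \<delta> y"
    using xy unfolding \<epsilon>_def by (simp_all add: min_le_iff_disj)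
  obtain t s where ts: "0 < 1 * (t - x)" "1 * (t - x) < \<epsilon>" "0 < 1 * e * (s - y)" "1 * e * (s - y) < \<epsilon>" "germ g t s e"
    using germ_perturb[OF g _ \<epsilon>(1), of 1] by auto
  have "0 < \<bar>s - y\<bar>" "\<bar>s - y\<bar> < \<epsilon>" using ts(3,4) e by auto
  hence "a < s" "s < b" "s \<noteq> c" using \<epsilon> by (auto simp: \<delta>_def split: if_splits)
  hence s: "s \<in> {a<..<b} - {c}" by simp
  have "0 < \<bar>t - x\<bar>" "\<bar>t - x\<bar> < \<epsilon>" using ts(1,2) by auto
  hence "a < t" "t < b" "t \<noteq> c" using \<epsilon> by (auto simp: \<delta>_def split: if_splits)
  hence t: "t \<in> {a<..<b} - {c}" by simp
  show "g \<in> stab" by (rule assms[OF t s ts(5)])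
qed

text \<open>The interval [t, rho t] is [u, rho u] with the piece between u and t moved by h to the
  right end. The map f moves it back: it is the identity left of \<open>rho u\<close> and
  \<open>sigma\<close> to the right of it, with images on different sides of t.\<close>

lemma rigid_step_up:
  assumes r: "rigid {u..rho u}" and u: "u \<in> dom" and t: "t \<in> dom" "u \<le> t" "t \<le> rho u"
  shows "rigid {t..rho t}"
proof (rule rigid_remove_point[of t "rho t" "rho u"])
  fix g x y e assume xy: "x \<in> {t<..<rho t} - {rho u}" "y \<in> {t<..<rho t} - {rho u}" "germ g x y e"
  define f where "f = (\<lambda>x. if x < rho u then x else sigma x)"
  have up: "x \<in> ran \<and> u < sigma x \<and> sigma x < t" if "x \<in> {t<..<rho t} - {rho u}" "\<not> x < rho u" for x
  proof -
    have x: "rho u < x" "x < rho t" using that by auto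
    have xr: "x \<in> ran" using ran_interval[OF rho_ran[OF u] rho_ran[OF t(1)]] x by simp
    thus ?thesis
      using sigma_less[OF rho_ran[OF u] xr x(1)] sigma_less[OF xr rho_ran[OF t(1)] x(2)] sigma_rho[OF u] sigma_rho[OF t(1)]
      by simp
  qed
  show "g \<in> stab"
  proof (rule rigid_transport[OF r germ_rho[OF u] _ _ _ xy, of f])
    show "u < f x \<and> f x < rho u" if "x \<in> {t<..<rho t} - {rho u}" for x
      using that up[OF that] t by (auto simp: f_def)
    show "inj_on f ({t<..<rho t} - {rho u})"
    proof (rule inj_onI)
      fix x y assume a: "x \<in> {t<..<rho t} - {rho u}" "y \<in> {t<..<rho t} - {rho u}" "f x = f y"
      consider "x < rho u" "y < rho u" | "x < rho u" "\<not> y < rho u" | "\<not> x < rho u" "y < rho u" | "\<not> x < rho u" "\<not> y < rho u"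
        by blast
      thus "x = y"
      proof cases
        case 1
        thus ?thesis using a(3) by (simp add: f_def)
      next
        case 2
        hence "x = sigma y" using a(3) by (simp add: f_def)
        with up[OF a(2) 2(2)] a(1) 2(1) t show ?thesis by auto
      next
        case 3
        hence "y = sigma x" using a(3) by (simp add: f_def)
        with up[OF a(1) 3(1)] a(2) 3(2) t show ?thesis by auto
      next
        case 4
        hence "sigma x = sigma y" using a(3) by (simp add: f_def)
        thus ?thesis
          by (rule inj_onD[OF lift_inj[OF lift_sigma]]) (simp_all add: up[OF a(1) 4(1)] up[OF a(2) 4(2)])
      qed
    qed
    show "\<exists>k e. germ k x (f x) e" if "x \<in> {t<..<rho t} - {rho u}" for x
    proof (cases "x < rho u")
      case True
      have "x \<in> I" using that True I_between[OF dom_I[OF t(1)] ran_I[OF rho_ran[OF u]], of x] by simp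
      with True show ?thesis using germ_one by (auto simp: f_def)
    next
      case False
      thus ?thesis using up[OF that False] germ_sigma[of x] by (auto simp: f_def)
    qed
  qed
qed

text \<open>The same rearrangement in the opposite direction: the break is at t, and
  \<open>rho\<close> moves the piece left of t beyond \<open>rho u\<close>.\<close>

lemma rigid_step_down:
  assumes r: "rigid {t..rho t}" and u: "u \<in> dom" and t: "t \<in> dom" "u \<le> t" "t \<le> rho u"
  shows "rigid {u..rho u}"
proof (rule rigid_remove_point[of u "rho u" t])
  fix g x y e assume xy: "x \<in> {u<..<rho u} - {t}" "y \<in> {u<..<rho u} - {t}" "germ g x y e"
  define f where "f = (\<lambda>x. if t < x then x else rho x)"
  have low: "x \<in> dom \<and> rho u < rho x \<and> rho x < rho t" if "x \<in> {u<..<rho u} - {t}" "\<not> t < x" for x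
  proof -
    have x: "u < x" "x < t" using that by auto
    have xd: "x \<in> dom" using dom_interval[OF u t(1)] x by simp
    thus ?thesis using rho_less[OF u xd x(1)] rho_less[OF xd t(1) x(2)] by simp
  qed
  show "g \<in> stab"
  proof (rule rigid_transport[OF r germ_rho[OF t(1)] _ _ _ xy, of f])
    show "t < f x \<and> f x < rho t" if "x \<in> {u<..<rho u} - {t}" for x
      using that low[OF that] t rho_le_iff[OF u t(1)] by (auto simp: f_def)
    show "inj_on f ({u<..<rho u} - {t})"
    proof (rule inj_onI)
      fix x y assume a: "x \<in> {u<..<rho u} - {t}" "y \<in> {u<..<rho u} - {t}" "f x = f y"
      consider "t < x" "t < y" | "t < x" "\<not> t < y" | "\<not> t < x" "t < y" | "\<not> t < x" "\<not> t < y"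
        by blast
      thus "x = y"
      proof cases
        case 1
        thus ?thesis using a(3) by (simp add: f_def)
      next
        case 2
        hence "x = rho y" using a(3) by (simp add: f_def)
        with low[OF a(2) 2(2)] a(1) 2(1) t show ?thesis by auto
      next
        case 3
        hence "y = rho x" using a(3) by (simp add: f_def)
        with low[OF a(1) 3(1)] a(2) 3(2) t show ?thesis by auto
      next
        case 4
        hence "rho x = rho y" using a(3) by (simp add: f_def)
        thus ?thesis
          by (rule inj_onD[OF lift_inj[OF lift_rho]]) (simp_all add: low[OF a(1) 4(1)] low[OF a(2) 4(2)])
      qed
    qed
    show "\<exists>k e. germ k x (f x) e" if "x \<in> {u<..<rho u} - {t}" for x
    proof (cases "t < x")
      case True
      have "x \<in> I" using that True I_between[OF dom_I[OF t(1)] ran_I[OF rho_ran[OF u]], of x] by simp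
      with True show ?thesis using germ_one by (auto simp: f_def)
    next
      case False
      thus ?thesis using low[OF that False] germ_rho[of x] by (auto simp: f_def)
    qed
  qed
qed

lemma rigid_rho: "t \<in> dom \<Longrightarrow> rigid {t..rho t}"
proof -
  assume t: "t \<in> dom"
  define A where "A = {u \<in> dom. rigid {u..rho u}}"
  have op: "open dom" and con: "connected dom" using lift_rho by (auto simp: lift_def)
  \<comment> \<open>For v near u one has u < rho v and v < rho u, so whichever of the two is
    smaller, the step lemmas transfer rigidity both ways.\<close>
  have near: "eventually (\<lambda>v. v \<in> dom \<and> (v \<in> A \<longleftrightarrow> u \<in> A)) (nhds u)" if u: "u \<in> dom" for u
  proof -
    have "eventually (\<lambda>v. rho v \<in> {u<..}) (nhds u)"
      by (rule isCont_eventually_in_open[OF lift_isCont[OF lift_rho u]]) (use rho_greater[OF u] in auto)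
    moreover have "eventually (\<lambda>v. v \<in> dom \<inter> {..<rho u}) (nhds u)"
      by (rule eventually_nhds_in_open) (use op u rho_greater[OF u] in auto)
    ultimately show ?thesis
    proof eventually_elim
      case (elim v)
      hence v: "u < rho v" "v \<in> dom" "v < rho u" by auto
      show ?case
      proof (cases "v \<le> u")
        case True
        thus ?thesis using rigid_step_up[OF _ v(2) u] rigid_step_down[OF _ v(2) u] v u by (auto simp: A_def)
      next
        case False
        thus ?thesis using rigid_step_up[OF _ u v(2)] rigid_step_down[OF _ u v(2)] v u by (auto simp: A_def)
      qed
    qed
  qed
  have "open A"
  proof (subst open_subopen, clarify)
    fix u assume "u \<in> A"
    moreover from this have "u \<in> dom" by (simp add: A_def)
    ultimately have "eventually (\<lambda>v. v \<in> A) (nhds u)" using near[of u] by (auto elim: eventually_mono)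
    thus "\<exists>V. open V \<and> u \<in> V \<and> V \<subseteq> A" unfolding eventually_nhds by blast
  qed
  moreover have "open (dom - A)"
  proof (subst open_subopen, clarify)
    fix u assume "u \<in> dom" "u \<notin> A"
    hence "eventually (\<lambda>v. v \<in> dom - A) (nhds u)" using near[of u] by (auto elim: eventually_mono)
    thus "\<exists>V. open V \<and> u \<in> V \<and> V \<subseteq> dom - A" unfolding eventually_nhds by blast
  qed
  moreover have "p \<in> A" using p_dom rho_p rigid_pq by (simp add: A_def)
  ultimately have "dom - A = {}" using connectedD[OF con, of A "dom - A"] p_dom by (auto simp: A_def)
  with t show ?thesis by (auto simp: A_def)
qed

end

section \<open>Decompositions of curves\<close>

text \<open>A half-open interval lacks an extremum on one side. This decides which end of the
  compact interval belongs to the domain in \<open>leads_wrt\<close>.\<close>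

lemma half_open_no_min_max:
  assumes "half_open_interval K" "a \<in> K" "b \<in> K" "\<And>x. x \<in> K \<Longrightarrow> a \<le> x \<and> x \<le> b"
  shows False
proof -
  have up: "\<exists>x\<in>K. b < x" if "K = {c..<d} \<or> K = {c..}" for c d
  proof -
    have "(b + d) / 2 \<in> K \<and> b < (b + d) / 2 \<or> b + 1 \<in> K" using that assms(3) by auto
    thus ?thesis using less_add_one[of b] by blast
  qed
  have down: "\<exists>x\<in>K. x < a" if "K = {c<..d} \<or> K = {..d}" for c d
  proof -
    have "(a + c) / 2 \<in> K \<and> (a + c) / 2 < a \<or> a - 1 \<in> K" using that assms(2) by auto
    moreover have "a - 1 < a" by simp
    ultimately show ?thesis by blast
  qed
  from assms(1) obtain c d where "K = {c..<d} \<or> K = {c<..d} \<or> K = {c..} \<or> K = {..d}"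
    unfolding half_open_interval_def by blast
  with up[of c d] down[of c d] obtain x where "x \<in> K" "x < a \<or> b < x" by blast
  with assms(4)[of x] show False by auto
qed

lemma half_open_of_min:
  assumes D: "real_interval D" and y: "y \<in> D" "\<And>x. x \<in> D \<Longrightarrow> y \<le> x" and no: "\<And>x. x \<in> D \<Longrightarrow> \<exists>x'\<in>D. x < x'"
  shows "half_open_interval D"
proof -
  have int: "t \<in> D" if "a \<in> D" "b \<in> D" "a \<le> t" "t \<le> b" for a b t
    using D that unfolding real_interval_def is_interval_connected_1[symmetric] is_interval_1 by blast
  have "D = {y..} \<or> D = {y..<Sup D}"
  proof (cases "bdd_above D")
    case True
    have "t \<in> D" if t: "y \<le> t" "t < Sup D" for t
    proof -
      obtain b where "b \<in> D" "t < b" using less_cSupD[OF _ t(2)] y(1) by blast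
      thus ?thesis using int[OF y(1)] t(1) by auto
    qed
    moreover have "t < Sup D" if t: "t \<in> D" for t
    proof -
      obtain x where "x \<in> D" "t < x" using no[OF t] by blast
      with cSup_upper[OF _ True] show ?thesis by (meson less_le_trans)
    qed
    ultimately have "D = {y..<Sup D}" using y(2) by auto
    thus ?thesis ..
  next
    case False
    have "t \<in> D" if "y \<le> t" for t
    proof -
      obtain b where "b \<in> D" "t < b" using False unfolding bdd_above_def by (meson not_le)
      thus ?thesis using int[OF y(1)] that by auto
    qed
    hence "D = {y..}" using y(2) by auto
    thus ?thesis ..
  qed
  thus ?thesis using D unfolding half_open_interval_def by blast
qed

lemma half_open_of_max:
  assumes D: "real_interval D" and y: "y \<in> D" "\<And>x. x \<in> D \<Longrightarrow> x \<le> y" and no: "\<And>x. x \<in> D \<Longrightarrow> \<exists>x'\<in>D. x' < x"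
  shows "half_open_interval D"
proof -
  have int: "t \<in> D" if "a \<in> D" "b \<in> D" "a \<le> t" "t \<le> b" for a b t
    using D that unfolding real_interval_def is_interval_connected_1[symmetric] is_interval_1 by blast
  have "D = {..y} \<or> D = {Inf D<..y}"
  proof (cases "bdd_below D")
    case True
    have "t \<in> D" if t: "Inf D < t" "t \<le> y" for t
    proof -
      obtain b where "b \<in> D" "b < t" using cInf_lessD[OF _ t(1)] y(1) by blast
      thus ?thesis using int[OF _ y(1)] t(2) by auto
    qed
    moreover have "Inf D < t" if t: "t \<in> D" for t
    proof -
      obtain x where "x \<in> D" "x < t" using no[OF t] by blast
      with cInf_lower[OF _ True] show ?thesis by (meson le_less_trans)
    qed
    ultimately have "D = {Inf D<..y}" using y(2) by auto
    thus ?thesis ..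
  next
    case False
    have "t \<in> D" if "t \<le> y" for t
    proof -
      obtain b where "b \<in> D" "b < t" using False unfolding bdd_below_def by (meson not_le)
      thus ?thesis using int[OF _ y(1)] that by auto
    qed
    hence "D = {..y}" using y(2) by auto
    thus ?thesis ..
  qed
  thus ?thesis using D unfolding half_open_interval_def by blast
qed

lemma real_interval_Icc: "a < b \<Longrightarrow> real_interval {a..b::real}"
  unfolding real_interval_def by simp

lemma compact_real_interval:
  assumes "compact A" "real_interval A"
  obtains a b where "A = {a..b}" "a < b"
proof -
  have "\<exists>a b. A = {a..b}"
    using assms connected_compact_interval_1[of A] by (auto simp: real_interval_def)
  then obtain a b where A: "A = {a..b}" by blast
  moreover have "interior A \<noteq> {}" using assms(2) by (simp add: real_interval_def)
  ultimately have "a < b" by (auto simp: interior_atLeastAtMost_real)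
  with A show ?thesis by (rule that)
qed

lemma real_interval_islimpt:
  assumes "real_interval K" "x \<in> K" "d > 0"
  obtains t where "t \<in> K" "t \<noteq> x" "\<bar>t - x\<bar> < d"
proof -
  have int: "t \<in> K" if "a \<in> K" "b \<in> K" "a \<le> t" "t \<le> b" for a b t
    using assms(1) that unfolding real_interval_def is_interval_connected_1[symmetric] is_interval_1 by blast
  have "K \<noteq> {x}" using assms(1) by (auto simp: real_interval_def)
  then obtain y where y: "y \<in> K" "y \<noteq> x" using assms(2) by blast
  show ?thesis
  proof (cases "x < y")
    case True
    have "min y (x + d/2) \<in> K" by (rule int[OF assms(2) y(1)]) (use True assms(3) in auto)
    thus ?thesis by (rule that) (use True assms(3) in auto)
  next
    case False
    have "max y (x - d/2) \<in> K" by (rule int[OF y(1) assms(2)]) (use False y(2) assms(3) in auto)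
    thus ?thesis by (rule that) (use False y(2) assms(3) in auto)
  qed
qed

lemma analytic_diffeo_strict_mono:
  assumes "analytic_diffeo K D \<mu>"
  shows "continuous_on K \<mu>" "strict_mono_on K \<mu> \<or> strict_antimono_on K \<mu>"
    "real_interval K" "real_interval D" "\<mu> ` K = D"
proof -
  from assms show K: "real_interval K" and "real_interval D" and D: "\<mu> ` K = D"
    unfolding analytic_diffeo_def by (auto simp: bij_betw_def)
  from assms have inj: "inj_on \<mu> K" unfolding analytic_diffeo_def by (auto simp: bij_betw_def)
  from assms obtain J \<nu> where J: "K \<subseteq> J" "\<And>t. t \<in> K \<Longrightarrow> \<nu> t = \<mu> t" "\<And>t. t \<in> J \<Longrightarrow> real_analytic_at \<nu> t"
    unfolding analytic_diffeo_def by blast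
  have "continuous_on K \<nu>"
    using J(1,3) by (intro continuous_at_imp_continuous_on ballI real_analytic_at_isCont) blast
  thus cont: "continuous_on K \<mu>" by (rule continuous_on_eq) (rule J(2))
  have "is_interval K" using K by (simp add: real_interval_def is_interval_connected_1)
  thus "strict_mono_on K \<mu> \<or> strict_antimono_on K \<mu>"
    using injective_eq_monotone_map[OF _ cont] inj by blast
qed

section \<open>Germs at the ends of the cells of a decomposition\<close>

context acted_curve
begin

text \<open>A germ with ends on the boundary can be used once some direction d moves both ends
  inwards; y then moves in direction d * e, hence the conditions on this product.\<close>

lemma rigid_germ_closed:
  assumes rig: "rigid {a..b}" and g: "germ g x y e" and ab: "a < b" and x: "a \<le> x" "x \<le> b" and y: "a \<le> y" "y \<le> b"
    and d: "d = 1 \<or> d = -1" "d = 1 \<Longrightarrow> x < b" "d = -1 \<Longrightarrow> a < x" "d * e = 1 \<Longrightarrow> y < b" "d * e = -1 \<Longrightarrow> a < y"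
  shows "g \<in> stab"
proof -
  have e: "e = 1 \<or> e = -1" using germ_sign[OF g] .
  define \<epsilon> where "\<epsilon> = min (if d = 1 then b - x else x - a) (if d * e = 1 then b - y else y - a)"
  have \<epsilon>: "\<epsilon> > 0" using d e by (auto simp: \<epsilon>_def)
  obtain t s where ts: "0 < d * (t - x)" "d * (t - x) < \<epsilon>" "0 < d * e * (s - y)" "d * e * (s - y) < \<epsilon>" "germ g t s e"
    using germ_perturb[OF g d(1) \<epsilon>] .
  have "a < t" "t < b" using d(1) ts(1,2) x by (auto simp: \<epsilon>_def)
  moreover have "d * e = 1 \<or> d * e = -1" using d(1) e by auto
  hence "a < s" "s < b" using ts(3,4) y by (auto simp: \<epsilon>_def)
  ultimately show ?thesis by (intro rigidD[OF rig _ _ ts(5)]) auto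
qed

text \<open>K may contain its end points, where \<mu> matches the curves from one side only.
  Accumulation still gives a germ on both sides, and monotonicity of \<mu> decides its sign.\<close>

lemma germ_of_parameter:
  assumes g: "g \<in> carrier G" and K: "real_interval K" "K \<subseteq> I" and \<mu>: "continuous_on K \<mu>" "\<mu> ` K \<subseteq> I"
    and eq: "\<And>t. t \<in> K \<Longrightarrow> tr g t = \<gamma> (\<mu> t)" and x: "x \<in> K"
  shows "strict_mono_on K \<mu> \<Longrightarrow> germ g x (\<mu> x) 1" "strict_antimono_on K \<mu> \<Longrightarrow> germ g x (\<mu> x) (-1)"
proof -
  have near: "\<exists>t\<in>K. t \<noteq> x \<and> \<bar>t - x\<bar> < d \<and> \<bar>\<mu> t - \<mu> x\<bar> < d" if d: "d > 0" for d
  proof -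
    obtain r where r: "r > 0" "\<And>t. t \<in> K \<Longrightarrow> \<bar>t - x\<bar> < r \<Longrightarrow> \<bar>\<mu> t - \<mu> x\<bar> < d"
      using \<mu>(1) x d unfolding continuous_on_iff dist_real_def by metis
    obtain t where "t \<in> K" "t \<noteq> x" "\<bar>t - x\<bar> < min r d"
      using real_interval_islimpt[OF K(1) x, of "min r d"] r(1) d by auto
    with r(2) show ?thesis by auto
  qed
  have xy: "x \<in> I" "\<mu> x \<in> I" using K(2) \<mu>(2) x by auto
  have "curves_accumulate (tr g) \<gamma> x (\<mu> x)"
    unfolding curves_accumulate_def using near eq by meson
  then obtain e where ge: "germ g x (\<mu> x) e" using germI_accumulate[OF g xy] by blast
  obtain \<nu> \<delta> where c: "germ_chart g x (\<mu> x) e \<nu> \<delta>" using germE[OF ge] .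
  note \<nu> = germ_chartD[OF c] and l = lift_of_germ_chart[OF c]
  obtain t where t: "t \<in> K" "t \<noteq> x" "\<bar>t - x\<bar> < \<delta>" "\<bar>\<mu> t - \<mu> x\<bar> < \<delta>" using near[OF \<nu>(1)] by blast
  have \<nu>t: "\<nu> t = \<mu> t" using \<nu>(6)[OF t(3,4) eq[OF t(1)]] by simp
  have tb: "t \<in> ball x \<delta>" "x \<in> ball x \<delta>" using t(3) \<nu>(1) by (auto simp: dist_real_def abs_minus_commute)
  have e: "e = 1 \<or> e = -1" using germ_sign[OF ge] .
  show "germ g x (\<mu> x) 1" if m: "strict_mono_on K \<mu>"
  proof -
    have "\<not> e = -1"
    proof
      assume "e = -1"
      with l have l': "lift g (-1) (ball x \<delta>) \<nu>" by simp
      show False using lift_greater[OF l' tb] lift_greater[OF l' tb(2,1)] t(2) \<nu>t \<nu>(2)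
        strict_mono_onD[OF m t(1) x] strict_mono_onD[OF m x t(1)] by linarith
    qed
    with e ge show ?thesis by auto
  qed
  show "germ g x (\<mu> x) (-1)" if m: "strict_antimono_on K \<mu>"
  proof -
    have "\<not> e = 1"
    proof
      assume "e = 1"
      with l have l': "lift g 1 (ball x \<delta>) \<nu>" by simp
      show False using lift_less[OF l' tb] lift_less[OF l' tb(2,1)] t(2) \<nu>t \<nu>(2)
        monotone_onD[OF m t(1) x] monotone_onD[OF m x t(1)] by linarith
    qed
    with e ge show ?thesis by auto
  qed
qed

lemma leads_germ:
  assumes lw: "leads_wrt M {a..b} (tr g) D \<gamma> K \<mu>" and g: "g \<in> carrier G" and ab: "{a..b} \<subseteq> I" and D: "D \<subseteq> I"
    and x: "x \<in> K"
  shows "strict_mono_on K \<mu> \<Longrightarrow> germ g x (\<mu> x) 1" "strict_antimono_on K \<mu> \<Longrightarrow> germ g x (\<mu> x) (-1)"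
proof -
  from lw have ad: "analytic_diffeo K D \<mu>" and K: "K \<subseteq> {a..b}" and eq: "\<And>t. t \<in> K \<Longrightarrow> tr g t = \<gamma> (\<mu> t)"
    unfolding leads_wrt_def by auto
  note \<mu> = analytic_diffeo_strict_mono[OF ad]
  have KI: "K \<subseteq> I" "\<mu> ` K \<subseteq> I" using K ab D \<mu>(5) by auto
  show "germ g x (\<mu> x) 1" if "strict_mono_on K \<mu>"
    by (rule germ_of_parameter(1)[OF g \<mu>(3) KI(1) \<mu>(1) KI(2) _ x that]) (rule eq)
  show "germ g x (\<mu> x) (-1)" if "strict_antimono_on K \<mu>"
    by (rule germ_of_parameter(2)[OF g \<mu>(3) KI(1) \<mu>(1) KI(2) _ x that]) (rule eq)
qed

text \<open>The cell D contains both of its ends, so the half-open alternative of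
  \<open>leads_wrt\<close> is excluded.\<close>

lemma leads_full:
  assumes lw: "leads_wrt M {a..b} \<beta> D \<gamma> K \<mu>" and c: "c \<in> D" "d \<in> D" "\<And>x. x \<in> D \<Longrightarrow> c \<le> x \<and> x \<le> d"
  shows "K = {a..b}"
  using lw half_open_no_min_max[OF _ c] unfolding leads_wrt_def by blast

text \<open>The least point c of D must come from an end of [a, b], namely a or b according to
  orientation. Were that end missing, K would be half-open and contain the other end, which gives it
  both a least and a greatest element.\<close>

lemma leads_cell_min:
  assumes lw: "leads_wrt M {a..b} (tr g) D \<gamma> K \<mu>" and g: "g \<in> carrier G" and ab: "{a..b} \<subseteq> I" "a \<le> b" and D: "D \<subseteq> I"
    and c: "c \<in> D" "\<And>x. x \<in> D \<Longrightarrow> c \<le> x"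
  shows "strict_mono_on K \<mu> \<Longrightarrow> germ g a c 1" "strict_antimono_on K \<mu> \<Longrightarrow> germ g b c (-1)"
    "strict_mono_on K \<mu> \<Longrightarrow> d \<in> D \<Longrightarrow> (\<And>x. x \<in> D \<Longrightarrow> x \<le> d) \<Longrightarrow> germ g b d 1"
proof -
  from lw have ad: "analytic_diffeo K D \<mu>" and K: "K \<subseteq> {a..b}"
    and cond: "K = {a..b} \<or> half_open_interval K \<and> (Inf {a..b} \<in> K \<or> Sup {a..b} \<in> K)"
    unfolding leads_wrt_def by auto
  have cond: "K = {a..b} \<or> half_open_interval K \<and> (a \<in> K \<or> b \<in> K)" using cond ab(2) by simp
  note \<mu> = analytic_diffeo_strict_mono[OF ad]
  obtain k0 where k0: "k0 \<in> K" "\<mu> k0 = c" using c(1) \<mu>(5) by auto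
  have ge: "c \<le> \<mu> k" if "k \<in> K" for k using c(2) that \<mu>(5) by auto
  show "germ g a c 1" if m: "strict_mono_on K \<mu>"
  proof -
    have min: "k0 \<le> k" if "k \<in> K" for k
      using ge[OF that] strict_mono_onD[OF m that k0(1)] k0(2) by fastforce
    have "a \<in> K"
    proof (rule ccontr)
      assume "a \<notin> K"
      with cond ab(2) have "half_open_interval K" "b \<in> K" by auto
      thus False using half_open_no_min_max[OF _ k0(1)] min K by fastforce
    qed
    hence "k0 = a" using min[of a] K k0(1) by force
    with leads_germ(1)[OF lw g ab(1) D k0(1) m] k0(2) show ?thesis by simp
  qed
  show "germ g b c (-1)" if m: "strict_antimono_on K \<mu>"
  proof -
    have max: "k \<le> k0" if "k \<in> K" for k
      using ge[OF that] monotone_onD[OF m k0(1) that] k0(2) by fastforce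
    have "b \<in> K"
    proof (rule ccontr)
      assume "b \<notin> K"
      with cond ab(2) have "half_open_interval K" "a \<in> K" by auto
      thus False using half_open_no_min_max[OF _ _ k0(1)] max K by fastforce
    qed
    hence "k0 = b" using max[of b] K k0(1) by force
    with leads_germ(2)[OF lw g ab(1) D k0(1) m] k0(2) show ?thesis by simp
  qed
  show "germ g b d 1" if m: "strict_mono_on K \<mu>" and d: "d \<in> D" "\<And>x. x \<in> D \<Longrightarrow> x \<le> d"
  proof -
    have full: "K = {a..b}" using leads_full[OF lw c(1) d(1)] c(2) d(2) by blast
    hence bK: "b \<in> K" using ab(2) by simp
    obtain k where k: "k \<in> K" "\<mu> k = d" using d(1) \<mu>(5) by auto
    have "\<mu> b \<le> d" using bK d(2) \<mu>(5) by auto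
    hence "k = b" using strict_mono_onD[OF m k(1) bK] k full by fastforce
    with leads_germ(1)[OF lw g ab(1) D bK m] k(2) show ?thesis by simp
  qed
qed

lemma leads_cell_max:
  assumes lw: "leads_wrt M {a..b} (tr g) D \<gamma> K \<mu>" and g: "g \<in> carrier G" and ab: "{a..b} \<subseteq> I" "a \<le> b" and D: "D \<subseteq> I"
    and c: "c \<in> D" "\<And>x. x \<in> D \<Longrightarrow> x \<le> c"
  shows "strict_mono_on K \<mu> \<Longrightarrow> germ g b c 1" "strict_antimono_on K \<mu> \<Longrightarrow> germ g a c (-1)"
    "strict_mono_on K \<mu> \<Longrightarrow> d \<in> D \<Longrightarrow> (\<And>x. x \<in> D \<Longrightarrow> d \<le> x) \<Longrightarrow> germ g a d 1"
proof -
  from lw have ad: "analytic_diffeo K D \<mu>" and K: "K \<subseteq> {a..b}"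
    and cond: "K = {a..b} \<or> half_open_interval K \<and> (Inf {a..b} \<in> K \<or> Sup {a..b} \<in> K)"
    unfolding leads_wrt_def by auto
  have cond: "K = {a..b} \<or> half_open_interval K \<and> (a \<in> K \<or> b \<in> K)" using cond ab(2) by simp
  note \<mu> = analytic_diffeo_strict_mono[OF ad]
  obtain k0 where k0: "k0 \<in> K" "\<mu> k0 = c" using c(1) \<mu>(5) by auto
  have le: "\<mu> k \<le> c" if "k \<in> K" for k using c(2) that \<mu>(5) by auto
  show "germ g b c 1" if m: "strict_mono_on K \<mu>"
  proof -
    have max: "k \<le> k0" if "k \<in> K" for k
      using le[OF that] strict_mono_onD[OF m k0(1) that] k0(2) by fastforce
    have "b \<in> K"
    proof (rule ccontr)
      assume "b \<notin> K"
      with cond ab(2) have "half_open_interval K" "a \<in> K" by auto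
      thus False using half_open_no_min_max[OF _ _ k0(1)] max K by fastforce
    qed
    hence "k0 = b" using max[of b] K k0(1) by force
    with leads_germ(1)[OF lw g ab(1) D k0(1) m] k0(2) show ?thesis by simp
  qed
  show "germ g a c (-1)" if m: "strict_antimono_on K \<mu>"
  proof -
    have min: "k0 \<le> k" if "k \<in> K" for k
      using le[OF that] monotone_onD[OF m that k0(1)] k0(2) by fastforce
    have "a \<in> K"
    proof (rule ccontr)
      assume "a \<notin> K"
      with cond ab(2) have "half_open_interval K" "b \<in> K" by auto
      thus False using half_open_no_min_max[OF _ k0(1)] min K by fastforce
    qed
    hence "k0 = a" using min[of a] K k0(1) by force
    with leads_germ(2)[OF lw g ab(1) D k0(1) m] k0(2) show ?thesis by simp
  qed
  show "germ g a d 1" if m: "strict_mono_on K \<mu>" and d: "d \<in> D" "\<And>x. x \<in> D \<Longrightarrow> d \<le> x"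
  proof -
    have full: "K = {a..b}" using leads_full[OF lw d(1) c(1)] c(2) d(2) by blast
    hence aK: "a \<in> K" using ab(2) by simp
    obtain k where k: "k \<in> K" "\<mu> k = d" using d(1) \<mu>(5) by auto
    have "d \<le> \<mu> a" using aK d(2) \<mu>(5) by auto
    hence "k = a" using strict_mono_onD[OF m aK k(1)] k full by fastforce
    with leads_germ(1)[OF lw g ab(1) D aK m] k(2) show ?thesis by simp
  qed
qed

text \<open>A germ within D is conjugated by k to a germ inside [a, b]. The way back multiplies by
  \<open>inv k\<close> from the right, for which a germ is at hand.\<close>

lemma leads_cell_rigid:
  assumes lw: "leads_wrt M {a..b} (tr k) D \<gamma> K \<mu>" and m: "strict_mono_on K \<mu>"
    and k: "k \<in> carrier G" and ab: "{a..b} \<subseteq> I" and D: "D \<subseteq> I" and rig: "rigid {a..b}"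
  shows "rigid D"
  unfolding rigid_def
proof (intro allI impI)
  fix g x y e assume xD: "x \<in> interior D" and yD: "y \<in> interior D" and g: "germ g x y e"
  from lw have ad: "analytic_diffeo K D \<mu>" and K: "K \<subseteq> {a..b}"
    unfolding leads_wrt_def by auto
  note \<mu> = analytic_diffeo_strict_mono[OF ad]
  \<comment> \<open>Points of D on either side of z have parameters on either side of t, so t is
    interior to [a, b].\<close>
  have pre: "\<exists>t. a < t \<and> t < b \<and> germ k t z 1" if z: "z \<in> interior D" for z
  proof -
    obtain r where r: "r > 0" "ball z r \<subseteq> D" using z by (meson interior_subset openE open_interior subset_trans)
    have zs: "z - r/2 \<in> D" "z \<in> D" "z + r/2 \<in> D"
      by (rule subsetD[OF r(2)], use r(1) in \<open>simp add: dist_real_def\<close>)+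
    obtain t1 t t2 where t: "t1 \<in> K" "\<mu> t1 = z - r/2" "t \<in> K" "\<mu> t = z" "t2 \<in> K" "\<mu> t2 = z + r/2"
      using zs \<mu>(5) by (metis imageE)
    have lt: "u < v" if "u \<in> K" "v \<in> K" "\<mu> u < \<mu> v" for u v
      using strict_mono_onD[OF m that(2,1)] that(3) by (cases u v rule: linorder_cases) auto
    have "t1 < t" "t < t2" using r(1) lt[OF t(1,3)] lt[OF t(3,5)] unfolding t(2,4,6) by auto
    moreover have "germ k t z 1" using leads_germ(1)[OF lw k ab D t(3) m] t(4) by simp
    moreover have "a \<le> t1" "t2 \<le> b" using t K by auto
    ultimately show ?thesis by (intro exI[of _ t]) auto
  qed
  obtain u v where u: "a < u" "u < b" "germ k u x 1" and v: "a < v" "v < b" "germ k v y 1"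
    using pre[OF xD] pre[OF yD] by blast
  have gc: "g \<in> carrier G" using g by (rule germ_carrier)
  have "inv k \<otimes> (g \<otimes> k) \<in> stab"
    by (rule rigidD[OF rig _ _ germ_mult[OF germ_mult[OF u(3) g] germ_inv[OF v(3)]]]) (use u v in auto)
  hence "inv k \<otimes> (g \<otimes> k) \<doteq> \<one>" by (simp add: stab_iff)
  from same_translate_mult_left[OF this k] have "g \<otimes> k \<doteq> k" using gc k by (simp flip: m_assoc)
  from same_translate_mult_right[OF this germ_inv[OF u(3)]] have "g \<doteq> \<one>" using gc k by (simp add: m_assoc)
  thus "g \<in> stab" by (simp add: stab_iff)
qed

end

lemma Fin_Suc_le: "Fin (n::int) < u \<Longrightarrow> Fin (n + 1) \<le> u"
  by (cases u) auto

lemma Fin_pred_ge: "l < Fin (n::int) \<Longrightarrow> l \<le> Fin (n - 1)"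
  by (cases l) auto

lemma real_interval_segment: "real_interval A \<Longrightarrow> x \<in> A \<Longrightarrow> y \<in> A \<Longrightarrow> {x..y} \<subseteq> A"
  unfolding real_interval_def is_interval_connected_1[symmetric] is_interval_1 subset_eq Ball_def atLeastAtMost_iff
  by blast

section \<open>Compact maximal intervals and comparison of neighbouring cells\<close>

context translated_curve
begin

lemma I_rho: "t \<in> dom \<Longrightarrow> {t..rho t} \<subseteq> I"
  by (rule I_segment[OF dom_I ran_I[OF rho_ran]])

lemma free_interval_Icc: "a < b \<Longrightarrow> {a..b} \<subseteq> I \<Longrightarrow> free_interval G M \<phi> I \<gamma> {a..b} \<longleftrightarrow> rigid {a..b}"
  by (rule free_interval_iff_rigid[OF real_interval_Icc])

text \<open>In a free interval reaching beyond one end, the germ of h from t to \<open>rho t\<close>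
  could be shifted in that direction into the interior, which would put h into the
  stabilizer.\<close>

lemma compact_maximal_rho:
  assumes t: "t \<in> dom"
  shows "compact_maximal_interval G M \<phi> I \<gamma> {t..rho t}"
proof -
  have lt: "t < rho t" by (rule rho_greater[OF t])
  have free: "free_interval G M \<phi> I \<gamma> {t..rho t}"
    using free_interval_Icc[OF lt I_rho[OF t]] rigid_rho[OF t] by blast
  have "\<not> free_interval G M \<phi> I \<gamma> A" if sub: "{t..rho t} \<subset> A" for A
  proof
    assume A: "free_interval G M \<phi> I \<gamma> A"
    hence ri: "real_interval A" "A \<subseteq> I" by (auto simp: free_interval_def)
    have rig: "rigid A" using A free_interval_iff_rigid[OF ri] by blast
    note seg = real_interval_segment[OF ri(1)]
    obtain z where z: "z \<in> A" "z \<notin> {t..rho t}" using sub by blast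
    have tA: "t \<in> A" "rho t \<in> A" by (rule subsetD[OF psubset_imp_subset[OF sub]], use lt in simp)+
    have "h \<in> stab"
    proof (cases "z < t")
      case True
      show ?thesis
        by (rule rigid_germ_closed[OF rigid_subset[OF rig seg[OF z(1) tA(2)]] germ_rho[OF t], of "-1"]) (use True lt in auto)
    next
      case False
      hence "rho t < z" using z(2) by auto
      show ?thesis
        by (rule rigid_germ_closed[OF rigid_subset[OF rig seg[OF tA(1) z(1)]] germ_rho[OF t], of 1]) (use \<open>rho t < z\<close> lt in auto)
    qed
    with h_notin show False ..
  qed
  with free show ?thesis unfolding compact_maximal_interval_def maximal_interval_def by blast
qed

text \<open>If b = rho t, then t < a contradicts maximality of B, and a < t contradicts freeness of
  B because the germ of h from t to b can be shifted to the left.\<close>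

lemma compact_maximal_is_rho:
  assumes B: "compact_maximal_interval G M \<phi> I \<gamma> B"
  obtains t where "t \<in> dom" "B = {t..rho t}"
proof -
  have free: "free_interval G M \<phi> I \<gamma> B" and cB: "compact B"
    and maxB: "\<And>A. B \<subset> A \<Longrightarrow> \<not> free_interval G M \<phi> I \<gamma> A"
    using B unfolding compact_maximal_interval_def maximal_interval_def by blast+
  have ri: "real_interval B" "B \<subseteq> I" using free by (auto simp: free_interval_def)
  obtain a b where ab: "B = {a..b}" "a < b" using compact_real_interval[OF cB ri(1)] .
  have rig: "rigid {a..b}" using free free_interval_iff_rigid[OF ri] ab(1) by simp
  have abI: "a \<in> I" "b \<in> I" using ri(2) ab by auto
  have nomore: False if "c < d" "{c..d} \<subseteq> I" "rigid {c..d}" "c \<le> a" "b \<le> d" "c < a \<or> b < d" for c d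
  proof -
    have "B \<subset> {c..d}" using that(4-6) ab by auto
    thus False using maxB free_interval_Icc[OF that(1,2)] that(3) by blast
  qed
  show ?thesis
  proof (cases "b \<in> ran")
    case True
    define t where "t = sigma b"
    have t: "t \<in> dom" "rho t = b" using sigma_dom[OF True] rho_sigma[OF True] by (auto simp: t_def)
    have gt: "germ h t b 1" using germ_rho[OF t(1)] t(2) by simp
    have "\<not> t < a"
    proof
      assume "t < a"
      thus False using nomore[of t b] rigid_rho[OF t(1)] I_rho[OF t(1)] t(2) ab(2) by auto
    qed
    moreover have "\<not> a < t"
    proof
      assume "a < t"
      have "h \<in> stab"
        by (rule rigid_germ_closed[OF rig gt ab(2), of "-1"]) (use \<open>a < t\<close> rho_greater[OF t(1)] t(2) ab(2) in auto)
      with h_notin show False ..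
    qed
    ultimately have "t = a" by simp
    thus ?thesis using that t ab(1) by blast
  next
    case False
    \<comment> \<open>With b outside \<open>ran\<close>, B is properly contained in a free interval:
      in [p, q] if p \<le> a, and in [a, rho a] otherwise.\<close>
    have bq: "b < q" using ran_upward[OF q_ran abI(2)] False by force
    have "\<not> p \<le> a"
    proof
      assume "p \<le> a"
      thus False using nomore[OF p_less_q I_segment[OF p_I q_I] rigid_pq] bq by auto
    qed
    hence ad: "a \<in> dom" using dom_downward[OF p_dom abI(1)] by simp
    have "b < rho a" using ran_upward[OF rho_ran[OF ad] abI(2)] False by force
    hence False using nomore[OF rho_greater[OF ad] I_rho[OF ad] rigid_rho[OF ad]] by auto
    thus ?thesis ..
  qed
qed

text \<open>The quotient has an increasing germ from a to a, which can be shifted to the right into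
  the free interval [a, rho a].\<close>

lemma germ_same_translate:
  assumes a: "a \<in> dom" and g: "germ g a y 1" and k: "germ k a y 1"
  shows "g \<doteq> k"
proof -
  have lt: "a < rho a" by (rule rho_greater[OF a])
  have c: "g \<in> carrier G" "k \<in> carrier G" using g k by (auto dest: germ_carrier)
  have "inv g \<otimes> k \<in> stab"
    by (rule rigid_germ_closed[OF rigid_rho[OF a] germ_mult[OF k germ_inv[OF g]], of 1]) (use lt in auto)
  thus ?thesis using same_translate_iff[OF c] by blast
qed

lemma germ_same_translate':
  assumes a: "a \<in> dom" and g: "germ g (rho a) y 1" and k: "germ k (rho a) y 1"
  shows "g \<doteq> k"
proof -
  have lt: "a < rho a" by (rule rho_greater[OF a])
  have c: "g \<in> carrier G" "k \<in> carrier G" using g k by (auto dest: germ_carrier)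
  have "inv g \<otimes> k \<in> stab"
    by (rule rigid_germ_closed[OF rigid_rho[OF a] germ_mult[OF k germ_inv[OF g]], of "-1"]) (use lt in auto)
  thus ?thesis using same_translate_iff[OF c] by blast
qed

text \<open>A decreasing parameter change at one end would fold \<open>\<gamma>\<close> back onto itself.\<close>

lemma germ_ends_not_reversed:
  assumes a: "a \<in> dom" and k: "germ k a y 1" and g: "germ g (rho a) y (-1)"
  shows False
proof -
  have lt: "a < rho a" by (rule rho_greater[OF a])
  have gk: "germ (inv g \<otimes> k) a (rho a) (-1)" using germ_mult[OF k germ_inv[OF g]] by simp
  have "inv g \<otimes> k \<in> stab"
    by (rule rigid_germ_closed[OF rigid_rho[OF a] gk, of 1]) (use lt in auto)
  hence "germ \<one> a (rho a) (-1)" using germ_cong gk by (auto simp: stab_iff)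
  with no_flip show False by blast
qed

lemma germ_ends_not_reversed':
  assumes a: "a \<in> dom" and k: "germ k (rho a) y 1" and g: "germ g a y (-1)"
  shows False
proof -
  have lt: "a < rho a" by (rule rho_greater[OF a])
  have gk: "germ (inv g \<otimes> k) (rho a) a (-1)" using germ_mult[OF k germ_inv[OF g]] by simp
  have "inv g \<otimes> k \<in> stab"
    by (rule rigid_germ_closed[OF rigid_rho[OF a] gk, of "-1"]) (use lt in auto)
  hence "germ \<one> (rho a) a (-1)" using germ_cong gk by (auto simp: stab_iff)
  with no_flip show False by blast
qed

text \<open>Here k belongs to the preceding cell and takes its right end to y. Since h takes a to
  \<open>rho a\<close>, the product \<open>k \<otimes> h\<close> takes a to y. So does g once a
  decreasing parameter is excluded, and increasing germs from a to y determine the class.\<close>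

lemma leads_next_right:
  assumes a: "a \<in> dom" and k: "germ k (rho a) y 1" and lead: "leads M {a..rho a} (tr g) D \<gamma>"
    and g: "g \<in> carrier G" and D: "D \<subseteq> I" "y \<in> D" "\<And>x. x \<in> D \<Longrightarrow> y \<le> x"
  shows "leads_pos M {a..rho a} (tr g) D \<gamma>" "germ g a y 1" "g \<doteq> k \<otimes> h" "rigid D"
    "d \<in> D \<Longrightarrow> (\<And>x. x \<in> D \<Longrightarrow> x \<le> d) \<Longrightarrow> germ g (rho a) d 1"
proof -
  obtain K \<mu> where lw: "leads_wrt M {a..rho a} (tr g) D \<gamma> K \<mu>" using lead unfolding leads_def by blast
  hence ad: "analytic_diffeo K D \<mu>" by (simp add: leads_wrt_def)
  have le: "a \<le> rho a" using rho_greater[OF a] by simp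
  note cell = leads_cell_min[OF lw g I_rho[OF a] le D(1,2)]
  have kh: "germ (k \<otimes> h) a y 1" using germ_mult[OF germ_rho[OF a] k] by simp
  have "\<not> strict_antimono_on K \<mu>"
    using germ_ends_not_reversed[OF a kh] cell(2) D(3) by blast
  hence m: "strict_mono_on K \<mu>" using analytic_diffeo_strict_mono(2)[OF ad] by blast
  show "leads_pos M {a..rho a} (tr g) D \<gamma>" using lw m unfolding leads_pos_def by blast
  show ga: "germ g a y 1" using cell(1)[OF D(3) m] by simp
  show "g \<doteq> k \<otimes> h" by (rule germ_same_translate[OF a ga kh])
  show "rigid D" by (rule leads_cell_rigid[OF lw m g I_rho[OF a] D(1) rigid_rho[OF a]])
  show "germ g (rho a) d 1" if "d \<in> D" "\<And>x. x \<in> D \<Longrightarrow> x \<le> d"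
    using cell(3)[OF D(3) m that(1)] that(2) by simp
qed

lemma leads_next_left:
  assumes a: "a \<in> dom" and k: "germ k a y 1" and lead: "leads M {a..rho a} (tr g) D \<gamma>"
    and g: "g \<in> carrier G" and D: "D \<subseteq> I" "y \<in> D" "\<And>x. x \<in> D \<Longrightarrow> x \<le> y"
  shows "leads_pos M {a..rho a} (tr g) D \<gamma>" "germ g (rho a) y 1" "g \<doteq> k \<otimes> inv h" "rigid D"
    "d \<in> D \<Longrightarrow> (\<And>x. x \<in> D \<Longrightarrow> d \<le> x) \<Longrightarrow> germ g a d 1"
proof -
  obtain K \<mu> where lw: "leads_wrt M {a..rho a} (tr g) D \<gamma> K \<mu>" using lead unfolding leads_def by blast
  hence ad: "analytic_diffeo K D \<mu>" by (simp add: leads_wrt_def)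
  have le: "a \<le> rho a" using rho_greater[OF a] by simp
  note cell = leads_cell_max[OF lw g I_rho[OF a] le D(1,2)]
  have kh: "germ (k \<otimes> inv h) (rho a) y 1" using germ_mult[OF germ_inv[OF germ_rho[OF a]] k] by simp
  have "\<not> strict_antimono_on K \<mu>"
    using germ_ends_not_reversed'[OF a kh] cell(2) D(3) by blast
  hence m: "strict_mono_on K \<mu>" using analytic_diffeo_strict_mono(2)[OF ad] by blast
  show "leads_pos M {a..rho a} (tr g) D \<gamma>" using lw m unfolding leads_pos_def by blast
  show gb: "germ g (rho a) y 1" using cell(1)[OF D(3) m] by simp
  show "g \<doteq> k \<otimes> inv h" by (rule germ_same_translate'[OF a gb kh])
  show "rigid D" by (rule leads_cell_rigid[OF lw m g I_rho[OF a] D(1) rigid_rho[OF a]])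
  show "germ g a d 1" if "d \<in> D" "\<And>x. x \<in> D \<Longrightarrow> d \<le> x"
    using cell(3)[OF D(3) m that(1)] that(2) by simp
qed

lemma power_quotient:
  assumes "g \<doteq> h [^] (i::int)" "k \<doteq> h [^] (j::int)" "germ k x y e"
  shows "g \<otimes> inv k \<doteq> h [^] (i - j)"
proof -
  have c: "g \<in> carrier G" "k \<in> carrier G" using assms by (auto simp: same_translate_def)
  have "g \<otimes> inv k \<doteq> h [^] i \<otimes> inv k" by (rule same_translate_mult_right[OF assms(1) germ_inv[OF assms(3)]])
  moreover have "h [^] i \<otimes> inv k \<doteq> h [^] i \<otimes> inv (h [^] j)"
    using same_translate_inv[OF assms(2,3)] h_carrier by (intro same_translate_mult_left) auto
  ultimately show ?thesis using same_translate_trans int_pow_diff[OF h_carrier] by metis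
qed

text \<open>Powers of h commute with h, and the germ of g allows multiplication by
  \<open>inv g\<close> from the right.\<close>

lemma conjugate_h:
  assumes g: "g \<doteq> h [^] (i::int)" and germ: "germ g x y e"
  shows "g \<otimes> h \<otimes> inv g \<doteq> h"
proof -
  have c: "g \<in> carrier G" using g by (simp add: same_translate_def)
  have "g \<otimes> h \<doteq> h [^] i \<otimes> h" by (rule same_translate_mult_right[OF g germ_h])
  also have "h [^] i \<otimes> h = h [^] (i + 1)" using int_pow_mult[OF h_carrier, of i 1] h_carrier by simp
  also have "\<dots> = h \<otimes> h [^] i" using int_pow_mult[OF h_carrier, of 1 i] h_carrier by (simp add: add.commute)
  finally have "g \<otimes> h \<doteq> h \<otimes> h [^] i" .
  moreover have "h \<otimes> h [^] i \<doteq> h \<otimes> g"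
    by (rule same_translate_mult_left[OF same_translate_sym[OF g] h_carrier])
  ultimately have "g \<otimes> h \<doteq> h \<otimes> g" by (rule same_translate_trans)
  from same_translate_mult_right[OF this germ_inv[OF germ]] show ?thesis
    using c h_carrier by (simp add: m_assoc)
qed

section \<open>Moving interior points into the neighbouring cell\<close>

lemma interior_neighbours:
  fixes x :: real
  assumes "x \<in> interior D"
  obtains u v where "u \<in> D" "v \<in> D" "u < x" "x < v"
proof -
  obtain r where r: "r > 0" "ball x r \<subseteq> D" using assms by (meson interior_subset openE open_interior subset_trans)
  have "x - r/2 \<in> D" "x + r/2 \<in> D"
    by (rule subsetD[OF r(2)], use r(1) in \<open>simp add: dist_real_def\<close>)+
  with r(1) show ?thesis by (intro that[of "x - r/2" "x + r/2"]) auto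
qed

text \<open>If rho b' \<le> y, the germ of h at b' could be shifted into the interior of a
  subinterval [u, y] of the free D; if rho b' \<ge> z, the germ of h from y to z could be shifted
  into the interior of the free interval [b', rho b']. Both would put h into the stabilizer.\<close>

lemma next_cell:
  assumes rig: "rigid D" and D: "real_interval D" "D \<subseteq> I" "y \<in> D" "\<And>x. x \<in> D \<Longrightarrow> x \<le> y" and y: "y \<in> dom"
    and z: "germ h y z 1" "y < z" and b': "b' \<in> interior D"
  shows "b' \<in> dom" "y < rho b'" "rho b' < z"
proof -
  obtain u v where uv: "u \<in> D" "v \<in> D" "u < b'" "b' < v" using interior_neighbours[OF b'] .
  have lt_y: "b' < y" using D(4)[OF uv(2)] uv(4) by simp
  have "b' \<in> I" using b' interior_subset D(2) by blast
  thus bd: "b' \<in> dom" using dom_downward[OF y] lt_y by simp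
  have "{u..y} \<subseteq> D"
    by (rule real_interval_segment[OF D(1) uv(1) D(3)])
  hence rigD: "rigid {u..y}" by (rule rigid_subset[OF rig])
  show "y < rho b'"
  proof (rule ccontr)
    assume "\<not> y < rho b'"
    have "h \<in> stab"
      by (rule rigid_germ_closed[OF rigD germ_rho[OF bd], of "-1"]) (use uv lt_y \<open>\<not> y < rho b'\<close> rho_greater[OF bd] in auto)
    with h_notin show False ..
  qed
  show "rho b' < z"
  proof (rule ccontr)
    assume "\<not> rho b' < z"
    have "h \<in> stab"
      by (rule rigid_germ_closed[OF rigid_rho[OF bd] z(1), of "-1"]) (use lt_y z(2) \<open>\<not> rho b' < z\<close> in auto)
    with h_notin show False ..
  qed
qed

lemma previous_cell:
  assumes rig: "rigid D" and D: "real_interval D" "D \<subseteq> I" "y \<in> D" "\<And>x. x \<in> D \<Longrightarrow> y \<le> x" and y: "y \<in> ran"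
    and x: "germ h x y 1" "x < y" and b: "b \<in> interior D"
  shows "b \<in> ran" "x < sigma b" "sigma b < y"
proof -
  obtain u v where uv: "u \<in> D" "v \<in> D" "u < b" "b < v" using interior_neighbours[OF b] .
  have yb: "y < b" using D(4)[OF uv(1)] uv(3) by simp
  have "b \<in> I" using b interior_subset D(2) by blast
  thus br: "b \<in> ran" using ran_upward[OF y] yb by simp
  define t where "t = sigma b"
  have t: "t \<in> dom" "rho t = b" using sigma_dom[OF br] rho_sigma[OF br] by (auto simp: t_def)
  have gt: "germ h t b 1" using germ_rho[OF t(1)] t(2) by simp
  have "{y..v} \<subseteq> D"
    by (rule real_interval_segment[OF D(1) D(3) uv(2)])
  hence rigD: "rigid {y..v}" by (rule rigid_subset[OF rig])
  have "t < y"
  proof (rule ccontr)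
    assume "\<not> t < y"
    have "h \<in> stab"
      by (rule rigid_germ_closed[OF rigD gt, of 1]) (use uv yb \<open>\<not> t < y\<close> rho_greater[OF t(1)] t(2) in auto)
    with h_notin show False ..
  qed
  thus "sigma b < y" by (simp add: t_def)
  have "x < t"
  proof (rule ccontr)
    assume "\<not> x < t"
    have "h \<in> stab"
      by (rule rigid_germ_closed[OF rigid_rho[OF t(1)] x(1), of 1]) (use yb x(2) t(2) \<open>\<not> x < t\<close> in auto)
    with h_notin show False ..
  qed
  thus "x < sigma b" by (simp add: t_def)
qed

section \<open>Analysis of a decomposition\<close>

context
  fixes a l u \<alpha> g
  assumes a: "a \<in> dom" and dec: "decomposition G M \<phi> I \<gamma> {a..rho a} l u \<alpha> g"
begin

abbreviation "N \<equiv> dec_index l u"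
abbreviation "cell \<equiv> dec_interval I l u \<alpha>"

lemma l_neg: "l < Fin 0" and u_pos: "Fin 0 < u" and alpha_I: "n \<in> N \<Longrightarrow> \<alpha> n \<in> I"
  and alpha_less: "m \<in> N \<Longrightarrow> n \<in> N \<Longrightarrow> m < n \<Longrightarrow> \<alpha> m < \<alpha> n"
  and g_carrier: "n \<in> N \<Longrightarrow> g n \<in> carrier G"
  and cell_0: "cell 0 = {a..rho a}"
  and leads_cell: "n \<in> N \<Longrightarrow> leads M {a..rho a} (tr (g n)) (cell n) \<gamma>"
  using dec unfolding decomposition_def by (auto dest: strict_mono_onD)

lemma index_iff: "n \<in> N \<longleftrightarrow> n \<noteq> 0 \<and> l \<le> Fin n \<and> Fin n \<le> u"
  by (simp add: dec_index_def)

lemma pos_index: "n > 0 \<Longrightarrow> Fin n \<le> u \<Longrightarrow> n \<in> N"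
  using l_neg by (cases l) (auto simp: dec_index_def)

lemma neg_index: "n < 0 \<Longrightarrow> l \<le> Fin n \<Longrightarrow> n \<in> N"
  using u_pos by (cases u) (auto simp: dec_index_def)

lemma index_1: "1 \<in> N" and index_minus_1: "- 1 \<in> N"
  using pos_index[of 1] Fin_Suc_le[OF u_pos] neg_index[of "- 1"] Fin_pred_ge[OF l_neg] by auto

lemma alpha_1: "\<alpha> 1 = rho a" and alpha_minus_1: "\<alpha> (- 1) = a"
proof -
  have "{\<alpha> (- 1)..\<alpha> 1} = {a..rho a}" using cell_0 by (simp add: dec_interval_def)
  thus "\<alpha> 1 = rho a" "\<alpha> (- 1) = a" using rho_greater[OF a] by (auto simp: Icc_eq_Icc)
qed

lemma cell_pos_last: "n > 0 \<Longrightarrow> Fin n = u \<Longrightarrow> cell n = {t \<in> I. \<alpha> n \<le> t}"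
  using l_neg by (auto simp: dec_interval_def)

lemma cell_pos: "n > 0 \<Longrightarrow> Fin n < u \<Longrightarrow> cell n = {\<alpha> n..\<alpha> (n + 1)}"
  using l_neg by (auto simp: dec_interval_def)

lemma cell_neg_last: "n < 0 \<Longrightarrow> Fin n = l \<Longrightarrow> cell n = {t \<in> I. t \<le> \<alpha> n}"
  by (auto simp: dec_interval_def)

lemma cell_neg: "n < 0 \<Longrightarrow> l < Fin n \<Longrightarrow> cell n = {\<alpha> (n - 1)..\<alpha> n}"
  using u_pos by (auto simp: dec_interval_def)

lemma pos_next: "n > 0 \<Longrightarrow> Fin n < u \<Longrightarrow> n \<in> N \<and> n + 1 \<in> N \<and> \<alpha> n < \<alpha> (n + 1)"
  using pos_index[of n] pos_index[of "n + 1"] Fin_Suc_le[of n u] alpha_less[of n "n + 1"] by auto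

lemma neg_next: "n < 0 \<Longrightarrow> l < Fin n \<Longrightarrow> n \<in> N \<and> n - 1 \<in> N \<and> \<alpha> (n - 1) < \<alpha> n"
  using neg_index[of n] neg_index[of "n - 1"] Fin_pred_ge[of l n] alpha_less[of "n - 1" n] by auto

lemma cell_pos_min:
  assumes n: "n > 0" "n \<in> N"
  shows "cell n \<subseteq> I" "\<alpha> n \<in> cell n" "\<And>x. x \<in> cell n \<Longrightarrow> \<alpha> n \<le> x"
proof -
  have "Fin n = u \<or> Fin n < u" using n(2) by (auto simp: index_iff le_less)
  hence "cell n \<subseteq> I \<and> \<alpha> n \<in> cell n \<and> (\<forall>x\<in>cell n. \<alpha> n \<le> x)"
  proof
    assume "Fin n = u"
    from cell_pos_last[OF n(1) this] alpha_I[OF n(2)] show ?thesis by auto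
  next
    assume u: "Fin n < u"
    note nx = pos_next[OF n(1) u]
    show ?thesis unfolding cell_pos[OF n(1) u]
      using I_segment[OF alpha_I[OF n(2)] alpha_I[of "n + 1"]] nx by auto
  qed
  thus "cell n \<subseteq> I" "\<alpha> n \<in> cell n" "\<And>x. x \<in> cell n \<Longrightarrow> \<alpha> n \<le> x" by auto
qed

lemma cell_neg_max:
  assumes n: "n < 0" "n \<in> N"
  shows "cell n \<subseteq> I" "\<alpha> n \<in> cell n" "\<And>x. x \<in> cell n \<Longrightarrow> x \<le> \<alpha> n"
proof -
  have "Fin n = l \<or> l < Fin n" using n(2) by (auto simp: index_iff le_less)
  hence "cell n \<subseteq> I \<and> \<alpha> n \<in> cell n \<and> (\<forall>x\<in>cell n. x \<le> \<alpha> n)"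
  proof
    assume "Fin n = l"
    from cell_neg_last[OF n(1) this] alpha_I[OF n(2)] show ?thesis by auto
  next
    assume u: "l < Fin n"
    note nx = neg_next[OF n(1) u]
    show ?thesis unfolding cell_neg[OF n(1) u]
      using I_segment[OF alpha_I[of "n - 1"] alpha_I[OF n(2)]] nx by auto
  qed
  thus "cell n \<subseteq> I" "\<alpha> n \<in> cell n" "\<And>x. x \<in> cell n \<Longrightarrow> x \<le> \<alpha> n" by auto
qed

lemma cell_real_interval: "n \<in> N \<Longrightarrow> real_interval (cell n)"
  using leads_cell[of n] analytic_diffeo_strict_mono(4) unfolding leads_def leads_wrt_def by blast

text \<open>The invariant of the induction over the cells to the right. Its last clause provides the
  germ at the common end point from which the next cell is treated.\<close>

definition right_ok :: "int \<Rightarrow> bool" where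
  "right_ok n \<longleftrightarrow> leads_pos M {a..rho a} (tr (g n)) (cell n) \<gamma> \<and> germ (g n) a (\<alpha> n) 1 \<and>
     g n \<doteq> h [^] n \<and> rigid (cell n) \<and> (Fin n < u \<longrightarrow> germ (g n) (rho a) (\<alpha> (n + 1)) 1)"

definition left_ok :: "int \<Rightarrow> bool" where
  "left_ok n \<longleftrightarrow> leads_pos M {a..rho a} (tr (g n)) (cell n) \<gamma> \<and> germ (g n) (rho a) (\<alpha> n) 1 \<and>
     g n \<doteq> h [^] n \<and> rigid (cell n) \<and> (l < Fin n \<longrightarrow> germ (g n) a (\<alpha> (n - 1)) 1)"

text \<open>The element k is that of the preceding cell; for the first cell it is the unit, which
  belongs to cell 0.\<close>

lemma right_okI:
  assumes n: "n > 0" "n \<in> N" and k: "germ k (rho a) (\<alpha> n) 1" "k \<doteq> h [^] (n - 1)"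
  shows "right_ok n"
proof -
  note c = cell_pos_min[OF n]
  note nr = leads_next_right[OF a k(1) leads_cell[OF n(2)] g_carrier[OF n(2)] c(1,2)]
  have "k \<otimes> h \<doteq> h [^] (n - 1) \<otimes> h" by (rule same_translate_mult_right[OF k(2) germ_h])
  also have "h [^] (n - 1) \<otimes> h = h [^] n" using int_pow_mult[OF h_carrier, of "n - 1" 1] h_carrier by simp
  finally have "g n \<doteq> h [^] n" using nr(3)[OF c(3)] same_translate_trans by blast
  moreover have "germ (g n) (rho a) (\<alpha> (n + 1)) 1" if u: "Fin n < u"
    by (rule nr(5)[OF c(3)]) (use cell_pos[OF n(1) u] pos_next[OF n(1) u] in auto)
  ultimately show ?thesis unfolding right_ok_def using nr(1,2,4)[OF c(3)] by blast
qed

lemma left_okI: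
  assumes n: "n < 0" "n \<in> N" and k: "germ k a (\<alpha> n) 1" "k \<doteq> h [^] (n + 1)"
  shows "left_ok n"
proof -
  note c = cell_neg_max[OF n]
  note nr = leads_next_left[OF a k(1) leads_cell[OF n(2)] g_carrier[OF n(2)] c(1,2)]
  have "k \<otimes> inv h \<doteq> h [^] (n + 1) \<otimes> inv h" by (rule same_translate_mult_right[OF k(2) germ_inv[OF germ_h]])
  also have "h [^] (n + 1) \<otimes> inv h = h [^] n" using int_pow_diff[OF h_carrier, of "n + 1" 1] h_carrier by simp
  finally have "g n \<doteq> h [^] n" using nr(3)[OF c(3)] same_translate_trans by blast
  moreover have "germ (g n) a (\<alpha> (n - 1)) 1" if u: "l < Fin n"
    by (rule nr(5)[OF c(3)]) (use cell_neg[OF n(1) u] neg_next[OF n(1) u] in auto)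
  ultimately show ?thesis unfolding left_ok_def using nr(1,2,4)[OF c(3)] by blast
qed

lemma right_cells: "n > 0 \<Longrightarrow> n \<in> N \<Longrightarrow> right_ok n"
proof (induction n rule: int_gr_induct[where k=0])
  case base
  have "rho a \<in> I" using I_rho[OF a] rho_greater[OF a] by auto
  thus ?case using right_okI[OF _ base, of \<one>] germ_one[of "rho a"] same_translate_refl[OF one_closed] alpha_1 by simp
next
  case (step i)
  have u: "Fin i < u" using step.prems by (cases u) (auto simp: dec_index_def)
  have "i \<in> N" using pos_next[OF step.hyps(1) u] by blast
  from step.IH[OF this] u have "germ (g i) (rho a) (\<alpha> (i + 1)) 1" "g i \<doteq> h [^] i" by (auto simp: right_ok_def)
  thus ?case using right_okI[OF _ step.prems, of "g i"] step.hyps by simp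
qed

lemma left_cells: "n < 0 \<Longrightarrow> n \<in> N \<Longrightarrow> left_ok n"
proof (induction n rule: int_less_induct[where k=0])
  case base
  have "a \<in> I" using dom_I[OF a] .
  thus ?case using left_okI[OF _ base, of \<one>] germ_one[of a] same_translate_refl[OF one_closed] alpha_minus_1 by simp
next
  case (step i)
  have u: "l < Fin i" using step.prems by (cases l) (auto simp: dec_index_def)
  have "i \<in> N" using neg_next[OF step.hyps(1) u] by blast
  from step.IH[OF this] u have "germ (g i) a (\<alpha> (i - 1)) 1" "g i \<doteq> h [^] i" by (auto simp: left_ok_def)
  thus ?case using left_okI[OF _ step.prems, of "g i"] step.hyps by simp
qed

lemma index_cases: "n \<in> N \<Longrightarrow> right_ok n \<and> n > 0 \<or> left_ok n \<and> n < 0"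
  using right_cells[of n] left_cells[of n] by (auto simp: dec_index_def) (meson linorder_neqE_linordered_idom)+

lemma decomposition_class: "n \<in> N \<Longrightarrow> g n \<doteq> h [^] n"
  using index_cases[of n] by (auto simp: right_ok_def left_ok_def)

lemma decomposition_leads_pos: "n \<in> N \<Longrightarrow> leads_pos M {a..rho a} (tr (g n)) (cell n) \<gamma>"
  using index_cases[of n] by (auto simp: right_ok_def left_ok_def)

lemma decomposition_germ: "n \<in> N \<Longrightarrow> \<exists>x y. germ (g n) x y 1"
  using index_cases[of n] by (auto simp: right_ok_def left_ok_def)

lemma decomposition_rigid: "n \<in> N \<Longrightarrow> rigid (cell n)"
  using index_cases[of n] by (auto simp: right_ok_def left_ok_def)

lemma decomposition_step:
  assumes n: "n \<in> N" shows "dec_step G g n \<doteq> h [^] sgn n"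
proof -
  consider "n = 1" | "n = - 1" | "n > 1" | "n < - 1" using n by (force simp: index_iff)
  thus ?thesis
  proof cases
    case 1 thus ?thesis using decomposition_class[OF n] by (simp add: dec_step_def)
  next
    case 2 thus ?thesis using decomposition_class[OF n] by (simp add: dec_step_def)
  next
    case 3
    have "Fin (n - 1) \<le> u" using n by (cases u) (auto simp: dec_index_def)
    hence m: "n - 1 \<in> N" using 3 by (intro pos_index) auto
    obtain x y where "germ (g (n - 1)) x y 1" using decomposition_germ[OF m] by blast
    from power_quotient[OF decomposition_class[OF n] decomposition_class[OF m] this]
    show ?thesis using 3 by (simp add: dec_step_def)
  next
    case 4
    have "l \<le> Fin (n + 1)" using n by (cases l) (auto simp: dec_index_def)
    hence m: "n + 1 \<in> N" using 4 by (intro neg_index) auto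
    obtain x y where "germ (g (n + 1)) x y 1" using decomposition_germ[OF m] by blast
    from power_quotient[OF decomposition_class[OF n] decomposition_class[OF m] this]
    show ?thesis using 4 by (simp add: dec_step_def)
  qed
qed

text \<open>Conjugation by \<open>g n\<close> moves the germ of h from [a, rho a] into the cell, and
  by \<open>conjugate_h\<close> the conjugate acts on \<gamma> as h itself.\<close>

lemma germ_h_cell:
  assumes n: "n \<in> N" and x: "germ (g n) a x 1" and y: "germ (g n) (rho a) y 1"
  shows "germ h x y 1"
proof -
  have "germ (g n \<otimes> (h \<otimes> inv (g n))) x y 1" using germ_mult[OF germ_mult[OF germ_inv[OF x] germ_rho[OF a]] y] by simp
  moreover have "g n \<otimes> (h \<otimes> inv (g n)) \<doteq> h"
    using conjugate_h[OF decomposition_class[OF n] x] g_carrier[OF n] h_carrier by (simp add: m_assoc)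
  ultimately show ?thesis using germ_cong by blast
qed

lemma shift_from_left:
  assumes n: "l < Fin n" "n \<le> 0" and b': "b' \<in> interior (cell (n - 1))"
  shows "b' \<in> dom \<and> rho b' \<in> interior (cell n)"
proof -
  have m: "n - 1 < 0" "n - 1 \<in> N" using n(2) neg_index[OF _ Fin_pred_ge[OF n(1)]] by auto
  note c = cell_neg_max[OF m]
  have le: "\<alpha> (n - 1) \<le> a" using alpha_less[OF m(2) index_minus_1] alpha_minus_1 n(2) by (cases "n = 0") auto
  have yd: "\<alpha> (n - 1) \<in> dom" by (rule dom_downward[OF a alpha_I[OF m(2)] le])
  \<comment> \<open>Cell n starts at \<open>\<alpha> (n - 1)\<close> also for n = 0: there is no
    index 0, and cell 0 runs from \<open>\<alpha> (- 1)\<close> to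
    \<open>\<alpha> 1\<close>.\<close>
  have "\<exists>z. cell n = {\<alpha> (n - 1)..z} \<and> germ h (\<alpha> (n - 1)) z 1 \<and> \<alpha> (n - 1) < z"
  proof (cases "n = 0")
    case True
    thus ?thesis using cell_0 alpha_minus_1 germ_rho[OF a] rho_greater[OF a] by auto
  next
    case False
    hence neg: "n < 0" using n(2) by simp
    note nx = neg_next[OF neg n(1)]
    have "left_ok n" using left_cells[OF neg] nx by blast
    hence "germ h (\<alpha> (n - 1)) (\<alpha> n) 1" using germ_h_cell[of n] nx n(1) by (auto simp: left_ok_def)
    thus ?thesis using cell_neg[OF neg n(1)] nx by auto
  qed
  then obtain z where z: "cell n = {\<alpha> (n - 1)..z}" "germ h (\<alpha> (n - 1)) z 1" "\<alpha> (n - 1) < z" by blast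
  from next_cell[OF decomposition_rigid[OF m(2)] cell_real_interval[OF m(2)] c(1,2) c(3) yd z(2,3) b']
  show ?thesis using z(1) by simp
qed

lemma shift_from_right:
  assumes n: "0 \<le> n" "Fin n < u" and b: "b \<in> interior (cell (n + 1))"
  shows "b \<in> ran \<and> sigma b \<in> interior (cell n)"
proof -
  have m: "n + 1 > 0" "n + 1 \<in> N" using n(1) pos_index[OF _ Fin_Suc_le[OF n(2)]] by auto
  note c = cell_pos_min[OF m]
  have le: "rho a \<le> \<alpha> (n + 1)" using alpha_less[OF index_1 m(2)] alpha_1 n(1) by (cases "n = 0") auto
  have yr: "\<alpha> (n + 1) \<in> ran" by (rule ran_upward[OF rho_ran[OF a] alpha_I[OF m(2)] le])
  have "\<exists>x. cell n = {x..\<alpha> (n + 1)} \<and> germ h x (\<alpha> (n + 1)) 1 \<and> x < \<alpha> (n + 1)"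
  proof (cases "n = 0")
    case True
    thus ?thesis using cell_0 alpha_1 germ_rho[OF a] rho_greater[OF a] by auto
  next
    case False
    hence pos: "n > 0" using n(1) by simp
    note nx = pos_next[OF pos n(2)]
    have "right_ok n" using right_cells[OF pos] nx by blast
    hence "germ h (\<alpha> n) (\<alpha> (n + 1)) 1" using germ_h_cell[of n] nx n(2) by (auto simp: right_ok_def)
    thus ?thesis using cell_pos[OF pos n(2)] nx by auto
  qed
  then obtain x where x: "cell n = {x..\<alpha> (n + 1)}" "germ h x (\<alpha> (n + 1)) 1" "x < \<alpha> (n + 1)" by blast
  from previous_cell[OF decomposition_rigid[OF m(2)] cell_real_interval[OF m(2)] c(1,2) c(3) yr x(2,3) b]
  show ?thesis using x(1) by simp
qed

end

end

section \<open>Construction of positive intervals\<close>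

lemma real_intervalI:
  assumes K: "is_interval K" and x: "x \<in> K" "y \<in> K" "x < y"
  shows "real_interval (K :: real set)"
proof -
  have "{x<..<y} \<subseteq> K" using K x unfolding is_interval_1 subset_eq Ball_def greaterThanLessThan_iff by (meson less_imp_le)
  hence "{x<..<y} \<subseteq> interior K" by (intro interior_maximal) auto
  moreover have "{x<..<y} \<noteq> {}" using x(3) by simp
  ultimately show ?thesis using K unfolding real_interval_def is_interval_connected_1 by blast
qed

text \<open>A finite u will be the index of the outermost cell, where one more step is impossible;
  \<open>Pinf\<close> records that no step ever fails.\<close>

lemma first_failure:
  assumes "P (0::nat)"
  obtains u where "Fin 0 < u" "\<And>n. Fin (int n) < u \<Longrightarrow> P n" "\<And>n. Fin (int n) = u \<Longrightarrow> \<not> P n"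
proof (cases "\<forall>n. P n")
  case True
  show ?thesis by (rule that[of Pinf]) (use True in auto)
next
  case False
  define m where "m = (LEAST n. \<not> P n)"
  have m: "\<not> P m" "\<And>n. n < m \<Longrightarrow> P n"
    unfolding m_def using False LeastI_ex[of "\<lambda>n. \<not> P n"] not_less_Least by blast+
  have "m \<noteq> 0" using m(1) assms by metis
  thus ?thesis by (intro that[of "Fin (int m)"]) (use m in auto)
qed

lemma first_failure_negative:
  assumes "P (0::nat)"
  obtains l where "l < Fin 0" "\<And>n. l < Fin (- int n) \<Longrightarrow> P n" "\<And>n. Fin (- int n) = l \<Longrightarrow> \<not> P n"
proof (cases "\<forall>n. P n")
  case True
  show ?thesis by (rule that[of Minf]) (use True in auto)
next
  case False
  define m where "m = (LEAST n. \<not> P n)"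
  have m: "\<not> P m" "\<And>n. n < m \<Longrightarrow> P n"
    unfolding m_def using False LeastI_ex[of "\<lambda>n. \<not> P n"] not_less_Least by blast+
  have "m \<noteq> 0" using m(1) assms by metis
  thus ?thesis by (intro that[of "Fin (- int m)"]) (use m in auto)
qed

context acted_curve
begin

lemma lift_is_interval: "lift g e D \<rho> \<Longrightarrow> is_interval D"
  by (simp add: lift_def is_interval_connected_1)

lemma lift_le: "lift g 1 D \<rho> \<Longrightarrow> x \<in> D \<Longrightarrow> y \<in> D \<Longrightarrow> x \<le> y \<Longrightarrow> \<rho> x \<le> \<rho> y"
  using lift_less[of g D \<rho> x y] by (cases "x = y") auto

text \<open>Monotonicity of \<mu> keeps the restricted domain an interval.\<close>

lemma lift_compose:
  assumes l: "lift g 1 E \<mu>" and k: "lift k 1 D f"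
  shows "lift (k \<otimes> g) 1 {x \<in> E. \<mu> x \<in> D} (\<lambda>x. f (\<mu> x))"
proof -
  have E: "open E" "continuous_on E \<mu>" and D: "open D" "continuous_on D f"
    using l k by (auto simp: lift_def)
  have eq: "{x \<in> E. \<mu> x \<in> D} = E \<inter> \<mu> -` D" by auto
  have "open {x \<in> E. \<mu> x \<in> D}" unfolding eq by (rule continuous_open_preimage[OF E(2,1) D(1)])
  moreover have "is_interval {x \<in> E. \<mu> x \<in> D}"
    unfolding is_interval_1
  proof (intro ballI allI impI)
    fix x y t assume x: "x \<in> {x \<in> E. \<mu> x \<in> D}" and y: "y \<in> {x \<in> E. \<mu> x \<in> D}" and t: "x \<le> t \<and> t \<le> y"
    have tE: "t \<in> E" using lift_interval[OF l, of x y t] x y t by simp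
    have "\<mu> x \<le> \<mu> t" "\<mu> t \<le> \<mu> y" using lift_le[OF l] x y t tE by auto
    hence "\<mu> t \<in> D" using lift_interval[OF k, of "\<mu> x" "\<mu> y"] x y by simp
    with tE show "t \<in> {x \<in> E. \<mu> x \<in> D}" by simp
  qed
  hence "connected {x \<in> E. \<mu> x \<in> D}" by (simp add: is_interval_connected_1)
  moreover have "continuous_on {x \<in> E. \<mu> x \<in> D} (\<lambda>x. f (\<mu> x))"
    by (rule continuous_on_compose2[OF D(2) continuous_on_subset[OF E(2)]]) auto
  moreover have "germ (k \<otimes> g) x (f (\<mu> x)) 1" if "x \<in> {x \<in> E. \<mu> x \<in> D}" for x
    using germ_mult[OF lift_germ[OF l] lift_germ[OF k], of x] that by simp
  ultimately show ?thesis unfolding lift_def by blast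
qed

text \<open>The power of k is continued over the whole segment from x to f x, not only at x. The
  form \<open>closed_segment\<close> covers both f = rho, which moves to the right, and f = sigma,
  which moves to the left.\<close>

lemma lift_iterate_segment:
  assumes k: "lift k 1 D f" and c: "k \<in> carrier G" and m: "\<And>j. j \<le> m \<Longrightarrow> (f ^^ j) x \<in> D"
  shows "\<exists>E \<mu>. lift (k [^] m) 1 E \<mu> \<and> closed_segment x (f x) \<subseteq> E \<and> \<mu> x = (f ^^ m) x \<and> \<mu> (f x) = (f ^^ Suc m) x"
  using m
proof (induction m)
  case 0
  hence "x \<in> D" using 0[of 0] by simp
  hence "x \<in> I" "f x \<in> I" using lift_subset_I[OF k] lift_in_I[OF k] by auto
  hence "closed_segment x (f x) \<subseteq> I"
    using is_interval_I by (meson closed_segment_subset is_interval_convex)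
  thus ?case using lift_identity by (intro exI[of _ I] exI[of _ "\<lambda>t. t"]) simp
next
  case (Suc m)
  then obtain E \<mu> where E: "lift (k [^] m) 1 E \<mu>" "closed_segment x (f x) \<subseteq> E"
    "\<mu> x = (f ^^ m) x" "\<mu> (f x) = (f ^^ Suc m) x" by (auto dest: le_SucI)
  define E' where "E' = {x \<in> E. \<mu> x \<in> D}"
  have l: "lift (k \<otimes> k [^] m) 1 E' (\<lambda>x. f (\<mu> x))" unfolding E'_def by (rule lift_compose[OF E(1) k])
  have "(f ^^ m) x \<in> D" "(f ^^ Suc m) x \<in> D" using Suc.prems[of m] Suc.prems[of "Suc m"] by auto
  hence "x \<in> E'" "f x \<in> E'" using E(2-4) by (auto simp: E'_def)
  hence "closed_segment x (f x) \<subseteq> E'"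
    using lift_is_interval[OF l] by (meson closed_segment_subset is_interval_convex)
  moreover have "k \<otimes> k [^] m = k [^] Suc m" using nat_pow_Suc2[OF c] by metis
  ultimately show ?case using l E(3,4) by (intro exI[of _ E'] exI[of _ "\<lambda>x. f (\<mu> x)"]) simp
qed

lemma lift_image_segment:
  assumes l: "lift g 1 E \<mu>" and ab: "{a..b} \<subseteq> E" "a \<le> b"
  shows "\<mu> ` {a..b} = {\<mu> a..\<mu> b}"
proof (intro equalityI subsetI)
  fix y assume "y \<in> \<mu> ` {a..b}"
  then obtain x where x: "a \<le> x" "x \<le> b" "y = \<mu> x" by auto
  have E: "a \<in> E" "b \<in> E" "x \<in> E" by (rule subsetD[OF ab(1)], use ab(2) x in simp)+
  show "y \<in> {\<mu> a..\<mu> b}" using lift_le[OF l E(1,3) x(1)] lift_le[OF l E(3,2) x(2)] x(3) by simp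
next
  fix y assume "y \<in> {\<mu> a..\<mu> b}"
  moreover have "continuous_on {a..b} \<mu>" using l ab(1) by (auto simp: lift_def intro: continuous_on_subset)
  ultimately have "\<exists>x. a \<le> x \<and> x \<le> b \<and> \<mu> x = y" by (intro IVT' ab(2)) auto
  thus "y \<in> \<mu> ` {a..b}" by auto
qed

lemma lift_analytic_diffeo:
  assumes l: "lift g 1 E \<mu>" and K: "K \<subseteq> E" "real_interval K"
  shows "analytic_diffeo K (\<mu> ` K) \<mu>"
proof -
  have inj: "inj_on \<mu> E" by (rule lift_inj[OF l])
  note linv = lift_inverse[OF l]
  have ri: "real_interval (\<mu> ` K)" "open_interval E" "open_interval (\<mu> ` E)"
  proof -
    have "interior K \<noteq> {}" using K(2) by (simp add: real_interval_def)
    moreover have op: "open (\<mu> ` U)" if "open U" "U \<subseteq> E" for U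
      using l inj that by (intro injective_into_1d_imp_open_map_UNIV[of U E]) (auto simp: lift_def)
    have "open (\<mu> ` interior K)" using op[of "interior K"] K(1) interior_subset by blast
    hence "\<mu> ` interior K \<subseteq> interior (\<mu> ` K)" using interior_subset by (intro interior_maximal) blast+
    ultimately have "interior (\<mu> ` K) \<noteq> {}" by blast
    moreover have "continuous_on K \<mu>" using l K(1) by (auto simp: lift_def intro: continuous_on_subset)
    hence "connected (\<mu> ` K)" using K(2) by (intro connected_continuous_image) (auto simp: real_interval_def)
    ultimately show "real_interval (\<mu> ` K)" by (simp add: real_interval_def)
    have "K \<noteq> {}" using K(2) by (auto simp: real_interval_def)
    hence "E \<noteq> {}" using K(1) by auto
    thus "open_interval E" "open_interval (\<mu> ` E)"
      using l linv unfolding open_interval_def real_interval_def lift_def by (simp_all add: interior_open)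
  qed
  have b: "bij_betw \<mu> E (\<mu> ` E)" "bij_betw \<mu> K (\<mu> ` K)"
    using inj inj_on_subset[OF inj K(1)] by (auto simp: bij_betw_def)
  have "\<forall>t\<in>E. real_analytic_at \<mu> t" "\<forall>t\<in>\<mu> ` E. real_analytic_at (the_inv_into E \<mu>) t"
    using lift_analytic(1)[OF l] lift_analytic(1)[OF linv] by blast+
  thus ?thesis
    unfolding analytic_diffeo_def using K ri b image_mono[OF K(1), of \<mu>] by blast
qed

text \<open>K is the part of [a, b] on which the lift is defined: all of it for an inner cell,
  half-open for an outermost one.\<close>

lemma leads_pos_of_lift:
  assumes l: "lift g 1 E \<mu>" and ab: "{a..b} \<subseteq> I" "a < b" and K: "K \<subseteq> E" "K \<subseteq> {a..b}" "real_interval K"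
    and c: "K = {a..b} \<or> half_open_interval K \<and> half_open_interval (\<mu> ` K) \<and> (a \<in> K \<or> b \<in> K)"
  shows "leads_pos M {a..b} (tr g) (\<mu> ` K) \<gamma>"
proof -
  note ad = lift_analytic_diffeo[OF l K(1,3)]
  have "K \<noteq> {}" using K(3) by (auto simp: real_interval_def)
  then obtain t where "t \<in> K" by blast
  hence g: "g \<in> carrier G" using germ_carrier[OF lift_germ[OF l]] K(1) by blast
  have sub: "\<mu> ` K \<subseteq> I" using lift_in_I[OF l] K(1) by auto
  have cont: "continuous_on K \<mu>" using l K(1) by (auto simp: lift_def intro: continuous_on_subset)
  have cpt: "compact (\<mu> ` K)" if "K = {a..b}" using compact_continuous_image[OF cont] that by simp
  have Inf_Sup: "Inf {a..b} = a" "Sup {a..b} = b" using ab(2) by auto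
  have cond: "K = {a..b} \<and> compact (\<mu> ` K) \<or>
      half_open_interval K \<and> half_open_interval (\<mu> ` K) \<and> (Inf {a..b} \<in> K \<or> Sup {a..b} \<in> K)"
    unfolding Inf_Sup using c cpt by blast
  have "leads_wrt M {a..b} (tr g) (\<mu> ` K) \<gamma> K \<mu>"
    unfolding leads_wrt_def
  proof (intro conjI ballI)
    show "analytic_immersion M {a..b} (tr g)" by (rule analytic_immersion_tr[OF g real_interval_Icc[OF ab(2)] ab(1)])
    show "analytic_immersion M (\<mu> ` K) \<gamma>"
      by (rule analytic_immersion_\<gamma>[OF analytic_diffeo_strict_mono(4)[OF ad] sub])
    show "tr g t = \<gamma> (\<mu> t)" if "t \<in> K" for t using germ_eq[OF lift_germ[OF l]] that K(1) by blast
  qed (use K(2) ad cond in auto)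
  moreover have "strict_mono_on K \<mu>" using lift_less[OF l] K(1) by (intro strict_mono_onI) blast
  ultimately show ?thesis unfolding leads_pos_def by blast
qed

lemma leads_pos_imp_leads: "leads_pos M C \<beta> D \<delta> \<Longrightarrow> leads M C \<beta> D \<delta>"
  unfolding leads_pos_def leads_def by blast

end

section \<open>The decomposition generated by iterating the translation\<close>

context translated_curve
begin

context
  fixes a assumes a: "a \<in> dom"
begin

text \<open>The starting points differ so that for n > 0 the division points are
  \<open>\<alpha> n = fwd n\<close> and \<open>\<alpha> (- n) = bwd n\<close>; the ends of cell 0
  are then \<open>fwd 1 = rho a\<close> and \<open>bwd 1 = a\<close>.\<close>

definition fwd :: "nat \<Rightarrow> real" where "fwd n = (rho ^^ n) a"
definition bwd :: "nat \<Rightarrow> real" where "bwd n = (sigma ^^ n) (rho a)"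

lemma fwd_simps: "fwd 0 = a" "fwd (Suc 0) = rho a" "fwd (Suc n) = rho (fwd n)"
  and bwd_simps: "bwd 0 = rho a" "bwd (Suc 0) = a" "bwd (Suc n) = sigma (bwd n)"
  by (auto simp: fwd_def bwd_def sigma_rho a)

lemma a_less: "a < rho a" by (rule rho_greater[OF a])

lemma fwd_full:
  assumes "\<And>j. j \<le> m \<Longrightarrow> fwd j \<in> dom"
  shows "leads_pos M {a..rho a} (tr (h [^] m)) {fwd m..fwd (Suc m)} \<gamma>"
proof -
  obtain E \<mu> where E: "lift (h [^] m) 1 E \<mu>" "closed_segment a (rho a) \<subseteq> E" "\<mu> a = (rho ^^ m) a" "\<mu> (rho a) = (rho ^^ Suc m) a"
    using lift_iterate_segment[OF lift_rho h_carrier, of m a] assms unfolding fwd_def by blast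
  have sub: "{a..rho a} \<subseteq> E" using E(2) a_less by (simp add: closed_segment_eq_real_ivl)
  have im: "\<mu> ` {a..rho a} = {fwd m..fwd (Suc m)}"
    using lift_image_segment[OF E(1) sub] a_less E(3,4) by (simp add: fwd_def)
  have "leads_pos M {a..rho a} (tr (h [^] m)) (\<mu> ` {a..rho a}) \<gamma>"
    by (rule leads_pos_of_lift[OF E(1) I_rho[OF a] a_less sub order_refl real_interval_Icc[OF a_less]]) simp
  thus ?thesis by (simp add: im)
qed

lemma bwd_full:
  assumes "\<And>j. j \<le> m \<Longrightarrow> bwd j \<in> ran"
  shows "leads_pos M {a..rho a} (tr (inv h [^] m)) {bwd (Suc m)..bwd m} \<gamma>"
proof -
  obtain E \<mu> where E: "lift (inv h [^] m) 1 E \<mu>" "closed_segment (rho a) (sigma (rho a)) \<subseteq> E"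
      "\<mu> (rho a) = (sigma ^^ m) (rho a)" "\<mu> (sigma (rho a)) = (sigma ^^ Suc m) (rho a)"
    using lift_iterate_segment[OF lift_sigma inv_closed[OF h_carrier], of m "rho a"] assms unfolding bwd_def by blast
  have sub: "{a..rho a} \<subseteq> E" using E(2) a_less by (simp add: closed_segment_eq_real_ivl sigma_rho[OF a])
  have im: "\<mu> ` {a..rho a} = {bwd (Suc m)..bwd m}"
    using lift_image_segment[OF E(1) sub] a_less E(3,4) by (simp add: bwd_def sigma_rho[OF a])
  have "leads_pos M {a..rho a} (tr (inv h [^] m)) (\<mu> ` {a..rho a}) \<gamma>"
    by (rule leads_pos_of_lift[OF E(1) I_rho[OF a] a_less sub order_refl real_interval_Icc[OF a_less]]) simp
  thus ?thesis by (simp add: im)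
qed

text \<open>On the last cell the power of h acts as \<open>rho\<close> after the continuation of
  \<open>h [^] m\<close>, restricted to the part K of [a, rho a] that the latter takes into
  \<open>dom\<close>. The image fills all of I beyond \<open>fwd (Suc m)\<close> because
  \<open>ran\<close> is upward closed.\<close>

lemma fwd_partial:
  assumes dm: "\<And>j. j \<le> m \<Longrightarrow> fwd j \<in> dom" and last: "fwd (Suc m) \<notin> dom"
  shows "leads_pos M {a..rho a} (tr (h [^] Suc m)) {x \<in> I. fwd (Suc m) \<le> x} \<gamma>"
proof -
  obtain E \<mu> where E: "lift (h [^] m) 1 E \<mu>" "closed_segment a (rho a) \<subseteq> E" "\<mu> a = fwd m" "\<mu> (rho a) = fwd (Suc m)"
    using lift_iterate_segment[OF lift_rho h_carrier, of m a] dm unfolding fwd_def by blast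
  have sub: "{a..rho a} \<subseteq> E" using E(2) a_less by (simp add: closed_segment_eq_real_ivl)
  have im: "\<mu> ` {a..rho a} = {fwd m..fwd (Suc m)}"
    using lift_image_segment[OF E(1) sub] a_less E(3,4) by simp
  define E' where "E' = {x \<in> E. \<mu> x \<in> dom}"
  have "lift (h \<otimes> h [^] m) 1 E' (\<lambda>x. rho (\<mu> x))" unfolding E'_def by (rule lift_compose[OF E(1) lift_rho])
  hence l: "lift (h [^] Suc m) 1 E' (\<lambda>x. rho (\<mu> x))" using nat_pow_Suc2[OF h_carrier] by metis
  define K where "K = {a..rho a} \<inter> E'"
  have fm: "fwd m \<in> dom" using dm by simp
  have fI: "fwd (Suc m) \<in> ran" "fwd (Suc m) \<in> I" using rho_ran[OF fm] ran_I by (auto simp: fwd_simps)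
  have aK: "a \<in> K" using sub a_less E(3) fm by (auto simp: K_def E'_def)
  have eK: "rho a \<notin> K" using E(4) last by (simp add: K_def E'_def)
  have iK: "is_interval K" unfolding K_def using lift_is_interval[OF l] by (intro is_interval_Int) (auto simp: is_interval_cc)
  \<comment> \<open>K is relatively open in [a, rho a] and misses \<open>rho a\<close>, so it has no
    greatest element.\<close>
  have noK: "\<exists>x'\<in>K. x < x'" if x: "x \<in> K" for x
  proof -
    have xl: "x < rho a" "a \<le> x" using x eK by (auto simp: K_def less_le)
    have "open E'" using l by (simp add: lift_def)
    moreover have "x \<in> E'" using x by (simp add: K_def)
    ultimately obtain r where r: "r > 0" "ball x r \<subseteq> E'" by (rule openE)
    define x' where "x' = min (x + r/2) (rho a)"
    have "x' \<in> ball x r" "x < x'" "x' \<le> rho a" using r(1) xl by (auto simp: x'_def dist_real_def min_def)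
    thus ?thesis using r(2) xl by (intro bexI[of _ x']) (auto simp: K_def)
  qed
  obtain a' where a': "a' \<in> K" "a < a'" using noK[OF aK] by blast
  have riK: "real_interval K" by (rule real_intervalI[OF iK aK a'])
  have hoK: "half_open_interval K" by (rule half_open_of_min[OF riK aK _ noK]) (simp add: K_def)
  have imK: "(\<lambda>x. rho (\<mu> x)) ` K = {x \<in> I. fwd (Suc m) \<le> x}"
  proof (intro equalityI subsetI)
    fix y assume "y \<in> (\<lambda>x. rho (\<mu> x)) ` K"
    then obtain x where x: "x \<in> K" "y = rho (\<mu> x)" by blast
    have "\<mu> x \<in> {fwd m..fwd (Suc m)}" using x(1) im by (auto simp: K_def)
    moreover have \<mu>x: "\<mu> x \<in> dom" using x(1) by (simp add: K_def E'_def)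
    ultimately have "fwd (Suc m) \<le> y" using rho_le_iff[OF fm \<mu>x] x(2) by (simp add: fwd_simps)
    thus "y \<in> {x \<in> I. fwd (Suc m) \<le> x}" using ran_I[OF rho_ran[OF \<mu>x]] x(2) by simp
  next
    fix y assume "y \<in> {x \<in> I. fwd (Suc m) \<le> x}"
    hence y: "y \<in> I" "fwd (Suc m) \<le> y" by auto
    have yr: "y \<in> ran" by (rule ran_upward[OF fI(1) y])
    have z: "sigma y \<in> dom" "rho (sigma y) = y" by (rule sigma_dom[OF yr], rule rho_sigma[OF yr])
    have "fwd m \<le> sigma y" using rho_le_iff[OF fm z(1)] y(2) z(2) by (simp add: fwd_simps)
    \<comment> \<open>Otherwise the downward closed \<open>dom\<close> would contain
      \<open>fwd (Suc m)\<close>.\<close>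
    moreover have "sigma y \<le> fwd (Suc m)"
      using dom_downward[OF z(1) fI(2)] last by force
    ultimately have "sigma y \<in> \<mu> ` {a..rho a}" using im by simp
    then obtain x where x: "x \<in> {a..rho a}" "sigma y = \<mu> x" by blast
    hence "x \<in> K" using z(1) sub by (auto simp: K_def E'_def)
    thus "y \<in> (\<lambda>x. rho (\<mu> x)) ` K" using x(2) z(2) by (intro image_eqI[of _ _ x]) simp_all
  qed
  have "K \<subseteq> E'" "K \<subseteq> {a..rho a}" by (auto simp: K_def)
  note KE = this
  have riD: "real_interval {x \<in> I. fwd (Suc m) \<le> x}"
    using analytic_diffeo_strict_mono(4)[OF lift_analytic_diffeo[OF l KE(1) riK]] imK by simp
  have hoD: "half_open_interval {x \<in> I. fwd (Suc m) \<le> x}"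
  proof (rule half_open_of_min[OF riD, of "fwd (Suc m)"])
    fix x assume "x \<in> {x \<in> I. fwd (Suc m) \<le> x}"
    hence x: "x \<in> I" "fwd (Suc m) \<le> x" by auto
    obtain r where r: "r > 0" "ball x r \<subseteq> I" using openE[OF open_I x(1)] .
    have "x + r/2 \<in> I" by (rule subsetD[OF r(2)]) (use r(1) in \<open>simp add: dist_real_def\<close>)
    thus "\<exists>x'\<in>{x \<in> I. fwd (Suc m) \<le> x}. x < x'" using x r(1) by (intro bexI[of _ "x + r/2"]) auto
  qed (use fI in auto)
  have "leads_pos M {a..rho a} (tr (h [^] Suc m)) ((\<lambda>x. rho (\<mu> x)) ` K) \<gamma>"
    by (rule leads_pos_of_lift[OF l I_rho[OF a] a_less KE riK]) (use hoK hoD imK aK in simp)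
  thus ?thesis by (simp only: imK)
qed

lemma bwd_partial:
  assumes dm: "\<And>j. j \<le> m \<Longrightarrow> bwd j \<in> ran" and last: "bwd (Suc m) \<notin> ran"
  shows "leads_pos M {a..rho a} (tr (inv h [^] Suc m)) {x \<in> I. x \<le> bwd (Suc m)} \<gamma>"
proof -
  obtain E \<mu> where E: "lift (inv h [^] m) 1 E \<mu>" "closed_segment (rho a) (sigma (rho a)) \<subseteq> E" "\<mu> (rho a) = bwd m" "\<mu> (sigma (rho a)) = bwd (Suc m)"
    using lift_iterate_segment[OF lift_sigma inv_closed[OF h_carrier], of m "rho a"] dm unfolding bwd_def by blast
  have \<mu>a: "\<mu> a = bwd (Suc m)" using E(4) by (simp add: sigma_rho[OF a])
  have sub: "{a..rho a} \<subseteq> E" using E(2) a_less by (simp add: closed_segment_eq_real_ivl sigma_rho[OF a])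
  have im: "\<mu> ` {a..rho a} = {bwd (Suc m)..bwd m}"
    using lift_image_segment[OF E(1) sub] a_less E(3) \<mu>a by simp
  define E' where "E' = {x \<in> E. \<mu> x \<in> ran}"
  have "lift (inv h \<otimes> inv h [^] m) 1 E' (\<lambda>x. sigma (\<mu> x))" unfolding E'_def by (rule lift_compose[OF E(1) lift_sigma])
  hence l: "lift (inv h [^] Suc m) 1 E' (\<lambda>x. sigma (\<mu> x))" using nat_pow_Suc2[OF inv_closed[OF h_carrier]] by metis
  define K where "K = {a..rho a} \<inter> E'"
  have fm: "bwd m \<in> ran" using dm by simp
  have fI: "bwd (Suc m) \<in> dom" "bwd (Suc m) \<in> I" using sigma_dom[OF fm] dom_I by (auto simp: bwd_simps)
  have bK: "rho a \<in> K" using sub a_less E(3) fm by (auto simp: K_def E'_def)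
  have eK: "a \<notin> K" using \<mu>a last by (simp add: K_def E'_def)
  have iK: "is_interval K" unfolding K_def using lift_is_interval[OF l] by (intro is_interval_Int) (auto simp: is_interval_cc)
  have noK: "\<exists>x'\<in>K. x' < x" if x: "x \<in> K" for x
  proof -
    have xl: "x \<le> rho a" "a < x" using x eK by (auto simp: K_def less_le)
    have "open E'" using l by (simp add: lift_def)
    moreover have "x \<in> E'" using x by (simp add: K_def)
    ultimately obtain r where r: "r > 0" "ball x r \<subseteq> E'" by (rule openE)
    define x' where "x' = max (x - r/2) a"
    have "x' \<in> ball x r" "x' < x" "a \<le> x'" using r(1) xl by (auto simp: x'_def dist_real_def max_def)
    thus ?thesis using r(2) xl by (intro bexI[of _ x']) (auto simp: K_def)
  qed
  obtain a' where a': "a' \<in> K" "a' < rho a" using noK[OF bK] by blast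
  have riK: "real_interval K" by (rule real_intervalI[OF iK a'(1) bK a'(2)])
  have hoK: "half_open_interval K" by (rule half_open_of_max[OF riK bK _ noK]) (simp add: K_def)
  have imK: "(\<lambda>x. sigma (\<mu> x)) ` K = {x \<in> I. x \<le> bwd (Suc m)}"
  proof (intro equalityI subsetI)
    fix y assume "y \<in> (\<lambda>x. sigma (\<mu> x)) ` K"
    then obtain x where x: "x \<in> K" "y = sigma (\<mu> x)" by blast
    have "\<mu> x \<in> {bwd (Suc m)..bwd m}" using x(1) im by (auto simp: K_def)
    moreover have \<mu>x: "\<mu> x \<in> ran" using x(1) by (simp add: K_def E'_def)
    ultimately have "y \<le> bwd (Suc m)" using lift_le[OF lift_sigma \<mu>x fm] x(2) by (simp add: bwd_simps)
    thus "y \<in> {x \<in> I. x \<le> bwd (Suc m)}" using dom_I[OF sigma_dom[OF \<mu>x]] x(2) by simp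
  next
    fix y assume "y \<in> {x \<in> I. x \<le> bwd (Suc m)}"
    hence y: "y \<in> I" "y \<le> bwd (Suc m)" by auto
    have yd: "y \<in> dom" by (rule dom_downward[OF fI(1) y])
    have z: "rho y \<in> ran" "sigma (rho y) = y" by (rule rho_ran[OF yd], rule sigma_rho[OF yd])
    have "rho y \<le> rho (bwd (Suc m))" using rho_le_iff[OF yd fI(1)] y(2) by simp
    hence "rho y \<le> bwd m" using rho_sigma[OF fm] by (simp add: bwd_simps)
    moreover have "bwd (Suc m) \<le> rho y"
      using ran_upward[OF z(1) fI(2)] last by force
    ultimately have "rho y \<in> \<mu> ` {a..rho a}" using im by simp
    then obtain x where x: "x \<in> {a..rho a}" "rho y = \<mu> x" by blast
    hence "x \<in> K" using z(1) sub by (auto simp: K_def E'_def)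
    thus "y \<in> (\<lambda>x. sigma (\<mu> x)) ` K" using x(2)[symmetric] z(2) by (intro image_eqI[of _ _ x]) simp_all
  qed
  have "K \<subseteq> E'" "K \<subseteq> {a..rho a}" by (auto simp: K_def)
  note KE = this
  have riD: "real_interval {x \<in> I. x \<le> bwd (Suc m)}"
    using analytic_diffeo_strict_mono(4)[OF lift_analytic_diffeo[OF l KE(1) riK]] imK by simp
  have hoD: "half_open_interval {x \<in> I. x \<le> bwd (Suc m)}"
  proof (rule half_open_of_max[OF riD, of "bwd (Suc m)"])
    fix x assume "x \<in> {x \<in> I. x \<le> bwd (Suc m)}"
    hence x: "x \<in> I" "x \<le> bwd (Suc m)" by auto
    obtain r where r: "r > 0" "ball x r \<subseteq> I" using openE[OF open_I x(1)] .
    have "x - r/2 \<in> I" by (rule subsetD[OF r(2)]) (use r(1) in \<open>simp add: dist_real_def\<close>)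
    thus "\<exists>x'\<in>{x \<in> I. x \<le> bwd (Suc m)}. x' < x" using x r(1) by (intro bexI[of _ "x - r/2"]) auto
  qed (use fI in auto)
  have "leads_pos M {a..rho a} (tr (inv h [^] Suc m)) ((\<lambda>x. sigma (\<mu> x)) ` K) \<gamma>"
    by (rule leads_pos_of_lift[OF l I_rho[OF a] a_less KE riK]) (use hoK hoD imK bK in simp)
  thus ?thesis by (simp only: imK)
qed

lemma fwd_less: "(\<And>k. k < j \<Longrightarrow> fwd k \<in> dom) \<Longrightarrow> i < j \<Longrightarrow> fwd i < fwd j"
proof (induction j)
  case (Suc j)
  have "fwd j < fwd (Suc j)" using rho_greater[of "fwd j"] Suc.prems(1)[of j] by (simp add: fwd_simps)
  moreover have "i = j \<or> fwd i < fwd j" using Suc by (cases "i = j") auto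
  ultimately show ?case by auto
qed simp

lemma bwd_less: "(\<And>k. k < j \<Longrightarrow> bwd k \<in> ran) \<Longrightarrow> i < j \<Longrightarrow> bwd j < bwd i"
proof (induction j)
  case (Suc j)
  have "bwd (Suc j) < bwd j" using sigma_smaller[of "bwd j"] Suc.prems(1)[of j] by (simp add: bwd_simps)
  moreover have "i = j \<or> bwd j < bwd i" using Suc by (cases "i = j") auto
  ultimately show ?case by auto
qed simp

lemma positive_interval_rho: "positive_interval G M \<phi> I \<gamma> {a..rho a}"
proof -
  have "fwd 0 \<in> dom" using a by (simp add: fwd_simps)
  \<comment> \<open>The first n at which \<open>fwd n\<close> leaves \<open>dom\<close>; there cell
    n has no successor and becomes the outermost one.\<close>
  then obtain u where u: "Fin 0 < u" "\<And>n. Fin (int n) < u \<Longrightarrow> fwd n \<in> dom" "\<And>n. Fin (int n) = u \<Longrightarrow> fwd n \<notin> dom"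
    using first_failure[of "\<lambda>n. fwd n \<in> dom"] by blast
  have "bwd 0 \<in> ran" using rho_ran[OF a] by (simp add: bwd_simps)
  then obtain l where l: "l < Fin 0" "\<And>n. l < Fin (- int n) \<Longrightarrow> bwd n \<in> ran" "\<And>n. Fin (- int n) = l \<Longrightarrow> bwd n \<notin> ran"
    using first_failure_negative[of "\<lambda>n. bwd n \<in> ran"] by blast
  define \<alpha> where "\<alpha> i = (if i > 0 then fwd (nat i) else bwd (nat (- i)))" for i
  define g where "g i = h [^] i" for i :: int
  have fd: "fwd k \<in> dom" if "Fin (int j) \<le> u" "k < j" for k j
    using that by (intro u(2)) (cases u, auto)
  have bd: "bwd k \<in> ran" if "l \<le> Fin (- int j)" "k < j" for k j
    using that by (intro l(2)) (cases l, auto)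
  have idx: "(\<exists>j. n = int (Suc j) \<and> Fin (int (Suc j)) \<le> u) \<or> (\<exists>j. n = - int (Suc j) \<and> l \<le> Fin (- int (Suc j)))"
    if "n \<in> dec_index l u" for n
  proof (cases "n > 0")
    case True
    then obtain j where "n = int (Suc j)" by (metis gr0_implies_Suc zero_less_imp_eq_int)
    with that show ?thesis by (auto simp: dec_index_def)
  next
    case False
    hence "- n > 0" using that by (auto simp: dec_index_def)
    then obtain j where "- n = int (Suc j)" by (metis gr0_implies_Suc zero_less_imp_eq_int)
    hence "n = - int (Suc j)" by simp
    with that show ?thesis by (auto simp: dec_index_def)
  qed
  have \<alpha>_pos: "\<alpha> (int (Suc j)) = fwd (Suc j)" and \<alpha>_neg: "\<alpha> (- int (Suc j)) = bwd (Suc j)" for j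
    unfolding \<alpha>_def by (simp_all del: of_nat_Suc)
  have \<alpha>_1: "\<alpha> 1 = rho a" "\<alpha> (- 1) = a" by (simp_all add: \<alpha>_def fwd_simps bwd_simps sigma_rho[OF a])
  have \<alpha>I: "\<alpha> n \<in> I" if "n \<in> dec_index l u" for n
    using idx[OF that]
  proof (elim disjE exE conjE)
    fix j assume "n = int (Suc j)" "Fin (int (Suc j)) \<le> u"
    thus ?thesis using fd[of "Suc j" j] ran_I[OF rho_ran] \<alpha>_pos[of j] by (simp add: fwd_simps)
  next
    fix j assume "n = - int (Suc j)" "l \<le> Fin (- int (Suc j))"
    thus ?thesis using bd[of "Suc j" j] dom_I[OF sigma_dom] \<alpha>_neg[of j] by (simp add: bwd_simps)
  qed
  have mono: "\<alpha> m < \<alpha> n" if "m \<in> dec_index l u" "n \<in> dec_index l u" "m < n" for m n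
    using idx[OF that(1)] idx[OF that(2)]
  proof (elim disjE exE conjE)
    fix i j assume m: "m = int (Suc i)" and n: "n = int (Suc j)" "Fin (int (Suc j)) \<le> u"
    have "fwd (Suc i) < fwd (Suc j)" by (rule fwd_less) (use m n that(3) fd[OF n(2)] in auto)
    thus ?thesis unfolding m n(1) \<alpha>_pos .
  next
    fix i j assume "m = int (Suc i)" "n = - int (Suc j)"
    thus ?thesis using that(3) by simp
  next
    fix i j assume m: "m = - int (Suc i)" "l \<le> Fin (- int (Suc i))" and n: "n = int (Suc j)" "Fin (int (Suc j)) \<le> u"
    have "bwd (Suc i) \<le> a"
      using bwd_less[of "Suc i" "Suc 0"] bd[OF m(2)] by (cases i) (auto simp: bwd_simps(2))
    moreover have "rho a \<le> fwd (Suc j)"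
      using fwd_less[of "Suc j" "Suc 0"] fd[OF n(2)] by (cases j) (auto simp: fwd_simps(2))
    ultimately show ?thesis using a_less unfolding m(1) n(1) \<alpha>_neg \<alpha>_pos by simp
  next
    fix i j assume m: "m = - int (Suc i)" "l \<le> Fin (- int (Suc i))" and n: "n = - int (Suc j)"
    have "bwd (Suc i) < bwd (Suc j)" by (rule bwd_less) (use m n that(3) bd[OF m(2)] in auto)
    thus ?thesis unfolding m(1) n \<alpha>_neg .
  qed
  have lead: "leads_pos M {a..rho a} (tr (g n)) (dec_interval I l u \<alpha> n) \<gamma>" if "n \<in> dec_index l u" for n
    using idx[OF that]
  proof (elim disjE exE conjE)
    fix j assume n: "n = int (Suc j)" "Fin (int (Suc j)) \<le> u"
    have gn: "g n = h [^] Suc j" by (simp only: g_def n(1) int_pow_int)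
    have nl: "Fin n \<noteq> l" "n \<noteq> 0" "\<not> n < 0" using l(1) n(1) by auto
    have "n + 1 = int (Suc (Suc j))" using n(1) by simp
    hence \<alpha>n: "\<alpha> n = fwd (Suc j)" "\<alpha> (n + 1) = fwd (Suc (Suc j))" by (simp_all only: n(1) \<alpha>_pos)
    show ?thesis
    proof (cases "Fin n = u")
      case True
      have "fwd (Suc j) \<notin> dom" using u(3)[of "Suc j"] True n(1) by simp
      from fwd_partial[OF _ this] fd[OF n(2)] have "leads_pos M {a..rho a} (tr (h [^] Suc j)) {x \<in> I. fwd (Suc j) \<le> x} \<gamma>"
        by simp
      thus ?thesis using True nl \<alpha>n(1) gn by (simp add: dec_interval_def)
    next
      case False
      hence "Fin (int (Suc j)) < u" using n by simp
      hence "fwd (Suc j) \<in> dom" by (rule u(2))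
      hence "fwd k \<in> dom" if "k \<le> Suc j" for k using fd[OF n(2), of k] that by (cases "k = Suc j") auto
      from fwd_full[of "Suc j", OF this] show ?thesis using False nl \<alpha>n gn by (simp add: dec_interval_def)
    qed
  next
    fix j assume n: "n = - int (Suc j)" "l \<le> Fin (- int (Suc j))"
    have gn: "g n = inv h [^] Suc j" unfolding g_def n(1) by (simp only: int_pow_neg_int[OF h_carrier] nat_pow_inv[OF h_carrier])
    have nl: "Fin n \<noteq> u" "n \<noteq> 0" "n < 0" using u(1) n(1) by auto
    have "n - 1 = - int (Suc (Suc j))" using n(1) by simp
    hence \<alpha>n: "\<alpha> n = bwd (Suc j)" "\<alpha> (n - 1) = bwd (Suc (Suc j))" by (simp_all only: n(1) \<alpha>_neg)
    show ?thesis
    proof (cases "Fin n = l")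
      case True
      have "bwd (Suc j) \<notin> ran" using l(3)[of "Suc j"] True n(1) by simp
      from bwd_partial[OF _ this] bd[OF n(2)] have "leads_pos M {a..rho a} (tr (inv h [^] Suc j)) {x \<in> I. x \<le> bwd (Suc j)} \<gamma>"
        by simp
      thus ?thesis using True nl \<alpha>n(1) gn by (simp add: dec_interval_def)
    next
      case False
      hence "l < Fin (- int (Suc j))" using n by simp
      hence "bwd (Suc j) \<in> ran" by (rule l(2))
      hence "bwd k \<in> ran" if "k \<le> Suc j" for k using bd[OF n(2), of k] that by (cases "k = Suc j") auto
      from bwd_full[of "Suc j", OF this] show ?thesis using False nl \<alpha>n gn by (simp add: dec_interval_def)
    qed
  qed
  have idx1: "1 \<in> dec_index l u" "- 1 \<in> dec_index l u"
    using u(1) l(1) by (cases u; cases l; auto simp: dec_index_def)+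
  have not1: "\<not> h \<doteq> \<one>" using h_notin by (simp add: stab_iff)
  have cc: "curve_class G \<phi> I \<gamma> (g 1) \<noteq> curve_class G \<phi> I \<gamma> \<one>"
    "curve_class G \<phi> I \<gamma> (g (- 1)) \<noteq> curve_class G \<phi> I \<gamma> \<one>"
  proof -
    show "curve_class G \<phi> I \<gamma> (g 1) \<noteq> curve_class G \<phi> I \<gamma> \<one>"
      using not1 h_carrier by (simp add: g_def curve_class_eq_iff)
    have "inv h \<notin> stab" using h_notin subgroup.m_inv_closed[OF subgroup_stab, of "inv h"] h_carrier by auto
    moreover have "h [^] (- 1 :: int) = inv h" using int_pow_neg[OF h_carrier, of 1] h_carrier by simp
    ultimately show "curve_class G \<phi> I \<gamma> (g (- 1)) \<noteq> curve_class G \<phi> I \<gamma> \<one>"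
      using h_carrier by (simp add: g_def curve_class_eq_iff stab_iff)
  qed
  have dec: "decomposition G M \<phi> I \<gamma> {a..rho a} l u \<alpha> g"
    unfolding decomposition_def
  proof (intro conjI ballI)
    show "free_interval G M \<phi> I \<gamma> {a..rho a}"
      using compact_maximal_rho[OF a] by (simp add: compact_maximal_interval_def maximal_interval_def)
    show "strict_mono_on (dec_index l u) \<alpha>" using mono by (intro strict_mono_onI)
    show "dec_interval I l u \<alpha> 0 = {a..rho a}" by (simp add: dec_interval_def \<alpha>_1)
    show "leads M {a..rho a} (tr (g n)) (dec_interval I l u \<alpha> n) \<gamma>" if "n \<in> dec_index l u" for n
      by (rule leads_pos_imp_leads[OF lead[OF that]])
  qed (use l(1) u(1) \<alpha>I cc h_carrier in \<open>auto simp: g_def\<close>)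
  show ?thesis
    unfolding positive_interval_def
    using compact_maximal_rho[OF a] dec lead[OF idx1(1)] lead[OF idx1(2)] by blast
qed

end

text \<open>For t in \<open>dom\<close> the interval starts slightly left of t. Otherwise t lies
  right of p, and either [p, q] has it in its interior, or t = rho s and an interval starting
  slightly right of s works.\<close>

lemma positive_interval_around:
  assumes t: "t \<in> I"
  shows "\<exists>A. positive_interval G M \<phi> I \<gamma> A \<and> t \<in> interior A"
proof -
  have *: ?thesis if "x \<in> dom" "x < t" "t < rho x" for x
    using positive_interval_rho[OF that(1)] that(2,3) by (intro exI[of _ "{x..rho x}"]) simp
  show ?thesis
  proof (cases "t \<in> dom")
    case True
    have "eventually (\<lambda>x. rho x \<in> {t<..}) (nhds t)"
      by (rule isCont_eventually_in_open[OF lift_isCont[OF lift_rho True]]) (use rho_greater[OF True] in auto)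
    moreover have "eventually (\<lambda>x. x \<in> dom) (nhds t)"
      using lift_rho True by (intro eventually_nhds_in_open) (auto simp: lift_def)
    ultimately have "eventually (\<lambda>x. rho x \<in> {t<..} \<and> x \<in> dom) (nhds t)" by (rule eventually_conj)
    then obtain r where r: "r > 0" "\<forall>x. dist x t < r \<longrightarrow> rho x \<in> {t<..} \<and> x \<in> dom"
      unfolding eventually_nhds_metric by blast
    have "dist (t - r/2) t < r" using r(1) by (simp add: dist_real_def)
    with r(2) have "rho (t - r/2) \<in> {t<..} \<and> t - r/2 \<in> dom" by blast
    thus ?thesis using *[of "t - r/2"] r(1) by simp
  next
    case False
    hence pt: "p < t" using dom_downward[OF p_dom t] by force
    show ?thesis
    proof (cases "t < q")
      case True
      thus ?thesis using *[OF p_dom pt] rho_p by simp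
    next
      case False
      hence tr: "t \<in> ran" using ran_upward[OF q_ran t] by simp
      define s where "s = sigma t"
      have s: "s \<in> dom" "rho s = t" "s < t" using sigma_dom[OF tr] rho_sigma[OF tr] sigma_smaller[OF tr] by (auto simp: s_def)
      have "open dom" using lift_rho by (simp add: lift_def)
      then obtain r where r: "r > 0" "ball s r \<subseteq> dom" using s(1) by (meson openE)
      \<comment> \<open>The bound r/2 keeps x in \<open>dom\<close>, and half of the gap keeps x
        left of t.\<close>
      define m where "m = min (r/2) ((t - s)/2)"
      define x where "x = s + m"
      have "0 < m" using r(1) s(3) by (simp add: m_def)
      moreover have "m \<le> r/2" "m \<le> (t - s)/2"
        unfolding m_def by (rule min.cobounded1, rule min.cobounded2)
      ultimately have x: "s < x" "x < t" "x \<in> ball s r" using r(1) s(3) by (auto simp: x_def dist_real_def)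
      have xd: "x \<in> dom" using r(2) x(3) by blast
      have "t < rho x" using rho_less[OF s(1) xd x(1)] s(2) by simp
      thus ?thesis using *[OF xd x(2)] by simp
    qed
  qed
qed

end

section \<open>The translating class of a positive curve\<close>

lemma leads_pos_cong:
  assumes "leads_pos M C \<beta> D \<gamma>" and eq: "\<And>t. t \<in> C \<Longrightarrow> \<beta> t = \<beta>' t"
  shows "leads_pos M C \<beta>' D \<gamma>"
proof -
  obtain K \<mu> where lw: "leads_wrt M C \<beta> D \<gamma> K \<mu>" and m: "strict_mono_on K \<mu>"
    using assms(1) unfolding leads_pos_def by blast
  from lw have "real_interval C" "\<exists>J \<delta>. C \<subseteq> J \<and> open_analytic_immersion M J \<delta> \<and> (\<forall>t\<in>C. \<delta> t = \<beta> t)"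
    by (auto simp: leads_wrt_def analytic_immersion_def)
  hence "analytic_immersion M C \<beta>'" unfolding analytic_immersion_def using eq by auto
  moreover have "\<forall>t\<in>K. \<beta>' t = \<gamma> (\<mu> t)" using lw eq unfolding leads_wrt_def by (metis subsetD)
  ultimately have "leads_wrt M C \<beta>' D \<gamma> K \<mu>" using lw unfolding leads_wrt_def by blast
  with m show ?thesis unfolding leads_pos_def by blast
qed

text \<open>Cell 1 begins at q, so an increasing parameter for \<open>g 1\<close> must start at p;
  this is the germ from which \<open>rho\<close> is continued.\<close>

lemma (in acted_curve) positive_interval_data:
  assumes pos: "positive_interval G M \<phi> I \<gamma> A"
  obtains l u \<alpha> g p q where "compact_maximal_interval G M \<phi> I \<gamma> A" "decomposition G M \<phi> I \<gamma> A l u \<alpha> g"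
    "1 \<in> dec_index l u" "germ (g 1) p q 1" "g 1 \<notin> stab" "p < q" "rigid {p..q}"
proof -
  obtain l u \<alpha> g where cm: "compact_maximal_interval G M \<phi> I \<gamma> A"
    and dec: "decomposition G M \<phi> I \<gamma> A l u \<alpha> g"
    and lp: "leads_pos M A (tr (g 1)) (dec_interval I l u \<alpha> 1) \<gamma>"
    using pos unfolding positive_interval_def by blast
  have free: "free_interval G M \<phi> I \<gamma> A" "compact A"
    using cm by (auto simp: compact_maximal_interval_def maximal_interval_def)
  hence ri: "real_interval A" "A \<subseteq> I" by (auto simp: free_interval_def)
  obtain p q where pq: "A = {p..q}" "p < q" using compact_real_interval[OF free(2) ri(1)] .
  have rig: "rigid {p..q}" using free_interval_iff_rigid[OF ri] free(1) pq(1) by simp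
  have l0: "l < Fin 0" and u0: "Fin 0 < u" using dec by (auto simp: decomposition_def)
  have i1: "1 \<in> dec_index l u" using l0 u0 by (cases l; cases u; auto simp: dec_index_def)
  have "{\<alpha> (- 1)..\<alpha> 1} = {p..q}" using dec pq(1) by (simp add: decomposition_def dec_interval_def)
  hence \<alpha>1: "\<alpha> 1 = q" using pq(2) by (auto simp: Icc_eq_Icc)
  have \<alpha>I: "\<alpha> n \<in> I" if "n \<in> dec_index l u" for n using dec that by (auto simp: decomposition_def)
  have g: "g 1 \<in> carrier G" using dec i1 by (auto simp: decomposition_def)
  have nl: "Fin 1 \<noteq> l" using l0 by auto
  define D where "D = dec_interval I l u \<alpha> 1"
  have D: "D \<subseteq> I \<and> q \<in> D \<and> (\<forall>x\<in>D. q \<le> x)"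
  proof (cases "Fin 1 = u")
    case True
    thus ?thesis using nl \<alpha>1 \<alpha>I[OF i1] by (auto simp: D_def dec_interval_def)
  next
    case False
    hence i2: "2 \<in> dec_index l u" using l0 u0 by (cases l; cases u; auto simp: dec_index_def)
    have "\<alpha> 1 < \<alpha> 2" using dec i1 i2 by (auto simp: decomposition_def dest: strict_mono_onD)
    moreover have "D = {\<alpha> 1..\<alpha> 2}" using False nl by (simp add: D_def dec_interval_def)
    ultimately show ?thesis using \<alpha>1 I_segment[OF \<alpha>I[OF i1] \<alpha>I[OF i2]] by auto
  qed
  obtain K \<mu> where lw: "leads_wrt M {p..q} (tr (g 1)) D \<gamma> K \<mu>" and m: "strict_mono_on K \<mu>"
    using lp pq(1) unfolding leads_pos_def D_def by blast
  have "germ (g 1) p q 1"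
    by (rule leads_cell_min(1)[OF lw g _ _ _ _ _ m]) (use D pq ri(2) in auto)
  moreover have "g 1 \<notin> stab"
    using dec g by (simp add: decomposition_def curve_class_eq_iff stab_iff)
  ultimately show ?thesis using that cm dec i1 pq(2) rig by blast
qed

theorem proposition6:
  fixes G :: "('g, 'r) monoid_scheme" and L :: "'g manifold"
    and M :: "'m manifold" and \<phi> :: "'g \<Rightarrow> 'm \<Rightarrow> 'm"
    and I :: "real set" and \<gamma> :: "real \<Rightarrow> 'm"
  assumes "analytic_manifold M" and "lie_group G L"
    and "group_action G (topspace (mtop M)) \<phi>"
    and "continuous_in_group G L M \<phi>"
    and "sated G M \<phi>" and "analytic_in_space G M \<phi>"
    and "open_interval I" and "analytic_immersion M I \<gamma>"
    and "free_curve G M \<phi> I \<gamma>" and "positive_curve G M \<phi> I \<gamma>"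
  shows "(\<exists>!c. step_class G M \<phi> I \<gamma> c) \<and>
         (\<forall>c h A l u a g n.
            step_class G M \<phi> I \<gamma> c \<and> h \<in> c \<and>
            compact_maximal_interval G M \<phi> I \<gamma> A \<and> decomposition G M \<phi> I \<gamma> A l u a g \<and>
            n \<in> dec_index l u \<longrightarrow>
            curve_class G \<phi> I \<gamma> (g n) = curve_class G \<phi> I \<gamma> (h [^]\<^bsub>G\<^esub> n) \<and>
            leads_pos M A (translate \<phi> (h [^]\<^bsub>G\<^esub> n) \<gamma>) (dec_interval I l u a n) \<gamma>) \<and>
         (\<forall>A l u a g.
            compact_maximal_interval G M \<phi> I \<gamma> A \<and> decomposition G M \<phi> I \<gamma> A l u a g \<longrightarrow>
            (\<forall>n b'. l < Fin n \<and> n \<le> 0 \<and> b' \<in> interior (dec_interval I l u a (n - 1)) \<longrightarrow>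
               (\<exists>b\<in>interior (dec_interval I l u a n). positive_interval G M \<phi> I \<gamma> {b'..b})) \<and>
            (\<forall>n b. 0 \<le> n \<and> Fin n < u \<and> b \<in> interior (dec_interval I l u a (n + 1)) \<longrightarrow>
               (\<exists>b'\<in>interior (dec_interval I l u a n). positive_interval G M \<phi> I \<gamma> {b'..b}))) \<and>
         (\<forall>t\<in>I. \<exists>A. positive_interval G M \<phi> I \<gamma> A \<and> t \<in> interior A)"
proof -
  interpret acted_curve G M \<phi> I \<gamma>
    by (rule acted_curve.intro) (rule assms)+
  obtain A0 where "positive_interval G M \<phi> I \<gamma> A0" using assms(10) unfolding positive_curve_def by blast
  then obtain l0 u0 \<alpha>0 g0 p q where A0: "compact_maximal_interval G M \<phi> I \<gamma> A0" "decomposition G M \<phi> I \<gamma> A0 l0 u0 \<alpha>0 g0"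
    and i1: "1 \<in> dec_index l0 u0" and g0: "germ (g0 1) p q 1" "g0 1 \<notin> stab" and pq: "p < q" "rigid {p..q}"
    by (rule positive_interval_data)
  have g0c: "g0 1 \<in> carrier G" using g0(1) by (rule germ_carrier)
  define c0 where "c0 = curve_class G \<phi> I \<gamma> (g0 1)"
  \<comment> \<open>Every representative of the class has the same germ from p to q, so each of them
    can play the role of h.\<close>
  have tc: "translated_curve G M \<phi> I \<gamma> h p q" if h: "h \<in> c0" for h
  proof -
    have hg: "h \<doteq> g0 1" using mem_curve_class[OF g0c] h by (simp add: c0_def)
    have "h \<notin> stab" using hg g0(2) by (meson same_translate_sym same_translate_trans stab_iff)
    moreover have "germ h p q 1" by (rule germ_cong[OF same_translate_sym[OF hg] g0(1)])
    ultimately show ?thesis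
      by (intro translated_curve.intro acted_curve_axioms translated_curve_axioms.intro assms(5) pq)
  qed
  have step0: "step_class G M \<phi> I \<gamma> c0"
    unfolding step_class_def
  proof (intro conjI ballI allI impI)
    show "c0 \<in> lcosets\<^bsub>G\<^esub> stab" unfolding c0_def curve_class_def LCOSETS_def using g0c by blast
    show "c0 \<noteq> curve_class G \<phi> I \<gamma> \<one>\<^bsub>G\<^esub>" using g0(2) g0c by (simp add: c0_def curve_class_eq_iff stab_iff)
  next
    fix h A l u a g n
    assume h: "h \<in> c0" and A: "compact_maximal_interval G M \<phi> I \<gamma> A \<and> decomposition G M \<phi> I \<gamma> A l u a g"
      and n: "n \<in> dec_index l u"
    interpret T: translated_curve G M \<phi> I \<gamma> h p q by (rule tc[OF h])
    obtain t where t: "t \<in> T.dom" "A = {t..T.rho t}" using T.compact_maximal_is_rho A by blast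
    have dec: "decomposition G M \<phi> I \<gamma> {t..T.rho t} l u a g" using A t(2) by auto
    have "dec_step G g n \<doteq> h [^]\<^bsub>G\<^esub> sgn n" by (rule T.decomposition_step[OF t(1) dec n])
    thus "curve_class G \<phi> I \<gamma> (dec_step G g n) = curve_class G \<phi> I \<gamma> (h [^]\<^bsub>G\<^esub> sgn n)"
      by (subst curve_class_eq_iff) (auto simp: same_translate_def)
  qed
  have unique: "c = c0" if c: "step_class G M \<phi> I \<gamma> c" for c
  proof -
    \<comment> \<open>A single instance determines c: n = 1 in the decomposition of A0, where the
      step is \<open>g0 1\<close> itself.\<close>
    obtain a where a: "a \<in> carrier G" "c = a <#\<^bsub>G\<^esub> stab" using c unfolding step_class_def LCOSETS_def by blast
    have "a \<in> c" using lcos_self[OF a(1) subgroup_stab] a(2) by simp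
    hence "curve_class G \<phi> I \<gamma> (dec_step G g0 1) = curve_class G \<phi> I \<gamma> (a [^]\<^bsub>G\<^esub> sgn (1::int))"
      using c A0 i1 unfolding step_class_def by blast
    thus ?thesis using a by (simp add: c0_def dec_step_def curve_class_def)
  qed
  have g0_c0: "g0 1 \<in> c0" using lcos_self[OF g0c subgroup_stab] by (simp add: c0_def curve_class_def)
  interpret T: translated_curve G M \<phi> I \<gamma> "g0 1" p q by (rule tc[OF g0_c0])
  show ?thesis
  proof (intro conjI allI impI ballI)
    show "\<exists>!c. step_class G M \<phi> I \<gamma> c" using step0 unique by blast
  next
    fix c h A l u a g n
    assume H: "step_class G M \<phi> I \<gamma> c \<and> h \<in> c \<and> compact_maximal_interval G M \<phi> I \<gamma> A \<and>
      decomposition G M \<phi> I \<gamma> A l u a g \<and> n \<in> dec_index l u"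
    hence h: "h \<in> c0" using unique by blast
    \<comment> \<open>The powers in question are those of h, so each representative gets its own
      instance.\<close>
    interpret H: translated_curve G M \<phi> I \<gamma> h p q by (rule tc[OF h])
    obtain t where t: "t \<in> H.dom" "A = {t..H.rho t}" using H.compact_maximal_is_rho H by blast
    have dec: "decomposition G M \<phi> I \<gamma> {t..H.rho t} l u a g" and n: "n \<in> dec_index l u" using H t(2) by auto
    have gn: "g n \<doteq> h [^]\<^bsub>G\<^esub> n" by (rule H.decomposition_class[OF t(1) dec n])
    thus "curve_class G \<phi> I \<gamma> (g n) = curve_class G \<phi> I \<gamma> (h [^]\<^bsub>G\<^esub> n)"
      by (subst curve_class_eq_iff) (auto simp: same_translate_def)
    show "leads_pos M A (translate \<phi> (h [^]\<^bsub>G\<^esub> n) \<gamma>) (dec_interval I l u a n) \<gamma>"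
      unfolding t(2)
    proof (rule leads_pos_cong[OF H.decomposition_leads_pos[OF t(1) dec n]])
      fix s assume "s \<in> {t..H.rho t}"
      hence "s \<in> I" using H.I_rho[OF t(1)] by blast
      thus "translate \<phi> (g n) \<gamma> s = translate \<phi> (h [^]\<^bsub>G\<^esub> n) \<gamma> s" using gn by (simp add: same_translate_def)
    qed
  next
    fix A l u a g n b'
    assume A: "compact_maximal_interval G M \<phi> I \<gamma> A \<and> decomposition G M \<phi> I \<gamma> A l u a g"
      and n: "l < Fin n \<and> n \<le> 0 \<and> b' \<in> interior (dec_interval I l u a (n - 1))"
    obtain t where t: "t \<in> T.dom" "A = {t..T.rho t}" using T.compact_maximal_is_rho A by blast
    have dec: "decomposition G M \<phi> I \<gamma> {t..T.rho t} l u a g" using A t(2) by auto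
    have "b' \<in> T.dom \<and> T.rho b' \<in> interior (dec_interval I l u a n)"
      using T.shift_from_left[OF t(1) dec] n by blast
    thus "\<exists>b\<in>interior (dec_interval I l u a n). positive_interval G M \<phi> I \<gamma> {b'..b}"
      using T.positive_interval_rho[of b'] by blast
  next
    fix A l u a g n b
    assume A: "compact_maximal_interval G M \<phi> I \<gamma> A \<and> decomposition G M \<phi> I \<gamma> A l u a g"
      and n: "0 \<le> n \<and> Fin n < u \<and> b \<in> interior (dec_interval I l u a (n + 1))"
    obtain t where t: "t \<in> T.dom" "A = {t..T.rho t}" using T.compact_maximal_is_rho A by blast
    have dec: "decomposition G M \<phi> I \<gamma> {t..T.rho t} l u a g" using A t(2) by auto
    have b: "b \<in> T.ran \<and> T.sigma b \<in> interior (dec_interval I l u a n)"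
      using T.shift_from_right[OF t(1) dec] n by blast
    hence "positive_interval G M \<phi> I \<gamma> {T.sigma b..b}"
      using T.positive_interval_rho[OF T.sigma_dom] T.rho_sigma by force
    with b show "\<exists>b'\<in>interior (dec_interval I l u a n). positive_interval G M \<phi> I \<gamma> {b'..b}" by blast
  next
    fix t assume "t \<in> I"
    thus "\<exists>A. positive_interval G M \<phi> I \<gamma> A \<and> t \<in> interior A" by (rule T.positive_interval_around)
  qed
qed

end
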